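(* Let $R$ be a ring, $M$ an $R$-bimodule, $n\ge1$, and let $R\ltimes_n M$ be the $n$-trivial extension. (1) $R\ltimes_n M$ is a semisimple Artinian ring if and only if $R$ is a semisimple Artinian ring and $M\otimes_R X=0$ for any simple left $R$-module $X$. (2) $R\ltimes_n M$ is a left SF ring if and only if $R$ is a left SF ring and $M\otimes_R X=0$ for any simple left $R$-module $X$. (3) $R\ltimes_n M$ is a left V-ring if and only if $R$ is a left V-ring and $\mathrm{Hom}_R(M,X)=0$ for any simple left $R$-module $X$. (4) $R\ltimes_n M$ is a left Kasch ring if and only if $\mathrm{Hom}_R\big(X,\coprod_{i=0}^{n-1}\mathrm{Ann}_{M^{\otimes_R i}}(M)\oplus M\big)\ne0$ for any simple left $R$-module $X$.
   Context: All rings are nonzero, associative, with identity; all modules are unitary. $M^{\otimes_R 0}=R$, $M^{\otimes_R 1}=M$, $M^{\otimes_R (i+1)}=M\otimes_R M^{\otimes_R i}$. The $n$-trivial extension $R\ltimes_n M$ is the abelian group $\coprod_{i=0}^n M^{\otimes_R i}$ with multiplication $(m_0,\dots,m_n)(m_0',\dots,m_n')=\big(\sum_{i+j=k}m_i\otimes m_j'\big)_{0\le k\le n}$ (using the canonical identifications $R\otimes_R N=N$ and $N\otimes_R R=N$). A ring is a left SF ring if every simple left module is flat; a left V-ring if every simple left module is injective; a left Kasch ring if every simple left module embeds in the ring as a left module over itself. For a right $R$-module $A$ and a left $R$-module $B$, $\mathrm{Ann}_B(A)=\{b\in B:a\otimes b=0\text{ in }A\otimes_R B\text{ for all }a\in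 A\}$. $\mathrm{Hom}_R$ denotes left $R$-homomorphisms.
   Formalization: In (4) the last summand M is corrected to its n-th tensor power (the printed form fails for n≥2, e.g. R=k[x,y] localized at (x,y), M=(x,y)R, n=2); modules range over a fixed type large enough for all quotients and ideals, which suffices by Baer's criterion and the ideal test for flatness. *)

theory Defs
  imports "HOL-Algebra.Module" "HOL-Algebra.Generated_Groups" "HOL-Algebra.Free_Abelian_Groups"
begin

section \<open>Modules over a noncommutative ring\<close>

text \<open>The library's \<^locale>\<open>ring\<close> is associative with identity but may be the zero ring, and its
  \<^locale>\<open>module\<close> requires a commutative ring of scalars.  We reuse the record
  \<^typ>\<open>('a, 'b) module\<close> (its multiplicative fields are irrelevant) and drop commutativity.\<close>

locale left_module = R?: ring R + M?: abelian_group M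
  for R :: "('a, 'r) ring_scheme" (structure) and M :: "('a, 'b, 'm) module_scheme" (structure) +
  assumes smult_closed:
      "\<lbrakk>r \<in> carrier R; x \<in> carrier M\<rbrakk> \<Longrightarrow> r \<odot>\<^bsub>M\<^esub> x \<in> carrier M"
    and smult_l_distr:
      "\<lbrakk>r \<in> carrier R; s \<in> carrier R; x \<in> carrier M\<rbrakk> \<Longrightarrow>
        (r \<oplus>\<^bsub>R\<^esub> s) \<odot>\<^bsub>M\<^esub> x = r \<odot>\<^bsub>M\<^esub> x \<oplus>\<^bsub>M\<^esub> s \<odot>\<^bsub>M\<^esub> x"
    and smult_r_distr:
      "\<lbrakk>r \<in> carrier R; x \<in> carrier M; y \<in> carrier M\<rbrakk> \<Longrightarrow>
        r \<odot>\<^bsub>M\<^esub> (x \<oplus>\<^bsub>M\<^esub> y) = r \<odot>\<^bsub>M\<^esub> x \<oplus>\<^bsub>M\<^esub> r \<odot>\<^bsub>M\<^esub> y"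
    and smult_assoc:
      "\<lbrakk>r \<in> carrier R; s \<in> carrier R; x \<in> carrier M\<rbrakk> \<Longrightarrow>
        (r \<otimes>\<^bsub>R\<^esub> s) \<odot>\<^bsub>M\<^esub> x = r \<odot>\<^bsub>M\<^esub> (s \<odot>\<^bsub>M\<^esub> x)"
    and smult_one:
      "x \<in> carrier M \<Longrightarrow> \<one>\<^bsub>R\<^esub> \<odot>\<^bsub>M\<^esub> x = x"

definition opposite_ring :: "('a, 'r) ring_scheme \<Rightarrow> ('a, 'r) ring_scheme" where
  "opposite_ring R = R\<lparr>monoid.mult := \<lambda>x y. y \<otimes>\<^bsub>R\<^esub> x\<rparr>"

text \<open>A right module is a left module over the opposite ring; its scalar multiplication takes the
  scalar first as well, so for a right module $A$ the product $a r$ is written \<open>r \<odot>\<^bsub>A\<^esub> a\<close>.\<close>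

definition right_module :: "('a, 'r) ring_scheme \<Rightarrow> ('a, 'b, 'm) module_scheme \<Rightarrow> bool" where
  "right_module R A \<longleftrightarrow> left_module (opposite_ring R) A"

record ('a, 'b) bimodule = "('a, 'b) module" +
  right_smult :: "'a \<Rightarrow> 'b \<Rightarrow> 'b"

text \<open>The underlying right module of a bimodule: the second scalar multiplication, again with
  the scalar as its first argument, replaces the first one.\<close>

definition right_part :: "('a, 'b, 'm) bimodule_scheme \<Rightarrow> ('a, 'b, 'm) bimodule_scheme" where
  "right_part M = M\<lparr>smult := right_smult M\<rparr>"

definition bimodule :: "('a, 'r) ring_scheme \<Rightarrow> ('a, 'b, 'm) bimodule_scheme \<Rightarrow> bool" where
  "bimodule R M \<longleftrightarrow> left_module R M \<and> right_module R (right_part M) \<and>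
     (\<forall>r \<in> carrier R. \<forall>s \<in> carrier R. \<forall>m \<in> carrier M.
        r \<odot>\<^bsub>M\<^esub> (right_smult M s m) = right_smult M s (r \<odot>\<^bsub>M\<^esub> m))"

definition regular_module :: "('a, 'r) ring_scheme \<Rightarrow> ('a, 'a) module" where
  "regular_module R = \<lparr>carrier = carrier R, monoid.mult = monoid.mult R, one = \<one>\<^bsub>R\<^esub>,
     ring.zero = \<zero>\<^bsub>R\<^esub>, add = add R, smult = monoid.mult R\<rparr>"

text \<open>Homomorphisms are extensional functions, so that \<open>module_hom R M N\<close> is the set
  $\mathrm{Hom}_R(M,N)$ on the nose and $\mathrm{Hom}_R(M,N)=0$ means that it is the singleton of
  the zero map.  For right modules use it over the opposite ring.\<close>

definition module_hom ::
  "('a, 'r) ring_scheme \<Rightarrow> ('a, 'b, 'm) module_scheme \<Rightarrow> ('a, 'c, 'n) module_scheme \<Rightarrow> ('b \<Rightarrow> 'c) set"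
where
  "module_hom R M N = {f \<in> carrier M \<rightarrow>\<^sub>E carrier N.
     (\<forall>x \<in> carrier M. \<forall>y \<in> carrier M. f (x \<oplus>\<^bsub>M\<^esub> y) = f x \<oplus>\<^bsub>N\<^esub> f y) \<and>
     (\<forall>r \<in> carrier R. \<forall>x \<in> carrier M. f (r \<odot>\<^bsub>M\<^esub> x) = r \<odot>\<^bsub>N\<^esub> f x)}"

definition zero_hom ::
  "('a, 'b, 'm) module_scheme \<Rightarrow> ('a, 'c, 'n) module_scheme \<Rightarrow> 'b \<Rightarrow> 'c" where
  "zero_hom M N = (\<lambda>x \<in> carrier M. \<zero>\<^bsub>N\<^esub>)"

definition simple_module :: "('a, 'r) ring_scheme \<Rightarrow> ('a, 'b, 'm) module_scheme \<Rightarrow> bool" where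
  "simple_module R X \<longleftrightarrow> left_module R X \<and> carrier X \<noteq> {\<zero>\<^bsub>X\<^esub>} \<and>
     (\<forall>N. submodule N R X \<longrightarrow> N = {\<zero>\<^bsub>X\<^esub>} \<or> N = carrier X)"

definition module_direct_sum ::
  "('a, 'b, 'm) module_scheme \<Rightarrow> ('a, 'c, 'n) module_scheme \<Rightarrow> ('a, 'b \<times> 'c) module" where
  "module_direct_sum A B = \<lparr>carrier = carrier A \<times> carrier B, monoid.mult = undefined, one = undefined,
     ring.zero = (\<zero>\<^bsub>A\<^esub>, \<zero>\<^bsub>B\<^esub>), add = (\<lambda>(a, b) (a', b'). (a \<oplus>\<^bsub>A\<^esub> a', b \<oplus>\<^bsub>B\<^esub> b')),
     smult = (\<lambda>r (a, b). (r \<odot>\<^bsub>A\<^esub> a, r \<odot>\<^bsub>B\<^esub> b))\<rparr>"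

definition module_coproduct ::
  "'i set \<Rightarrow> ('i \<Rightarrow> ('a, 'b, 'm) module_scheme) \<Rightarrow> ('a, 'i \<Rightarrow> 'b) module" where
  "module_coproduct I N = \<lparr>
     carrier = {f \<in> (\<Pi>\<^sub>E i \<in> I. carrier (N i)). finite {i \<in> I. f i \<noteq> \<zero>\<^bsub>N i\<^esub>}},
     monoid.mult = undefined, one = undefined,
     ring.zero = (\<lambda>i \<in> I. \<zero>\<^bsub>N i\<^esub>), add = (\<lambda>f g. \<lambda>i \<in> I. f i \<oplus>\<^bsub>N i\<^esub> g i),
     smult = (\<lambda>r f. \<lambda>i \<in> I. r \<odot>\<^bsub>N i\<^esub> f i)\<rparr>"


section \<open>Tensor products\<close>

text \<open>For a right module $A$ and a left module $B$, the group $A\otimes_R B$ is the free abelian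
  group on $A\times B$ modulo the biadditivity and balancedness relations.  It is a library
  \<^const>\<open>FactGroup\<close>, hence written multiplicatively: \<open>\<one>\<close> is the zero tensor.\<close>

definition tensor_relations ::
  "('a, 'r) ring_scheme \<Rightarrow> ('a, 'b, 'm) module_scheme \<Rightarrow> ('a, 'c, 'n) module_scheme \<Rightarrow>
    ('b \<times> 'c \<Rightarrow>\<^sub>0 int) set" where
  "tensor_relations R A B = generate (free_Abelian_group (carrier A \<times> carrier B))
     ({frag_of (a \<oplus>\<^bsub>A\<^esub> a', b) - frag_of (a, b) - frag_of (a', b) | a a' b.
         a \<in> carrier A \<and> a' \<in> carrier A \<and> b \<in> carrier B} \<union>
      {frag_of (a, b \<oplus>\<^bsub>B\<^esub> b') - frag_of (a, b) - frag_of (a, b') | a b b'.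
         a \<in> carrier A \<and> b \<in> carrier B \<and> b' \<in> carrier B} \<union>
      {frag_of (r \<odot>\<^bsub>A\<^esub> a, b) - frag_of (a, r \<odot>\<^bsub>B\<^esub> b) | a r b.
         a \<in> carrier A \<and> r \<in> carrier R \<and> b \<in> carrier B})"

definition tensor ::
  "('a, 'r) ring_scheme \<Rightarrow> ('a, 'b, 'm) module_scheme \<Rightarrow> ('a, 'c, 'n) module_scheme \<Rightarrow>
    ('b \<times> 'c \<Rightarrow>\<^sub>0 int) set monoid" where
  "tensor R A B =
     free_Abelian_group (carrier A \<times> carrier B) Mod tensor_relations R A B"

definition tensor_class ::
  "('a, 'r) ring_scheme \<Rightarrow> ('a, 'b, 'm) module_scheme \<Rightarrow> ('a, 'c, 'n) module_scheme \<Rightarrow>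
    ('b \<times> 'c \<Rightarrow>\<^sub>0 int) \<Rightarrow> ('b \<times> 'c \<Rightarrow>\<^sub>0 int) set" where
  "tensor_class R A B x =
     tensor_relations R A B #>\<^bsub>free_Abelian_group (carrier A \<times> carrier B)\<^esub> x"

definition pure_tensor ::
  "('a, 'r) ring_scheme \<Rightarrow> ('a, 'b, 'm) module_scheme \<Rightarrow> ('a, 'c, 'n) module_scheme \<Rightarrow>
    'b \<Rightarrow> 'c \<Rightarrow> ('b \<times> 'c \<Rightarrow>\<^sub>0 int) set" where
  "pure_tensor R A B a b = tensor_class R A B (frag_of (a, b))"

text \<open>The map $f\otimes g$ into $A'\otimes_R B'$ applied to a coset \<open>C\<close>: for homomorphisms \<open>f\<close>
  and \<open>g\<close> all members of the union are the same coset.\<close>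

definition tensor_map ::
  "('a, 'r) ring_scheme \<Rightarrow> ('a, 'd, 'm) module_scheme \<Rightarrow> ('a, 'e, 'n) module_scheme \<Rightarrow>
    ('b \<Rightarrow> 'd) \<Rightarrow> ('c \<Rightarrow> 'e) \<Rightarrow> ('b \<times> 'c \<Rightarrow>\<^sub>0 int) set \<Rightarrow> ('d \<times> 'e \<Rightarrow>\<^sub>0 int) set" where
  "tensor_map R A' B' f g C =
     (\<Union>x \<in> C. tensor_class R A' B' (frag_extend (\<lambda>(a, b). frag_of (f a, g b)) x))"

definition tensor_module ::
  "('a, 'r) ring_scheme \<Rightarrow> ('a, 'b, 'm) bimodule_scheme \<Rightarrow> ('a, 'c, 'n) module_scheme \<Rightarrow>
    ('a, ('b \<times> 'c \<Rightarrow>\<^sub>0 int) set) module" where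
  "tensor_module R M B = (let T = tensor R (right_part M) B in
     \<lparr>carrier = carrier T, monoid.mult = undefined, one = undefined, ring.zero = \<one>\<^bsub>T\<^esub>, add = monoid.mult T,
      smult = (\<lambda>r. tensor_map R (right_part M) B (\<lambda>m. r \<odot>\<^bsub>M\<^esub> m) (\<lambda>b. b))\<rparr>)"

definition tensor_annihilator ::
  "('a, 'r) ring_scheme \<Rightarrow> ('a, 'b, 'm) module_scheme \<Rightarrow> ('a, 'c, 'n) module_scheme \<Rightarrow> 'c set"
where
  "tensor_annihilator R A B =
     {b \<in> carrier B. \<forall>a \<in> carrier A. pure_tensor R A B a b = \<one>\<^bsub>tensor R A B\<^esub>}"


section \<open>Classes of rings\<close>

text \<open>A definition cannot quantify over all types, so the notions below take the type \<open>'u\<close> of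
  elements of the modules under consideration as a parameter.  They are the intended notions as
  soon as \<open>'u\<close> is large enough to contain copies of all quotients of the regular modules.\<close>

definition flat_module ::
  "'u itself \<Rightarrow> ('a, 'r) ring_scheme \<Rightarrow> ('a, 'b, 'm) module_scheme \<Rightarrow> bool" where
  "flat_module U R X \<longleftrightarrow> left_module R X \<and>
     (\<forall>(A :: ('a, 'u) module) (B :: ('a, 'u) module). \<forall>f \<in> module_hom (opposite_ring R) A B.
        right_module R A \<and> right_module R B \<and> inj_on f (carrier A) \<longrightarrow>
        inj_on (tensor_map R B X f (\<lambda>x. x)) (carrier (tensor R A X)))"

definition injective_module ::
  "'u itself \<Rightarrow> ('a, 'r) ring_scheme \<Rightarrow> ('a, 'b, 'm) module_scheme \<Rightarrow> bool" where
  "injective_module U R X \<longleftrightarrow> left_module R X \<and>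
     (\<forall>(A :: ('a, 'u) module) (B :: ('a, 'u) module). \<forall>f \<in> module_hom R A B.
        \<forall>g \<in> module_hom R A X.
        left_module R A \<and> left_module R B \<and> inj_on f (carrier A) \<longrightarrow>
        (\<exists>h \<in> module_hom R B X. \<forall>a \<in> carrier A. h (f a) = g a))"

definition left_SF_ring :: "'u itself \<Rightarrow> ('a, 'r) ring_scheme \<Rightarrow> bool" where
  "left_SF_ring U R \<longleftrightarrow> ring R \<and>
     (\<forall>X :: ('a, 'u) module. simple_module R X \<longrightarrow> flat_module U R X)"

definition left_V_ring :: "'u itself \<Rightarrow> ('a, 'r) ring_scheme \<Rightarrow> bool" where
  "left_V_ring U R \<longleftrightarrow> ring R \<and>
     (\<forall>X :: ('a, 'u) module. simple_module R X \<longrightarrow> injective_module U R X)"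

definition left_Kasch_ring :: "'u itself \<Rightarrow> ('a, 'r) ring_scheme \<Rightarrow> bool" where
  "left_Kasch_ring U R \<longleftrightarrow> ring R \<and>
     (\<forall>X :: ('a, 'u) module. simple_module R X \<longrightarrow>
        (\<exists>f \<in> module_hom R X (regular_module R). inj_on f (carrier X)))"

text \<open>A module is semisimple if it is the sum of its simple submodules, i.e. the smallest submodule
  containing them is everything.\<close>

definition semisimple_module :: "('a, 'r) ring_scheme \<Rightarrow> ('a, 'b, 'm) module_scheme \<Rightarrow> bool" where
  "semisimple_module R M \<longleftrightarrow> left_module R M \<and>
     \<Inter>{N. submodule N R M \<and>
          (\<forall>S. submodule S R M \<and> simple_module R (M\<lparr>carrier := S\<rparr>) \<longrightarrow> S \<subseteq> N)} = carrier M"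

definition artinian_module :: "('a, 'r) ring_scheme \<Rightarrow> ('a, 'b, 'm) module_scheme \<Rightarrow> bool" where
  "artinian_module R M \<longleftrightarrow> left_module R M \<and>
     (\<forall>N :: nat \<Rightarrow> 'b set. (\<forall>k. submodule (N k) R M \<and> N (Suc k) \<subseteq> N k) \<longrightarrow>
        (\<exists>k. \<forall>l \<ge> k. N l = N k))"

text \<open>By Wedderburn--Artin the left-right choice is immaterial.\<close>

definition semisimple_artinian_ring :: "('a, 'r) ring_scheme \<Rightarrow> bool" where
  "semisimple_artinian_ring R \<longleftrightarrow> ring R \<and>
     semisimple_module R (regular_module R) \<and> artinian_module R (regular_module R)"


section \<open>Tensor powers and the n-trivial extension\<close>

text \<open>The element type of a tensor power may not depend on the exponent.  So the elements of
  $M^{\otimes 0}=R$ and $M^{\otimes 1}=M$ are tagged, and an element of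
  $M^{\otimes(i+1)}=M\otimes_R M^{\otimes i}$ ($i\ge1$) is named by a chosen list of pairs
  whose pure tensors add up to it; every tensor is such a sum, as $-(m\otimes x)=(-m)\otimes x$.
  The naming is injective, and the structure is transported along it.\<close>

datatype ('a, 'm) tpow_elem =
    Scal (the_scal: 'a)
  | Vec (the_vec: 'm)
  | Ten "('m \<times> ('a, 'm) tpow_elem) list"

definition name_tensor ::
  "('m \<times> ('a, 'm) tpow_elem \<Rightarrow>\<^sub>0 int) set \<Rightarrow> ('a, 'm) tpow_elem" where
  "name_tensor C = Ten (SOME ps. (\<Sum>p\<leftarrow>ps. frag_of p) \<in> C)"

definition transport_module ::
  "('b \<Rightarrow> 'c) \<Rightarrow> ('a, 'b, 'm) module_scheme \<Rightarrow> ('a, 'c) module" where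
  "transport_module \<phi> N = (let \<psi> = inv_into (carrier N) \<phi> in
     \<lparr>carrier = \<phi> ` carrier N, monoid.mult = undefined, one = undefined, ring.zero = \<phi> \<zero>\<^bsub>N\<^esub>,
      add = (\<lambda>x y. \<phi> (\<psi> x \<oplus>\<^bsub>N\<^esub> \<psi> y)), smult = (\<lambda>r x. \<phi> (r \<odot>\<^bsub>N\<^esub> \<psi> x))\<rparr>)"

text \<open>\<open>tensor_power R M i\<close> is $M^{\otimes i}$ as a left module (its right module structure is
  not needed).\<close>

fun tensor_power ::
  "('a, 'r) ring_scheme \<Rightarrow> ('a, 'm, 'z) bimodule_scheme \<Rightarrow> nat \<Rightarrow> ('a, ('a, 'm) tpow_elem) module"
where
  "tensor_power R M 0 = transport_module Scal (regular_module R)"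
| "tensor_power R M (Suc 0) = transport_module Vec M"
| "tensor_power R M (Suc (Suc i)) =
     transport_module name_tensor (tensor_module R M (tensor_power R M (Suc i)))"

text \<open>\<open>tpow_mult R M i j x y\<close> is $x\otimes y$ for $x\in M^{\otimes i}$ and $y\in M^{\otimes j}$, as an
  element of $M^{\otimes(i+j)}$ under the canonical identifications $R\otimes_R N=N$,
  $N\otimes_R R=N$ and $(m\otimes x)\otimes y=m\otimes(x\otimes y)$.\<close>

fun tpow_mult ::
  "('a, 'r) ring_scheme \<Rightarrow> ('a, 'm, 'z) bimodule_scheme \<Rightarrow> nat \<Rightarrow> nat \<Rightarrow>
    ('a, 'm) tpow_elem \<Rightarrow> ('a, 'm) tpow_elem \<Rightarrow> ('a, 'm) tpow_elem" where
  "tpow_mult R M 0 j x y = the_scal x \<odot>\<^bsub>tensor_power R M j\<^esub> y"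
| "tpow_mult R M (Suc 0) 0 x y = Vec (right_smult M (the_scal y) (the_vec x))"
| "tpow_mult R M (Suc 0) (Suc j) x y =
     name_tensor (pure_tensor R (right_part M) (tensor_power R M (Suc j)) (the_vec x) y)"
| "tpow_mult R M (Suc (Suc i)) j x y =
     name_tensor (tensor_map R (right_part M) (tensor_power R M (Suc i + j))
       (\<lambda>m. m) (\<lambda>z. tpow_mult R M (Suc i) j z y)
       (inv_into (carrier (tensor_module R M (tensor_power R M (Suc i)))) name_tensor x))"

definition trivial_extension ::
  "nat \<Rightarrow> ('a, 'r) ring_scheme \<Rightarrow> ('a, 'm, 'z) bimodule_scheme \<Rightarrow> (nat \<Rightarrow> ('a, 'm) tpow_elem) ring"
where
  "trivial_extension n R M = \<lparr>
     carrier = (\<Pi>\<^sub>E k \<in> {..n}. carrier (tensor_power R M k)),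
     monoid.mult = (\<lambda>x y. \<lambda>k \<in> {..n}.
       \<Oplus>\<^bsub>tensor_power R M k\<^esub>i \<in> {..k}. tpow_mult R M i (k - i) (x i) (y (k - i))),
     one = (\<lambda>k \<in> {..n}. if k = 0 then Scal \<one>\<^bsub>R\<^esub> else \<zero>\<^bsub>tensor_power R M k\<^esub>),
     ring.zero = (\<lambda>k \<in> {..n}. \<zero>\<^bsub>tensor_power R M k\<^esub>),
     add = (\<lambda>x y. \<lambda>k \<in> {..n}. x k \<oplus>\<^bsub>tensor_power R M k\<^esub> y k)\<rparr>"

text \<open>The left $R$-module $\coprod_{i=0}^{n-1}\mathrm{Ann}_{M^{\otimes i}}(M)\oplus M^{\otimes n}$: the
  part of the extension annihilated by left multiplication with $(0,m,0,\dots,0)$, $m\in M$.  The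
  last summand is $M$ for $n=1$, but for $n\ge2$ it has to be $M^{\otimes n}$ and not $M$: for $R$ the
  localization of $k[x,y]$ at $(x,y)$, $M$ its maximal ideal and $n=2$ the extension is Kasch
  ($x\otimes y-y\otimes x$ spans a copy of the only simple module in $M\otimes M$), although $M$
  is torsion-free and both annihilators vanish.\<close>

definition kasch_test_module ::
  "nat \<Rightarrow> ('a, 'r) ring_scheme \<Rightarrow> ('a, 'm, 'z) bimodule_scheme \<Rightarrow>
    ('a, (nat \<Rightarrow> ('a, 'm) tpow_elem) \<times> ('a, 'm) tpow_elem) module" where
  "kasch_test_module n R M = module_direct_sum
     (module_coproduct {..<n} (\<lambda>i. (tensor_power R M i)
        \<lparr>carrier := tensor_annihilator R (right_part M) (tensor_power R M i)\<rparr>))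
     (tensor_power R M n)"

text \<open>The element type for modules.  The first summand makes it large enough for both \<^term>\<open>R\<close> and
  the extension: it has room for every set of cosets in either ring.  The second summand is an
  arbitrary type, so that every module, on whatever type, is isomorphic to one on \<open>univ\<close>
  for some \<open>'v\<close>.\<close>

type_synonym ('a, 'm, 'v) univ = "(nat \<Rightarrow> ('a, 'm) tpow_elem) set + 'v"

end

theory Submission
  imports Defs
begin

text \<open>Write $S = R\ltimes_n M$ and let $I$ be the kernel of the projection $S\to R$.  The ideal $I$
  is nilpotent and is generated by $M$, which sits in degree one.  Hence $I$ kills every simple
  $S$-module, and the simple modules of $S$ and of $R$ are the same.

  If every simple $S$-module $X$ is flat, the inclusion $I\subseteq S$ gives $I\otimes_S X=0$, and
  $M\otimes_R X$ is a quotient of this group.  Conversely, if $M\otimes_R X=0$, then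
  $a i\otimes x=0$ already in $A\otimes_R X$ for $i\in I$, so that $A\otimes_S X=A\otimes_R X$.

  If every simple $S$-module $X$ is injective, $f\colon M\to X$ composed with the projection
  $I\to M$ extends to $S$, and the extension vanishes on $I = I\cdot 1$.  Conversely, if
  $\mathrm{Hom}_R(M,X)=0$, an $R$-linear extension $h\colon B\to X$ is $S$-linear, because
  $m\mapsto h(m b)$ is zero for every $b\in B$.

  If $S$ is semisimple, its simple left ideals lie in the annihilator of $I$, so $I=0$.  If $R$ is
  semisimple and $M\otimes_R X=0$ for all simple $X$, every simple left ideal $L$ of $R$ satisfies
  $ML=0$, so $M=0$.  In both cases $S\cong R$.

  A homomorphism from a simple module to $S$ takes its values in $\{s : Is=0\}$, and this is the
  module of the Kasch criterion.\<close>

section \<open>Modules\<close>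

text \<open>All four criteria are proved for an abstract ring \<open>S\<close> with a split
  projection onto \<open>R\<close>, a degree-one part and a finite filtration; tensor powers and
  their chosen names matter only where these data are produced and where the annihilator of the
  kernel is computed.

  The obstacle for SF rings is the comparison of tensor products over \<open>S\<close> and over
  \<open>R\<close>. Both are quotients of the same free abelian group, so it suffices that the two
  subgroups of relations coincide as sets. The groups and the induced maps are then equal, and no
  isomorphism has to be carried along.

  Flatness and injectivity are tested on modules with elements in a fixed type. The test modules
  \<open>I\<close> and \<open>S\<close>, and in the semisimple case the simple left ideals of
  \<open>R\<close>, must therefore be copied into that type; an injection of \<open>S\<close>
  supplies the copies.

  The Kasch module gets its shape from the degree bound: left multiplication by M raises degrees by
  one, so it constrains each component below n, while products with component n fall outside the
  range.\<close>

lemma opposite_ring_simps [simp]: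
  "carrier (opposite_ring R) = carrier R"
  "add (opposite_ring R) = add R"
  "\<zero>\<^bsub>opposite_ring R\<^esub> = \<zero>\<^bsub>R\<^esub>"
  "\<one>\<^bsub>opposite_ring R\<^esub> = \<one>\<^bsub>R\<^esub>"
  "x \<otimes>\<^bsub>opposite_ring R\<^esub> y = y \<otimes>\<^bsub>R\<^esub> x"
  by (simp_all add: opposite_ring_def)

lemma right_part_simps [simp]:
  "carrier (right_part M) = carrier M"
  "add (right_part M) = add M"
  "\<zero>\<^bsub>right_part M\<^esub> = \<zero>\<^bsub>M\<^esub>"
  "r \<odot>\<^bsub>right_part M\<^esub> m = right_smult M r m"
  by (simp_all add: right_part_def)

text \<open>Tensor products arrive as multiplicatively written quotient groups, whereas a module
  needs an additive group on the same elements; this is the bridge between the two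
  notations.\<close>

lemma abelian_group_of_comm_group:
  assumes "comm_group G" "carrier H = carrier G" "add H = monoid.mult G" "\<zero>\<^bsub>H\<^esub> = \<one>\<^bsub>G\<^esub>"
  shows "abelian_group H"
proof -
  interpret comm_group G by fact
  show ?thesis
    using assms(2-4) by (intro abelian_groupI) (auto simp: m_ac intro: l_inv_ex)
qed

lemma abelian_group_cong:
  assumes "abelian_group G" "carrier H = carrier G" "add H = add G" "\<zero>\<^bsub>H\<^esub> = \<zero>\<^bsub>G\<^esub>"
  shows "abelian_group H"
  using abelian_group_of_comm_group[OF abelian_group.a_comm_group[OF assms(1)]] assms(2-4) by simp

lemma ring_opposite_ring:
  assumes "ring R"
  shows "ring (opposite_ring R)"
proof -
  interpret ring R by fact
  have "abelian_group (opposite_ring R)"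
    by (rule abelian_group_cong[OF is_abelian_group]) simp_all
  then show ?thesis
    by (intro ringI monoid.intro) (auto simp: m_assoc l_distr r_distr)
qed

section \<open>Modules and submodules over a noncommutative ring\<close>

lemma left_module_abelian_group: "left_module R X \<Longrightarrow> abelian_group X"
  by (simp add: left_module_def)

lemma left_moduleI:
  assumes "ring R" "abelian_group X"
    and "\<And>r x. \<lbrakk>r \<in> carrier R; x \<in> carrier X\<rbrakk> \<Longrightarrow> r \<odot>\<^bsub>X\<^esub> x \<in> carrier X"
    and "\<And>r s x. \<lbrakk>r \<in> carrier R; s \<in> carrier R; x \<in> carrier X\<rbrakk> \<Longrightarrow>
        (r \<oplus>\<^bsub>R\<^esub> s) \<odot>\<^bsub>X\<^esub> x = r \<odot>\<^bsub>X\<^esub> x \<oplus>\<^bsub>X\<^esub> s \<odot>\<^bsub>X\<^esub> x"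
    and "\<And>r x y. \<lbrakk>r \<in> carrier R; x \<in> carrier X; y \<in> carrier X\<rbrakk> \<Longrightarrow>
        r \<odot>\<^bsub>X\<^esub> (x \<oplus>\<^bsub>X\<^esub> y) = r \<odot>\<^bsub>X\<^esub> x \<oplus>\<^bsub>X\<^esub> r \<odot>\<^bsub>X\<^esub> y"
    and "\<And>r s x. \<lbrakk>r \<in> carrier R; s \<in> carrier R; x \<in> carrier X\<rbrakk> \<Longrightarrow>
        (r \<otimes>\<^bsub>R\<^esub> s) \<odot>\<^bsub>X\<^esub> x = r \<odot>\<^bsub>X\<^esub> (s \<odot>\<^bsub>X\<^esub> x)"
    and "\<And>x. x \<in> carrier X \<Longrightarrow> \<one>\<^bsub>R\<^esub> \<odot>\<^bsub>X\<^esub> x = x"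
  shows "left_module R X"
  using assms by (simp add: left_module_def left_module_axioms_def)

lemma (in left_module) smult_zero_right [simp]:
  assumes "r \<in> carrier R" shows "r \<odot>\<^bsub>M\<^esub> \<zero>\<^bsub>M\<^esub> = \<zero>\<^bsub>M\<^esub>"
proof -
  have "r \<odot>\<^bsub>M\<^esub> \<zero>\<^bsub>M\<^esub> \<oplus>\<^bsub>M\<^esub> r \<odot>\<^bsub>M\<^esub> \<zero>\<^bsub>M\<^esub> = r \<odot>\<^bsub>M\<^esub> \<zero>\<^bsub>M\<^esub> \<oplus>\<^bsub>M\<^esub> \<zero>\<^bsub>M\<^esub>"
    using smult_r_distr[OF assms, of "\<zero>\<^bsub>M\<^esub>" "\<zero>\<^bsub>M\<^esub>"] smult_closed[OF assms] by simp
  then show ?thesis using smult_closed[OF assms] by simp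
qed

lemma (in left_module) smult_zero_left [simp]:
  assumes "x \<in> carrier M" shows "\<zero>\<^bsub>R\<^esub> \<odot>\<^bsub>M\<^esub> x = \<zero>\<^bsub>M\<^esub>"
proof -
  have "\<zero>\<^bsub>R\<^esub> \<odot>\<^bsub>M\<^esub> x \<oplus>\<^bsub>M\<^esub> \<zero>\<^bsub>R\<^esub> \<odot>\<^bsub>M\<^esub> x = \<zero>\<^bsub>R\<^esub> \<odot>\<^bsub>M\<^esub> x \<oplus>\<^bsub>M\<^esub> \<zero>\<^bsub>M\<^esub>"
    using smult_l_distr[of "\<zero>\<^bsub>R\<^esub>" "\<zero>\<^bsub>R\<^esub>" x] smult_closed assms by simp
  then show ?thesis using smult_closed assms by simp
qed

lemma (in left_module) smult_minus_one:
  assumes "x \<in> carrier M" shows "(\<ominus>\<^bsub>R\<^esub> \<one>\<^bsub>R\<^esub>) \<odot>\<^bsub>M\<^esub> x = \<ominus>\<^bsub>M\<^esub> x"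
proof -
  have "x \<oplus>\<^bsub>M\<^esub> (\<ominus>\<^bsub>R\<^esub> \<one>\<^bsub>R\<^esub>) \<odot>\<^bsub>M\<^esub> x = \<zero>\<^bsub>M\<^esub>"
    using smult_l_distr[of "\<one>\<^bsub>R\<^esub>" "\<ominus>\<^bsub>R\<^esub> \<one>\<^bsub>R\<^esub>" x] assms by (simp add: R.r_neg smult_one)
  then show ?thesis
    using assms smult_closed[of "\<ominus>\<^bsub>R\<^esub> \<one>\<^bsub>R\<^esub>" x] M.minus_equality M.a_comm
    by (metis R.add.inv_closed R.one_closed)
qed

text \<open>Since -x = (-1)x, closure under negatives follows from closure under scalars, so the
  inverse clause of a subgroup need not be checked.\<close>

lemma submodule_iff:
  assumes "left_module R X"
  shows "submodule N R X \<longleftrightarrow> N \<subseteq> carrier X \<and> \<zero>\<^bsub>X\<^esub> \<in> N \<and>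
     (\<forall>x\<in>N. \<forall>y\<in>N. x \<oplus>\<^bsub>X\<^esub> y \<in> N) \<and> (\<forall>r\<in>carrier R. \<forall>x\<in>N. r \<odot>\<^bsub>X\<^esub> x \<in> N)" (is "_ \<longleftrightarrow> ?Q")
proof
  assume "submodule N R X"
  then interpret submodule N R X .
  show ?Q using subset one_closed m_closed by auto
next
  interpret X: left_module R X by fact
  assume Q: ?Q
  have "\<ominus>\<^bsub>X\<^esub> x \<in> N" if "x \<in> N" for x
    using Q that X.smult_minus_one[of x] by (metis X.R.add.inv_closed X.R.one_closed subsetD)
  then show "submodule N R X"
    using Q by (intro submodule.intro subgroup.intro submodule_axioms.intro) (auto simp: a_inv_def)
qed

lemma left_module_submodule:
  assumes "left_module R X" "submodule N R X"
  shows "left_module R (X\<lparr>carrier := N\<rparr>)"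
proof -
  interpret X: left_module R X by fact
  note N = assms(2)[unfolded submodule_iff[OF assms(1)]]
  have sub: "subgroup N (add_monoid X)" using assms(2) by (simp add: submodule_def)
  have "comm_group (add_monoid X\<lparr>carrier := N\<rparr>)"
    by (intro group.group_comm_groupI subgroup.subgroup_is_group[OF sub] X.a_group)
      (use N in \<open>auto simp: X.M.a_comm subsetD\<close>)
  then have "abelian_group (X\<lparr>carrier := N\<rparr>)"
    by (rule abelian_group_of_comm_group) simp_all
  then show ?thesis
    using N by (intro left_moduleI) (auto simp: X.smult_closed X.smult_l_distr X.smult_r_distr
        X.smult_assoc X.smult_one subsetD X.R.ring_axioms)
qed

lemma regular_module_simps [simp]:
  "carrier (regular_module R) = carrier R"
  "add (regular_module R) = add R"
  "\<zero>\<^bsub>regular_module R\<^esub> = \<zero>\<^bsub>R\<^esub>"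
  "r \<odot>\<^bsub>regular_module R\<^esub> x = r \<otimes>\<^bsub>R\<^esub> x"
  by (simp_all add: regular_module_def)

lemma left_module_regular:
  assumes "ring R" shows "left_module R (regular_module R)"
proof -
  interpret ring R by fact
  have "abelian_group (regular_module R)"
    by (rule abelian_group_cong[OF is_abelian_group]) simp_all
  then show ?thesis
    by (intro left_moduleI) (auto simp: l_distr r_distr m_assoc ring_axioms)
qed

text \<open>Unlike \<open>module_hom\<close>, this puts no condition on values outside the carrier,
  so that compositions and changes of scalars need no \<open>restrict\<close>. Extensionality is
  added by \<open>restrict_module_hom\<close> where an element of \<open>module_hom\<close> is
  required.\<close>

definition linear_map ::
  "('a, 'r) ring_scheme \<Rightarrow> ('a, 'b, 'm) module_scheme \<Rightarrow> ('a, 'c, 'n) module_scheme \<Rightarrow> ('b \<Rightarrow> 'c) \<Rightarrow> bool"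
where
  "linear_map R X Y f \<longleftrightarrow> f \<in> carrier X \<rightarrow> carrier Y \<and>
     (\<forall>x \<in> carrier X. \<forall>y \<in> carrier X. f (x \<oplus>\<^bsub>X\<^esub> y) = f x \<oplus>\<^bsub>Y\<^esub> f y) \<and>
     (\<forall>r \<in> carrier R. \<forall>x \<in> carrier X. f (r \<odot>\<^bsub>X\<^esub> x) = r \<odot>\<^bsub>Y\<^esub> f x)"

lemma linear_mapD:
  assumes "linear_map R X Y f"
  shows "x \<in> carrier X \<Longrightarrow> f x \<in> carrier Y"
    and "\<lbrakk>x \<in> carrier X; y \<in> carrier X\<rbrakk> \<Longrightarrow> f (x \<oplus>\<^bsub>X\<^esub> y) = f x \<oplus>\<^bsub>Y\<^esub> f y"
    and "\<lbrakk>r \<in> carrier R; x \<in> carrier X\<rbrakk> \<Longrightarrow> f (r \<odot>\<^bsub>X\<^esub> x) = r \<odot>\<^bsub>Y\<^esub> f x"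
  using assms by (auto simp: linear_map_def)

lemma module_hom_iff: "f \<in> module_hom R X Y \<longleftrightarrow> linear_map R X Y f \<and> f \<in> extensional (carrier X)"
  by (auto simp: module_hom_def linear_map_def PiE_def)

lemma restrict_module_hom:
  assumes "linear_map R X Y f" "left_module R X"
  shows "restrict f (carrier X) \<in> module_hom R X Y"
proof -
  interpret X: left_module R X by fact
  show ?thesis
    using assms(1) by (auto simp: module_hom_iff linear_map_def X.smult_closed)
qed

lemma additive_zero:
  assumes "abelian_group X" "abelian_group Y" "f \<in> carrier X \<rightarrow> carrier Y"
    and "\<And>x y. \<lbrakk>x \<in> carrier X; y \<in> carrier X\<rbrakk> \<Longrightarrow> f (x \<oplus>\<^bsub>X\<^esub> y) = f x \<oplus>\<^bsub>Y\<^esub> f y"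
  shows "f \<zero>\<^bsub>X\<^esub> = \<zero>\<^bsub>Y\<^esub>"
proof -
  interpret X: abelian_group X by fact
  interpret Y: abelian_group Y by fact
  have "f \<zero>\<^bsub>X\<^esub> \<oplus>\<^bsub>Y\<^esub> f \<zero>\<^bsub>X\<^esub> = f \<zero>\<^bsub>X\<^esub> \<oplus>\<^bsub>Y\<^esub> \<zero>\<^bsub>Y\<^esub>"
    using assms(3) assms(4)[of "\<zero>\<^bsub>X\<^esub>" "\<zero>\<^bsub>X\<^esub>"] by (simp add: Pi_iff)
  moreover have "f \<zero>\<^bsub>X\<^esub> \<in> carrier Y" using assms(3) by blast
  ultimately show ?thesis by simp
qed

lemma linear_map_zero:
  assumes "linear_map R X Y f" "left_module R X" "left_module R Y"
  shows "f \<zero>\<^bsub>X\<^esub> = \<zero>\<^bsub>Y\<^esub>"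
  using assms by (intro additive_zero) (auto simp: linear_map_def left_module_abelian_group)

lemma linear_map_zero_hom:
  assumes "left_module R X" "left_module R Y"
  shows "zero_hom X Y \<in> module_hom R X Y"
proof -
  interpret X: left_module R X by fact
  interpret Y: left_module R Y by fact
  show ?thesis by (auto simp: module_hom_def zero_hom_def X.smult_closed)
qed

text \<open>Turns the equality of sets behind Hom = 0 into a pointwise statement about linear maps.
  The zero map is always a homomorphism, so the set is never empty.\<close>

lemma module_hom_eq_zero_iff:
  assumes "left_module R X" "left_module R Y"
  shows "module_hom R X Y = {zero_hom X Y} \<longleftrightarrow> (\<forall>f. linear_map R X Y f \<longrightarrow> (\<forall>x\<in>carrier X. f x = \<zero>\<^bsub>Y\<^esub>))"
    (is "?L \<longleftrightarrow> ?R")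
proof
  assume L: ?L
  show ?R
  proof (intro allI impI ballI)
    fix f x assume f: "linear_map R X Y f" and x: "x \<in> carrier X"
    from restrict_module_hom[OF f assms(1)] L have "restrict f (carrier X) = zero_hom X Y" by blast
    from fun_cong[OF this, of x] x show "f x = \<zero>\<^bsub>Y\<^esub>" by (simp add: zero_hom_def)
  qed
next
  assume R: ?R
  have "f = zero_hom X Y" if "f \<in> module_hom R X Y" for f
  proof (rule extensionalityI)
    show "f \<in> extensional (carrier X)" using that by (simp add: module_hom_iff)
  qed (use R that in \<open>auto simp: module_hom_iff zero_hom_def\<close>)
  then show ?L using linear_map_zero_hom[OF assms] by blast
qed

lemma submodule_kernel:
  assumes "linear_map R X Y f" "left_module R X" "left_module R Y"
  shows "submodule {x \<in> carrier X. f x = \<zero>\<^bsub>Y\<^esub>} R X"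
proof -
  interpret X: left_module R X by fact
  interpret Y: left_module R Y by fact
  show ?thesis
    unfolding submodule_iff[OF assms(2)]
    using linear_map_zero[OF assms] by (auto simp: linear_mapD[OF assms(1)] X.smult_closed)
qed

text \<open>Schur's argument: the kernel is a submodule that omits \<open>x\<close>, hence zero. For
  the Kasch property a nonzero map out of a simple module is thus as good as an embedding.\<close>

lemma linear_map_simple_inj:
  assumes "simple_module R X" "left_module R Y" "linear_map R X Y f"
    and "x \<in> carrier X" "f x \<noteq> \<zero>\<^bsub>Y\<^esub>"
  shows "inj_on f (carrier X)"
proof
  have X: "left_module R X" using assms(1) by (simp add: simple_module_def)
  interpret X: left_module R X by fact
  interpret Y: left_module R Y by fact
  have ker: "{x \<in> carrier X. f x = \<zero>\<^bsub>Y\<^esub>} = {\<zero>\<^bsub>X\<^esub>}"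
    using assms submodule_kernel[OF assms(3) X assms(2)] unfolding simple_module_def by blast
  fix a b assume ab: "a \<in> carrier X" "b \<in> carrier X" "f a = f b"
  have "f (a \<oplus>\<^bsub>X\<^esub> \<ominus>\<^bsub>X\<^esub> b) \<oplus>\<^bsub>Y\<^esub> f b = f a"
    using ab by (simp add: X.M.a_assoc X.M.l_neg flip: linear_mapD(2)[OF assms(3)])
  then have "f (a \<oplus>\<^bsub>X\<^esub> \<ominus>\<^bsub>X\<^esub> b) = \<zero>\<^bsub>Y\<^esub>"
    using ab linear_mapD(1)[OF assms(3)] by (simp add: linear_mapD(2)[OF assms(3)])
  then have "a \<oplus>\<^bsub>X\<^esub> \<ominus>\<^bsub>X\<^esub> b = \<zero>\<^bsub>X\<^esub>" using ker ab by blast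
  then show "a = b" using ab by (metis X.M.minus_equality X.M.add.inv_closed X.M.minus_minus)
qed

section \<open>Transport of structure and change of rings\<close>

lemma transport_module_simps:
  assumes "inj_on \<phi> (carrier X)"
  shows "carrier (transport_module \<phi> X) = \<phi> ` carrier X"
    and "\<zero>\<^bsub>transport_module \<phi> X\<^esub> = \<phi> \<zero>\<^bsub>X\<^esub>"
    and "\<lbrakk>x \<in> carrier X; y \<in> carrier X\<rbrakk> \<Longrightarrow> \<phi> x \<oplus>\<^bsub>transport_module \<phi> X\<^esub> \<phi> y = \<phi> (x \<oplus>\<^bsub>X\<^esub> y)"
    and "x \<in> carrier X \<Longrightarrow> r \<odot>\<^bsub>transport_module \<phi> X\<^esub> \<phi> x = \<phi> (r \<odot>\<^bsub>X\<^esub> x)"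
  using assms by (simp_all add: transport_module_def Let_def)

lemma left_module_transport:
  assumes "inj_on \<phi> (carrier X)" "left_module R X"
  shows "left_module R (transport_module \<phi> X)"
proof -
  interpret X: left_module R X by fact
  note [simp] = transport_module_simps[OF assms(1)] X.smult_closed
  have "abelian_group (transport_module \<phi> X)"
  proof (rule abelian_groupI)
    fix x assume "x \<in> carrier (transport_module \<phi> X)"
    then obtain a where "a \<in> carrier X" "x = \<phi> a" by auto
    then show "\<exists>y\<in>carrier (transport_module \<phi> X). y \<oplus>\<^bsub>transport_module \<phi> X\<^esub> x = \<zero>\<^bsub>transport_module \<phi> X\<^esub>"
      using X.M.l_neg[of a] by (intro bexI[of _ "\<phi> (\<ominus>\<^bsub>X\<^esub> a)"]) auto
  qed (auto simp: X.M.a_ac)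
  then show ?thesis
    by (intro left_moduleI)
      (auto simp: X.smult_l_distr X.smult_r_distr X.smult_assoc X.smult_one X.R.ring_axioms)
qed

lemma linear_map_transport:
  assumes "inj_on \<phi> (carrier X)" "left_module R X"
  shows "linear_map R X (transport_module \<phi> X) \<phi>"
  using assms by (auto simp: linear_map_def transport_module_simps)

lemma linear_map_transport_inv:
  assumes "inj_on \<phi> (carrier X)" "left_module R X"
  shows "linear_map R (transport_module \<phi> X) X (inv_into (carrier X) \<phi>)"
proof -
  interpret X: left_module R X by fact
  show ?thesis
    using assms by (auto simp: linear_map_def transport_module_simps X.smult_closed)
qed

text \<open>With \<open>h\<close> the projection or the section of the extension, one construction
  gives inflation and restriction. Right modules are covered as well, by viewing \<open>h\<close> as
  a map of opposite rings.\<close>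

definition restrict_scalars :: "('a \<Rightarrow> 'b) \<Rightarrow> ('b, 'c, 'm) module_scheme \<Rightarrow> ('a, 'c) module" where
  "restrict_scalars h X = \<lparr>carrier = carrier X, monoid.mult = monoid.mult X, one = \<one>\<^bsub>X\<^esub>,
     ring.zero = \<zero>\<^bsub>X\<^esub>, add = add X, smult = (\<lambda>r. smult X (h r))\<rparr>"

lemma restrict_scalars_simps [simp]:
  "carrier (restrict_scalars h X) = carrier X"
  "\<zero>\<^bsub>restrict_scalars h X\<^esub> = \<zero>\<^bsub>X\<^esub>"
  "add (restrict_scalars h X) = add X"
  "r \<odot>\<^bsub>restrict_scalars h X\<^esub> x = h r \<odot>\<^bsub>X\<^esub> x"
  by (simp_all add: restrict_scalars_def)

lemma left_module_restrict_scalars: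
  assumes "h \<in> ring_hom R S" "ring R" "left_module S X"
  shows "left_module R (restrict_scalars h X)"
proof -
  interpret X: left_module S X by fact
  have "abelian_group (restrict_scalars h X)"
    by (rule abelian_group_cong[OF X.abelian_group_axioms]) simp_all
  then show ?thesis
    using assms(1,2) by (intro left_moduleI)
      (auto simp: X.smult_closed X.smult_l_distr X.smult_r_distr X.smult_assoc X.smult_one
        ring_hom_add ring_hom_mult ring_hom_one ring_hom_closed)
qed

lemma ring_hom_opposite_ring: "h \<in> ring_hom R S \<Longrightarrow> h \<in> ring_hom (opposite_ring R) (opposite_ring S)"
  by (simp add: ring_hom_def)

lemma linear_map_restrict_scalars:
  assumes "h \<in> ring_hom R S" "linear_map S X Y f"
  shows "linear_map R (restrict_scalars h X) (restrict_scalars h Y) f"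
  using assms by (auto simp: linear_map_def ring_hom_closed)

lemma linear_map_restrict_scalars_iff:
  assumes "h ` carrier R = carrier S"
  shows "linear_map R (restrict_scalars h X) (restrict_scalars h Y) f \<longleftrightarrow> linear_map S X Y f"
  unfolding linear_map_def restrict_scalars_simps assms[symmetric] by auto

text \<open>For surjective \<open>h\<close> the two rings act on the group through the same set of
  operators.\<close>

lemma submodule_restrict_scalars_iff:
  assumes "h \<in> ring_hom R S" "h ` carrier R = carrier S" "ring R" "left_module S X"
  shows "submodule N R (restrict_scalars h X) \<longleftrightarrow> submodule N S X"
  unfolding submodule_iff[OF assms(4)] submodule_iff[OF left_module_restrict_scalars[OF assms(1,3,4)]]
  unfolding restrict_scalars_simps assms(2)[symmetric] by auto

lemma simple_module_restrict_scalars: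
  assumes "h \<in> ring_hom R S" "h ` carrier R = carrier S" "ring R" "simple_module S X"
  shows "simple_module R (restrict_scalars h X)"
proof -
  have "left_module S X" using assms(4) by (simp add: simple_module_def)
  from submodule_restrict_scalars_iff[OF assms(1-3) this] left_module_restrict_scalars[OF assms(1,3) this]
  show ?thesis using assms(4) by (simp add: simple_module_def)
qed

text \<open>Submodules of \<open>Y\<close> pull back to submodules of \<open>X\<close>, and
  surjectivity recovers each of them from its preimage.\<close>

lemma simple_module_iso:
  assumes "simple_module R X" "left_module R Y" "linear_map R X Y f"
    and "inj_on f (carrier X)" "f ` carrier X = carrier Y"
  shows "simple_module R Y"
  unfolding simple_module_def
proof (intro conjI allI impI)
  have X: "left_module R X" using assms(1) by (simp add: simple_module_def)
  interpret X: left_module R X by fact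
  note f0 = linear_map_zero[OF assms(3) X assms(2)]
  show "carrier Y \<noteq> {\<zero>\<^bsub>Y\<^esub>}"
  proof
    assume Y: "carrier Y = {\<zero>\<^bsub>Y\<^esub>}"
    have "x = \<zero>\<^bsub>X\<^esub>" if "x \<in> carrier X" for x
    proof -
      have "f x \<in> carrier Y" using linear_mapD(1)[OF assms(3) that] .
      then have "f x = f \<zero>\<^bsub>X\<^esub>" using Y f0 by simp
      then show ?thesis using assms(4) that X.M.zero_closed by (auto dest: inj_onD)
    qed
    then show False using assms(1) by (auto simp: simple_module_def)
  qed
  fix N assume N: "submodule N R Y"
  let ?N = "{x \<in> carrier X. f x \<in> N}"
  have "submodule ?N R X"
    using N unfolding submodule_iff[OF X] submodule_iff[OF assms(2)]
    by (auto simp: linear_mapD[OF assms(3)] f0 X.smult_closed)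
  then have "?N = {\<zero>\<^bsub>X\<^esub>} \<or> ?N = carrier X" using assms(1) by (simp add: simple_module_def)
  moreover have "N \<subseteq> f ` carrier X"
    using N assms(5) by (simp add: submodule_iff[OF assms(2)])
  then have "f ` ?N = N" by auto
  moreover have "f ` {\<zero>\<^bsub>X\<^esub>} = {\<zero>\<^bsub>Y\<^esub>}" using f0 by simp
  ultimately show "N = {\<zero>\<^bsub>Y\<^esub>} \<or> N = carrier Y" using assms(5) by (elim disjE) metis+
qed (rule assms(2))

lemma simple_module_left_module: "simple_module R X \<Longrightarrow> left_module R X"
  by (simp add: simple_module_def)

lemma linear_map_id: "linear_map Q X X (\<lambda>x. x)"
  by (simp add: linear_map_def)

lemma linear_map_comp:
  assumes "linear_map R X Y f" "linear_map R Y Z g"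
  shows "linear_map R X Z (\<lambda>x. g (f x))"
  using assms by (auto simp: linear_map_def Pi_iff)

lemma linear_map_inv_into:
  assumes "linear_map R X Y f" "left_module R X" "inj_on f (carrier X)" "f ` carrier X = carrier Y"
  shows "linear_map R Y X (inv_into (carrier X) f)"
proof -
  interpret X: left_module R X by fact
  note fD = linear_mapD[OF assms(1)]
  show ?thesis
    unfolding linear_map_def assms(4)[symmetric]
    using assms(3) by (auto simp: X.smult_closed simp flip: fD(2,3))
qed

text \<open>The value at zero is a separate hypothesis because \<open>Y\<close> is not yet known to
  be a group. In the Kasch criterion this supplies the module laws of the test module, which are
  inherited from an annihilator in the extension.\<close>

lemma left_module_surj:
  assumes "left_module R X" "linear_map R X Y f" "f ` carrier X = carrier Y" "f \<zero>\<^bsub>X\<^esub> = \<zero>\<^bsub>Y\<^esub>"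
  shows "left_module R Y"
proof -
  interpret X: left_module R X by fact
  note fD = linear_mapD[OF assms(2)]
  have "abelian_group Y"
  proof (rule abelian_groupI, unfold assms(3)[symmetric])
    fix x assume "x \<in> f ` carrier X"
    then obtain a where "a \<in> carrier X" "x = f a" by auto
    then show "\<exists>y\<in>f ` carrier X. y \<oplus>\<^bsub>Y\<^esub> x = \<zero>\<^bsub>Y\<^esub>"
      using X.M.l_neg[of a] fD(2)[of "\<ominus>\<^bsub>X\<^esub> a" a] assms(4)
      by (intro bexI[of _ "f (\<ominus>\<^bsub>X\<^esub> a)"]) auto
  qed (auto simp: X.M.a_ac assms(4)[symmetric] simp flip: fD(2))
  then show ?thesis
  proof (rule left_moduleI[OF X.R.ring_axioms], unfold assms(3)[symmetric])
  qed (auto simp: X.smult_closed X.smult_l_distr X.smult_r_distr X.smult_assoc X.smult_one simp flip: fD(2,3))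
qed

section \<open>Simple submodules, semisimple modules and ring isomorphisms\<close>

lemma simple_submodule_iff:
  assumes "left_module R X" "submodule N R X"
  shows "simple_module R (X\<lparr>carrier := N\<rparr>) \<longleftrightarrow>
    N \<noteq> {\<zero>\<^bsub>X\<^esub>} \<and> (\<forall>L. submodule L R X \<and> L \<subseteq> N \<longrightarrow> L = {\<zero>\<^bsub>X\<^esub>} \<or> L = N)"
proof -
  note N = left_module_submodule[OF assms]
  have "submodule L R (X\<lparr>carrier := N\<rparr>) \<longleftrightarrow> submodule L R X \<and> L \<subseteq> N" for L
    unfolding submodule_iff[OF N] submodule_iff[OF assms(1)]
    using assms(2)[unfolded submodule_iff[OF assms(1)]] by auto
  then show ?thesis using N by (auto simp: simple_module_def)
qed

lemma submodule_carrier: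
  assumes "left_module R X" shows "submodule (carrier X) R X"
proof -
  interpret left_module R X by fact
  show ?thesis unfolding submodule_iff[OF assms] using smult_closed by auto
qed

text \<open>The carrier always belongs to the intersected family, so the intersection equals it
  exactly when the family has no other member. In this form semisimplicity shows that a given
  submodule is everything.\<close>

lemma semisimple_module_iff:
  "semisimple_module R X \<longleftrightarrow> left_module R X \<and>
     (\<forall>N. submodule N R X \<longrightarrow>
        (\<forall>L. submodule L R X \<and> simple_module R (X\<lparr>carrier := L\<rparr>) \<longrightarrow> L \<subseteq> N) \<longrightarrow> N = carrier X)"
proof (cases "left_module R X")
  case True
  have sub: "N \<subseteq> carrier X" if "submodule N R X" for N
    using that by (simp add: submodule_iff[OF True])
  show ?thesis
    unfolding semisimple_module_def
  proof (intro conj_cong refl iffI allI impI)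
    fix N assume eq: "\<Inter>{N. submodule N R X \<and>
          (\<forall>S. submodule S R X \<and> simple_module R (X\<lparr>carrier := S\<rparr>) \<longrightarrow> S \<subseteq> N)} = carrier X"
      and "submodule N R X" "\<forall>L. submodule L R X \<and> simple_module R (X\<lparr>carrier := L\<rparr>) \<longrightarrow> L \<subseteq> N"
    then have "carrier X \<subseteq> N" unfolding eq[symmetric] by (intro Inter_lower) simp
    then show "N = carrier X" using sub[OF \<open>submodule N R X\<close>] by simp
  next
    assume *: "\<forall>N. submodule N R X \<longrightarrow>
        (\<forall>L. submodule L R X \<and> simple_module R (X\<lparr>carrier := L\<rparr>) \<longrightarrow> L \<subseteq> N) \<longrightarrow> N = carrier X"
    let ?F = "{N. submodule N R X \<and>
          (\<forall>S. submodule S R X \<and> simple_module R (X\<lparr>carrier := S\<rparr>) \<longrightarrow> S \<subseteq> N)}"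
    have "carrier X \<in> ?F" using submodule_carrier[OF True] sub by blast
    moreover have "N = carrier X" if "N \<in> ?F" for N using * that by simp
    ultimately show "\<Inter>?F = carrier X" by blast
  qed
qed (simp add: semisimple_module_def)

lemma semisimple_moduleD:
  assumes "semisimple_module R X" "submodule N R X"
    and "\<And>L. \<lbrakk>submodule L R X; simple_module R (X\<lparr>carrier := L\<rparr>)\<rbrakk> \<Longrightarrow> L \<subseteq> N"
  shows "N = carrier X"
  using assms(1)[unfolded semisimple_module_iff, THEN conjunct2, rule_format, OF assms(2)] assms(3) by blast

lemma submodule_regular_image:
  assumes "h \<in> ring_hom R S" "h ` carrier R = carrier S" "ring R" "ring S"
    and "submodule N R (regular_module R)"
  shows "submodule (h ` N) S (regular_module S)"
proof -
  note N = assms(5)[unfolded submodule_iff[OF left_module_regular[OF assms(3)]], simplified]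
  have "h \<zero>\<^bsub>R\<^esub> = \<zero>\<^bsub>S\<^esub>" using assms(1,3,4) ring_hom_zero by blast
  moreover have "h x \<oplus>\<^bsub>S\<^esub> h y \<in> h ` N" if "x \<in> N" "y \<in> N" for x y
    using N that ring_hom_add[OF assms(1), of x y] by (metis image_eqI subsetD)
  moreover have "h r \<otimes>\<^bsub>S\<^esub> h x \<in> h ` N" if "r \<in> carrier R" "x \<in> N" for r x
    using N that ring_hom_mult[OF assms(1), of r x] by (metis image_eqI subsetD)
  moreover have "h ` N \<subseteq> carrier S" using N assms(2) by auto
  ultimately show ?thesis
    using N unfolding submodule_iff[OF left_module_regular[OF assms(4)]] regular_module_simps
    unfolding assms(2)[symmetric] by (auto simp: image_iff) metis
qed

lemma submodule_regular_preimage: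
  assumes "h \<in> ring_hom R S" "ring R" "ring S" "submodule N S (regular_module S)"
  shows "submodule {r \<in> carrier R. h r \<in> N} R (regular_module R)"
proof -
  interpret R: ring R by fact
  have "h \<zero>\<^bsub>R\<^esub> = \<zero>\<^bsub>S\<^esub>" using assms(1-3) ring_hom_zero by blast
  then show ?thesis
    using assms(4) unfolding submodule_iff[OF left_module_regular[OF assms(2)]]
      submodule_iff[OF left_module_regular[OF assms(3)]]
    by (auto simp: ring_hom_add[OF assms(1)] ring_hom_mult[OF assms(1)] ring_hom_closed[OF assms(1)])
qed

text \<open>Images and preimages match left ideals, simple left ideals and descending chains of the
  two rings. The property is pulled back from \<open>S\<close> to \<open>R\<close>; taking the
  section or the projection for \<open>h\<close> serves both directions of the criterion.\<close>

lemma semisimple_artinian_ring_iso: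
  assumes h: "h \<in> ring_hom R S" "bij_betw h (carrier R) (carrier S)" and RS: "ring R" "ring S"
    and ss: "semisimple_artinian_ring S"
  shows "semisimple_artinian_ring R"
proof -
  let ?R = "regular_module R" and ?S = "regular_module S"
  note mR = left_module_regular[OF RS(1)] and mS = left_module_regular[OF RS(2)]
  have inj: "inj_on h (carrier R)" and surj: "h ` carrier R = carrier S"
    using h(2) by (auto simp: bij_betw_def)
  have h0: "h \<zero>\<^bsub>R\<^esub> = \<zero>\<^bsub>S\<^esub>" using h(1) RS ring_hom_zero by blast
  note im = submodule_regular_image[OF h(1) surj RS] and pre = submodule_regular_preimage[OF h(1) RS]
  have subR: "N \<subseteq> carrier R" if "submodule N R ?R" for N
    using that by (simp add: submodule_iff[OF mR])
  have subS: "N \<subseteq> carrier S" if "submodule N S ?S" for N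
    using that by (simp add: submodule_iff[OF mS])
  have im_pre: "h ` {r \<in> carrier R. h r \<in> N} = N" if "submodule N S ?S" for N
    using subS[OF that] surj by auto
  have art: "\<forall>N. (\<forall>k. submodule (N k) S ?S \<and> N (Suc k) \<subseteq> N k) \<longrightarrow> (\<exists>k. \<forall>l\<ge>k. N l = N k)"
    using ss unfolding semisimple_artinian_ring_def artinian_module_def by (elim conjE)
  have "N = carrier R" if N: "submodule N R ?R"
    and simp: "\<And>L. submodule L R ?R \<Longrightarrow> simple_module R (?R\<lparr>carrier := L\<rparr>) \<Longrightarrow> L \<subseteq> N" for N
  proof -
    \<comment> \<open>The hypothesis on simple left ideals concerns \<open>R\<close>, so
      \<open>L\<close> is pulled back, shown to be simple there, and pushed forward again.\<close>
    have "L \<subseteq> h ` N" if L: "submodule L S ?S" "simple_module S (?S\<lparr>carrier := L\<rparr>)" for L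
    proof -
      let ?L = "{r \<in> carrier R. h r \<in> L}"
      note L2 = L(2)[unfolded simple_submodule_iff[OF mS L(1)], simplified]
      have "simple_module R (?R\<lparr>carrier := ?L\<rparr>)"
        unfolding simple_submodule_iff[OF mR pre[OF L(1)]]
      proof (intro conjI allI impI)
        show "?L \<noteq> {\<zero>\<^bsub>?R\<^esub>}"
          using L2 im_pre[OF L(1)] h0 by (metis image_empty image_insert regular_module_simps(3))
        fix K assume K: "submodule K R ?R \<and> K \<subseteq> ?L"
        then have "h ` K = {\<zero>\<^bsub>S\<^esub>} \<or> h ` K = L" using L2 im[of K] by blast
        moreover have "h ` {\<zero>\<^bsub>R\<^esub>} = {\<zero>\<^bsub>S\<^esub>}" using h0 by simp
        ultimately have "h ` K = h ` {\<zero>\<^bsub>R\<^esub>} \<or> h ` K = h ` ?L" using im_pre[OF L(1)] by simp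
        moreover have "K \<subseteq> carrier R" "{\<zero>\<^bsub>R\<^esub>} \<subseteq> carrier R" "?L \<subseteq> carrier R"
          using K subR ring.ring_simprules(2)[OF RS(1)] by auto
        ultimately show "K = {\<zero>\<^bsub>?R\<^esub>} \<or> K = ?L"
          unfolding regular_module_simps
          by (metis (no_types) inj_on_image_eq_iff[OF inj])
      qed
      then have "?L \<subseteq> N" using simp pre[OF L(1)] by blast
      then show ?thesis using im_pre[OF L(1)] by blast
    qed
    then have "h ` N = carrier S"
      using semisimple_moduleD[of S ?S "h ` N"] ss im[OF N]
      unfolding semisimple_artinian_ring_def by simp
    then have "h ` N = h ` carrier R" using surj by simp
    then show ?thesis using inj_on_image_eq_iff[OF inj subR[OF N] subset_refl] by simp
  qed
  then have ssR: "semisimple_module R ?R"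
    unfolding semisimple_module_iff regular_module_simps(1) using mR by blast
  have "\<exists>k. \<forall>l\<ge>k. N l = N k"
    if N: "\<And>k. submodule (N k) R ?R" "\<And>k. N (Suc k) \<subseteq> N k" for N :: "nat \<Rightarrow> _"
  proof -
    have "\<exists>k. \<forall>l\<ge>k. h ` N l = h ` N k"
    proof -
      have "\<forall>k. submodule (h ` N k) S ?S \<and> h ` N (Suc k) \<subseteq> h ` N k"
        by (intro allI conjI im N(1) image_mono N(2))
      with spec[OF art, of "\<lambda>k. h ` N k"] show ?thesis by (rule mp)
    qed
    then show ?thesis using inj_on_image_eq_iff[OF inj subR[OF N(1)] subR[OF N(1)]] by simp
  qed
  then have "artinian_module R ?R"
    unfolding artinian_module_def using mR by blast
  then show ?thesis
    using RS(1) ssR unfolding semisimple_artinian_ring_def by blast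
qed

section \<open>Tensor products\<close>

text \<open>These are the families written out inside \<open>tensor_relations\<close>; with a name
  of their own, statements can be reduced to generators.\<close>

definition tensor_generators ::
  "('a, 'r) ring_scheme \<Rightarrow> ('a, 'b, 'm) module_scheme \<Rightarrow> ('a, 'c, 'n) module_scheme \<Rightarrow>
    ('b \<times> 'c \<Rightarrow>\<^sub>0 int) set" where
  "tensor_generators R A B =
     {frag_of (a \<oplus>\<^bsub>A\<^esub> a', b) - frag_of (a, b) - frag_of (a', b) | a a' b.
         a \<in> carrier A \<and> a' \<in> carrier A \<and> b \<in> carrier B} \<union>
      {frag_of (a, b \<oplus>\<^bsub>B\<^esub> b') - frag_of (a, b) - frag_of (a, b') | a b b'.
         a \<in> carrier A \<and> b \<in> carrier B \<and> b' \<in> carrier B} \<union>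
      {frag_of (r \<odot>\<^bsub>A\<^esub> a, b) - frag_of (a, r \<odot>\<^bsub>B\<^esub> b) | a r b.
         a \<in> carrier A \<and> r \<in> carrier R \<and> b \<in> carrier B}"

lemma tensor_relations_eq:
  "tensor_relations R A B =
     generate (free_Abelian_group (carrier A \<times> carrier B)) (tensor_generators R A B)"
  by (simp add: tensor_relations_def tensor_generators_def)

lemma tensor_generatorsI:
  "\<lbrakk>a \<in> carrier A; a' \<in> carrier A; b \<in> carrier B\<rbrakk> \<Longrightarrow>
     frag_of (a \<oplus>\<^bsub>A\<^esub> a', b) - frag_of (a, b) - frag_of (a', b) \<in> tensor_generators R A B"
  "\<lbrakk>a \<in> carrier A; b \<in> carrier B; b' \<in> carrier B\<rbrakk> \<Longrightarrow>
     frag_of (a, b \<oplus>\<^bsub>B\<^esub> b') - frag_of (a, b) - frag_of (a, b') \<in> tensor_generators R A B"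
  "\<lbrakk>a \<in> carrier A; r \<in> carrier R; b \<in> carrier B\<rbrakk> \<Longrightarrow>
     frag_of (r \<odot>\<^bsub>A\<^esub> a, b) - frag_of (a, r \<odot>\<^bsub>B\<^esub> b) \<in> tensor_generators R A B"
  unfolding tensor_generators_def by blast+

text \<open>The target is multiplicative because tensor products are; an additive group enters as
  its \<open>add_monoid\<close>.\<close>

definition balanced ::
  "('a, 'r) ring_scheme \<Rightarrow> ('a, 'b, 'm) module_scheme \<Rightarrow> ('a, 'c, 'n) module_scheme \<Rightarrow>
    ('g, 'x) monoid_scheme \<Rightarrow> ('b \<Rightarrow> 'c \<Rightarrow> 'g) \<Rightarrow> bool" where
  "balanced R A B G \<phi> \<longleftrightarrow>
     (\<forall>a\<in>carrier A. \<forall>b\<in>carrier B. \<phi> a b \<in> carrier G) \<and>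
     (\<forall>a\<in>carrier A. \<forall>a'\<in>carrier A. \<forall>b\<in>carrier B. \<phi> (a \<oplus>\<^bsub>A\<^esub> a') b = \<phi> a b \<otimes>\<^bsub>G\<^esub> \<phi> a' b) \<and>
     (\<forall>a\<in>carrier A. \<forall>b\<in>carrier B. \<forall>b'\<in>carrier B. \<phi> a (b \<oplus>\<^bsub>B\<^esub> b') = \<phi> a b \<otimes>\<^bsub>G\<^esub> \<phi> a b') \<and>
     (\<forall>a\<in>carrier A. \<forall>r\<in>carrier R. \<forall>b\<in>carrier B. \<phi> (r \<odot>\<^bsub>A\<^esub> a) b = \<phi> a (r \<odot>\<^bsub>B\<^esub> b))"

section \<open>The tensor product of a right and a left module\<close>

locale tensor_product =
  fixes R :: "('a, 'r) ring_scheme" and A :: "('a, 'b, 'm) module_scheme"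
    and B :: "('a, 'c, 'n) module_scheme"
  assumes right: "right_module R A" and left: "left_module R B"
begin

sublocale A: left_module "opposite_ring R" A
  using right by (simp add: right_module_def)

sublocale B: left_module R B
  by (rule left)

lemma smult_closed_right: "\<lbrakk>r \<in> carrier R; a \<in> carrier A\<rbrakk> \<Longrightarrow> r \<odot>\<^bsub>A\<^esub> a \<in> carrier A"
  using A.smult_closed by simp

lemmas closed [simp] = smult_closed_right B.smult_closed

abbreviation F where "F \<equiv> free_Abelian_group (carrier A \<times> carrier B)"

sublocale F: comm_group F
  by (rule abelian_free_Abelian_group)

lemma free_diff_closed: "\<lbrakk>x \<in> carrier F; y \<in> carrier F\<rbrakk> \<Longrightarrow> x - y \<in> carrier F"
  using keys_diff[of x y] by auto

lemma generators_in_free: "tensor_generators R A B \<subseteq> carrier F"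
  unfolding tensor_generators_def
  by (auto simp del: carrier_free_Abelian_group_iff intro!: free_diff_closed)

lemma relations_subgroup: "subgroup (tensor_relations R A B) F"
  unfolding tensor_relations_eq by (rule F.generate_is_subgroup[OF generators_in_free])

lemma relations_normal: "tensor_relations R A B \<lhd> F"
  by (rule F.subgroup_imp_normal[OF relations_subgroup])

lemma comm_group_tensor: "comm_group (tensor R A B)"
  unfolding tensor_def by (rule F.abelian_FactGroup[OF relations_subgroup])

sublocale T: comm_group "tensor R A B"
  by (rule comm_group_tensor)

lemma tensor_class_hom: "tensor_class R A B \<in> hom F (tensor R A B)"
  unfolding tensor_def tensor_class_def[abs_def] by (rule normal.r_coset_hom_Mod[OF relations_normal])

lemma tensor_class_closed [simp]:
  "x \<in> carrier F \<Longrightarrow> tensor_class R A B x \<in> carrier (tensor R A B)"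
  using tensor_class_hom by (auto simp: hom_def)

lemma tensor_class_add:
  "\<lbrakk>x \<in> carrier F; y \<in> carrier F\<rbrakk> \<Longrightarrow>
    tensor_class R A B (x + y) = tensor_class R A B x \<otimes>\<^bsub>tensor R A B\<^esub> tensor_class R A B y"
  using hom_mult[OF tensor_class_hom, of x y] by simp

lemma tensor_class_zero: "tensor_class R A B 0 = \<one>\<^bsub>tensor R A B\<^esub>"
  using hom_one[OF tensor_class_hom F.is_group T.is_group] by simp

lemma tensor_class_cases:
  assumes "C \<in> carrier (tensor R A B)"
  obtains x where "x \<in> carrier F" "C = tensor_class R A B x"
  using assms unfolding tensor_def carrier_FactGroup tensor_class_def by blast

lemma tensor_class_self: "x \<in> carrier F \<Longrightarrow> x \<in> tensor_class R A B x"
  unfolding tensor_class_def by (rule F.rcos_self[OF _ relations_subgroup])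

lemma tensor_class_eqI:
  assumes "x \<in> tensor_class R A B y" "y \<in> carrier F"
  shows "x \<in> carrier F" "tensor_class R A B x = tensor_class R A B y"
proof -
  show "tensor_class R A B x = tensor_class R A B y"
    using F.repr_independence[OF _ assms(2) relations_subgroup, of x] assms(1)
    by (simp add: tensor_class_def)
  show "x \<in> carrier F"
    using F.r_coset_subset_G[OF subgroup.subset[OF relations_subgroup] assms(2)] assms(1)
    unfolding tensor_class_def by blast
qed

lemma tensor_class_eq_diff:
  assumes "x - y \<in> tensor_generators R A B" "y \<in> carrier F"
  shows "tensor_class R A B x = tensor_class R A B y"
proof -
  have "x - y \<in> tensor_relations R A B"
    unfolding tensor_relations_eq using assms(1) by (rule generate.incl)
  then have "x \<in> tensor_class R A B y"
    unfolding tensor_class_def r_coset_def by (auto intro!: bexI[of _ "x - y"])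
  then show ?thesis using tensor_class_eqI assms(2) by blast
qed

lemma tensor_class_eqD:
  assumes "tensor_class R A B x = tensor_class R A B y" "x \<in> carrier F"
  shows "x - y \<in> tensor_relations R A B"
  using tensor_class_self[OF assms(2)] unfolding assms(1) unfolding tensor_class_def r_coset_def by auto

lemma balanced_pure_tensor: "balanced R A B (tensor R A B) (pure_tensor R A B)"
proof -
  have "pure_tensor R A B (a \<oplus>\<^bsub>A\<^esub> a') b = pure_tensor R A B a b \<otimes>\<^bsub>tensor R A B\<^esub> pure_tensor R A B a' b"
    if "a \<in> carrier A" "a' \<in> carrier A" "b \<in> carrier B" for a a' b
  proof -
    have "tensor_class R A B (frag_of (a \<oplus>\<^bsub>A\<^esub> a', b)) = tensor_class R A B (frag_of (a, b) + frag_of (a', b))"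
      using that keys_add[of "frag_of (a, b)" "frag_of (a', b)"]
      by (intro tensor_class_eq_diff) (auto simp: tensor_generators_def diff_diff_eq)
    then show ?thesis using that by (simp add: pure_tensor_def tensor_class_add)
  qed
  moreover have "pure_tensor R A B a (b \<oplus>\<^bsub>B\<^esub> b') = pure_tensor R A B a b \<otimes>\<^bsub>tensor R A B\<^esub> pure_tensor R A B a b'"
    if "a \<in> carrier A" "b \<in> carrier B" "b' \<in> carrier B" for a b b'
  proof -
    have "tensor_class R A B (frag_of (a, b \<oplus>\<^bsub>B\<^esub> b')) = tensor_class R A B (frag_of (a, b) + frag_of (a, b'))"
      using that keys_add[of "frag_of (a, b)" "frag_of (a, b')"]
      by (intro tensor_class_eq_diff) (auto simp: tensor_generators_def diff_diff_eq)
    then show ?thesis using that by (simp add: pure_tensor_def tensor_class_add)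
  qed
  moreover have "pure_tensor R A B (r \<odot>\<^bsub>A\<^esub> a) b = pure_tensor R A B a (r \<odot>\<^bsub>B\<^esub> b)"
    if "a \<in> carrier A" "r \<in> carrier R" "b \<in> carrier B" for a r b
    unfolding pure_tensor_def
    using that by (intro tensor_class_eq_diff) (auto simp: tensor_generators_def)
  ultimately show ?thesis
    by (auto simp: balanced_def pure_tensor_def)
qed

lemma pure_tensor_closed [simp]:
  "\<lbrakk>a \<in> carrier A; b \<in> carrier B\<rbrakk> \<Longrightarrow> pure_tensor R A B a b \<in> carrier (tensor R A B)"
  using balanced_pure_tensor by (simp add: balanced_def)

lemma pure_tensor_add_left:
  "\<lbrakk>a \<in> carrier A; a' \<in> carrier A; b \<in> carrier B\<rbrakk> \<Longrightarrow>
    pure_tensor R A B (a \<oplus>\<^bsub>A\<^esub> a') b = pure_tensor R A B a b \<otimes>\<^bsub>tensor R A B\<^esub> pure_tensor R A B a' b"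
  using balanced_pure_tensor by (simp add: balanced_def)

lemma pure_tensor_add_right:
  "\<lbrakk>a \<in> carrier A; b \<in> carrier B; b' \<in> carrier B\<rbrakk> \<Longrightarrow>
    pure_tensor R A B a (b \<oplus>\<^bsub>B\<^esub> b') = pure_tensor R A B a b \<otimes>\<^bsub>tensor R A B\<^esub> pure_tensor R A B a b'"
  using balanced_pure_tensor by (simp add: balanced_def)

lemma pure_tensor_smult:
  "\<lbrakk>a \<in> carrier A; r \<in> carrier R; b \<in> carrier B\<rbrakk> \<Longrightarrow>
    pure_tensor R A B (r \<odot>\<^bsub>A\<^esub> a) b = pure_tensor R A B a (r \<odot>\<^bsub>B\<^esub> b)"
  using balanced_pure_tensor by (simp add: balanced_def)

lemma pure_tensor_zero_left [simp]:
  assumes "b \<in> carrier B"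
  shows "pure_tensor R A B \<zero>\<^bsub>A\<^esub> b = \<one>\<^bsub>tensor R A B\<^esub>"
  using assms pure_tensor_add_left[of "\<zero>\<^bsub>A\<^esub>" "\<zero>\<^bsub>A\<^esub>" b] by simp

lemma pure_tensor_zero_right [simp]:
  assumes "a \<in> carrier A"
  shows "pure_tensor R A B a \<zero>\<^bsub>B\<^esub> = \<one>\<^bsub>tensor R A B\<^esub>"
  using assms pure_tensor_add_right[of a "\<zero>\<^bsub>B\<^esub>" "\<zero>\<^bsub>B\<^esub>"] by simp

text \<open>Absorbs inverses into pure tensors, which is why \<open>tensor_induct\<close> has no
  case for inverses.\<close>

lemma tensor_class_minus_frag_of:
  assumes "a \<in> carrier A" "b \<in> carrier B"
  shows "tensor_class R A B (- frag_of (a, b)) = pure_tensor R A B (\<ominus>\<^bsub>A\<^esub> a) b"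
proof -
  have "pure_tensor R A B (\<ominus>\<^bsub>A\<^esub> a) b \<otimes>\<^bsub>tensor R A B\<^esub> pure_tensor R A B a b = \<one>\<^bsub>tensor R A B\<^esub>"
    using assms by (simp add: A.M.l_neg flip: pure_tensor_add_left)
  moreover have "tensor_class R A B (- frag_of (a, b)) \<otimes>\<^bsub>tensor R A B\<^esub> pure_tensor R A B a b = \<one>\<^bsub>tensor R A B\<^esub>"
    unfolding pure_tensor_def using assms by (simp add: tensor_class_zero flip: tensor_class_add)
  ultimately show ?thesis
    using assms by (metis T.inv_equality pure_tensor_closed A.M.add.inv_closed tensor_class_closed
        carrier_free_Abelian_group_iff frag_of_in_free_Abelian_group keys_minus SigmaI)
qed

lemma tensor_induct [consumes 1, case_names one pure mult]:
  assumes "C \<in> carrier (tensor R A B)"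
    and "P \<one>\<^bsub>tensor R A B\<^esub>"
    and pure: "\<And>a b. \<lbrakk>a \<in> carrier A; b \<in> carrier B\<rbrakk> \<Longrightarrow> P (pure_tensor R A B a b)"
    and mult: "\<And>C D. \<lbrakk>C \<in> carrier (tensor R A B); D \<in> carrier (tensor R A B); P C; P D\<rbrakk> \<Longrightarrow>
      P (C \<otimes>\<^bsub>tensor R A B\<^esub> D)"
  shows "P C"
proof -
  obtain x where x: "x \<in> carrier F" "C = tensor_class R A B x"
    using assms(1) tensor_class_cases by blast
  have "Poly_Mapping.keys x \<subseteq> carrier A \<times> carrier B" using x(1) by simp
  \<comment> \<open>Induction on the free group passes through differences, so the claim is carried
    for \<open>x\<close> and \<open>- x\<close> together.\<close>
  then have "P (tensor_class R A B x) \<and> P (tensor_class R A B (- x))"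
  proof (induction x rule: free_Abelian_group_induct[consumes 1, case_names zero diff frag_of])
    case zero
    then show ?case using assms(2) by (simp add: tensor_class_zero)
  next
    case (diff x y)
    then have "P (tensor_class R A B (x + - y))" "P (tensor_class R A B (- x + y))"
      using mult[of "tensor_class R A B x" "tensor_class R A B (- y)"]
        mult[of "tensor_class R A B (- x)" "tensor_class R A B y"]
      by (simp_all flip: tensor_class_add)
    then show ?case by (simp add: add.commute)
  next
    case (frag_of p)
    then obtain a b where p: "p = (a, b)" "a \<in> carrier A" "b \<in> carrier B" by auto
    then show ?case using pure[of a b] pure[of "\<ominus>\<^bsub>A\<^esub> a" b]
      by (simp add: tensor_class_minus_frag_of) (simp add: pure_tensor_def)
  qed
  then show ?thesis using x by simp
qed

text \<open>The universal property on formal sums. It is kept apart from the version for balanced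
  maps because \<open>tensor_map\<close> is defined on representatives and has to be compared with a
  homomorphism of the free group.\<close>

lemma tensor_lift_class:
  assumes "group G" "h \<in> hom F G" "\<And>x. x \<in> tensor_generators R A B \<Longrightarrow> h x = \<one>\<^bsub>G\<^esub>"
  obtains k where "k \<in> hom (tensor R A B) G" "\<And>x. x \<in> carrier F \<Longrightarrow> k (tensor_class R A B x) = h x"
proof -
  interpret h: group_hom F G h
    using assms(1,2) by (simp add: group_hom_def group_hom_axioms_def F.is_group)
  have "tensor_relations R A B \<subseteq> kernel F G h"
    unfolding tensor_relations_eq
    using generators_in_free assms(3)
    by (intro F.generate_subgroup_incl h.subgroup_kernel)
      (auto simp: kernel_def simp del: carrier_free_Abelian_group_iff)
  from h.FactGroup_universal_kernel[OF relations_normal this]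
  show thesis using that unfolding tensor_def tensor_class_def by blast
qed

lemma tensor_lift:
  assumes "comm_group G" "balanced R A B G \<phi>"
  obtains k where "k \<in> hom (tensor R A B) G"
    "\<And>a b. \<lbrakk>a \<in> carrier A; b \<in> carrier B\<rbrakk> \<Longrightarrow> k (pure_tensor R A B a b) = \<phi> a b"
proof -
  interpret G: comm_group G by fact
  note \<phi> = assms(2)[unfolded balanced_def]
  have "(\<lambda>(a, b). \<phi> a b) ` (carrier A \<times> carrier B) \<subseteq> carrier G" using \<phi> by auto
  then obtain h where h: "h \<in> hom F G"
    and hf: "\<And>p. p \<in> carrier A \<times> carrier B \<Longrightarrow> h (frag_of p) = (\<lambda>(a, b). \<phi> a b) p"
    using G.free_Abelian_group_universal by metis
  interpret h: group_hom F G h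
    using h by (simp add: group_hom_def group_hom_axioms_def F.is_group G.is_group)
  have diff: "h (x - y) = h x \<otimes>\<^bsub>G\<^esub> inv\<^bsub>G\<^esub> h y" if "x \<in> carrier F" "y \<in> carrier F" for x y
    using h.hom_mult[of x "- y"] h.hom_inv[of y] that by simp
  have fc: "frag_of (a, b) \<in> carrier F" if "a \<in> carrier A" "b \<in> carrier B" for a b
    using that by simp
  \<comment> \<open>This is the image of an additivity generator, once \<open>\<phi>\<close> has
    been expanded in the argument where the sum stands.\<close>
  have 3: "x \<otimes>\<^bsub>G\<^esub> y \<otimes>\<^bsub>G\<^esub> inv\<^bsub>G\<^esub> x \<otimes>\<^bsub>G\<^esub> inv\<^bsub>G\<^esub> y = \<one>\<^bsub>G\<^esub>" if "x \<in> carrier G" "y \<in> carrier G" for x y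
    using that by (simp add: G.m_ac) (metis G.inv_mult G.m_closed G.m_comm G.r_inv G.inv_closed G.m_assoc)
  have kill: "h x = \<one>\<^bsub>G\<^esub>" if "x \<in> tensor_generators R A B" for x
    using that \<phi> unfolding tensor_generators_def
    by (auto simp del: carrier_free_Abelian_group_iff simp: diff fc free_diff_closed hf 3)
  obtain k where k: "k \<in> hom (tensor R A B) G" "\<And>x. x \<in> carrier F \<Longrightarrow> k (tensor_class R A B x) = h x"
    using tensor_lift_class[OF G.is_group h kill] by blast
  show thesis
    by (rule that[OF k(1)]) (simp add: pure_tensor_def k(2) hf)
qed

lemma tensor_trivial_iff:
  "carrier (tensor R A B) = {\<one>\<^bsub>tensor R A B\<^esub>} \<longleftrightarrow>
    (\<forall>a\<in>carrier A. \<forall>b\<in>carrier B. pure_tensor R A B a b = \<one>\<^bsub>tensor R A B\<^esub>)" (is "_ \<longleftrightarrow> ?R")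
proof
  assume ?R
  have "C = \<one>\<^bsub>tensor R A B\<^esub>" if "C \<in> carrier (tensor R A B)" for C
    using that by (induction rule: tensor_induct) (use \<open>?R\<close> in auto)
  then show "carrier (tensor R A B) = {\<one>\<^bsub>tensor R A B\<^esub>}" by auto
qed (use pure_tensor_closed in blast)

end

text \<open>The definition takes a union over all representatives of a coset. The extension of
  \<open>f\<close> and \<open>g\<close> to formal sums sends generators to generators, so it induces
  a homomorphism \<open>k\<close>; every representative then contributes the same coset, and the
  union collapses to it.\<close>

lemma tensor_map_hom:
  assumes "tensor_product R A B" "tensor_product R A' B'"
    and f: "linear_map (opposite_ring R) A A' f" and g: "linear_map R B B' g"
  shows "tensor_map R A' B' f g \<in> hom (tensor R A B) (tensor R A' B')"
    and "\<lbrakk>a \<in> carrier A; b \<in> carrier B\<rbrakk> \<Longrightarrow>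
      tensor_map R A' B' f g (pure_tensor R A B a b) = pure_tensor R A' B' (f a) (g b)"
proof -
  interpret T: tensor_product R A B by fact
  interpret T': tensor_product R A' B' by fact
  let ?e = "frag_extend (\<lambda>(a, b). frag_of (f a, g b))"
  note fg = linear_mapD[OF f, simplified] linear_mapD[OF g]
  have e: "?e \<in> hom T.F T'.F"
  proof (rule homI)
    fix x assume "x \<in> carrier T.F"
    moreover have "Poly_Mapping.keys (case p of (a, b) \<Rightarrow> frag_of (f a, g b)) \<subseteq> carrier A' \<times> carrier B'"
      if "p \<in> carrier A \<times> carrier B" for p
      using that fg(1,4) by auto
    ultimately have "(\<Union>p\<in>Poly_Mapping.keys x. Poly_Mapping.keys (case p of (a, b) \<Rightarrow> frag_of (f a, g b)))
        \<subseteq> carrier A' \<times> carrier B'"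
      unfolding carrier_free_Abelian_group_iff by blast
    then show "?e x \<in> carrier T'.F"
      using keys_frag_extend[of "\<lambda>(a, b). frag_of (f a, g b)" x]
      unfolding carrier_free_Abelian_group_iff by (rule order_trans[rotated])
  qed (simp add: frag_extend_add)
  have h: "tensor_class R A' B' \<circ> ?e \<in> hom T.F (tensor R A' B')"
    using hom_compose[OF e T'.tensor_class_hom] .
  have kill: "(tensor_class R A' B' \<circ> ?e) x = \<one>\<^bsub>tensor R A' B'\<^esub>" if "x \<in> tensor_generators R A B" for x
  proof -
    have "?e x \<in> tensor_generators R A' B'"  (is ?goal)
      using that[unfolded tensor_generators_def]
    proof (elim UnE CollectE exE conjE)
      fix a a' b assume "x = frag_of (a \<oplus>\<^bsub>A\<^esub> a', b) - frag_of (a, b) - frag_of (a', b)"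
        and "a \<in> carrier A" "a' \<in> carrier A" "b \<in> carrier B"
      then show ?goal by (simp add: frag_extend_diff fg tensor_generatorsI)
    next
      fix a b b' assume "x = frag_of (a, b \<oplus>\<^bsub>B\<^esub> b') - frag_of (a, b) - frag_of (a, b')"
        and "a \<in> carrier A" "b \<in> carrier B" "b' \<in> carrier B"
      then show ?goal by (simp add: frag_extend_diff fg tensor_generatorsI)
    next
      fix a r b assume "x = frag_of (r \<odot>\<^bsub>A\<^esub> a, b) - frag_of (a, r \<odot>\<^bsub>B\<^esub> b)"
        and "a \<in> carrier A" "r \<in> carrier R" "b \<in> carrier B"
      then show ?goal by (simp add: frag_extend_diff fg tensor_generatorsI)
    qed
    then show ?thesis
      using T'.tensor_class_eq_diff[of "?e x" 0] by (simp add: T'.tensor_class_zero)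
  qed
  obtain k where k: "k \<in> hom (tensor R A B) (tensor R A' B')"
      "\<And>x. x \<in> carrier T.F \<Longrightarrow> k (tensor_class R A B x) = (tensor_class R A' B' \<circ> ?e) x"
    using T.tensor_lift_class[OF T'.T.is_group h kill] by blast
  have eq: "tensor_map R A' B' f g C = k C" if C: "C \<in> carrier (tensor R A B)" for C
  proof -
    obtain x where x: "x \<in> carrier T.F" "C = tensor_class R A B x"
      using C T.tensor_class_cases by blast
    have "tensor_class R A' B' (?e y) = k C" if "y \<in> C" for y
      using T.tensor_class_eqI[of y x] k(2)[of y] that x by simp
    \<comment> \<open>A representative exists, so the union of equal cosets is not empty.\<close>
    moreover have "x \<in> C" using x T.tensor_class_self by blast
    ultimately show ?thesis unfolding tensor_map_def by blast
  qed
  show "tensor_map R A' B' f g \<in> hom (tensor R A B) (tensor R A' B')"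
    using k(1) eq by (auto simp: hom_def)
  assume "a \<in> carrier A" "b \<in> carrier B"
  then show "tensor_map R A' B' f g (pure_tensor R A B a b) = pure_tensor R A' B' (f a) (g b)"
    using eq k(2)[of "frag_of (a, b)"] T.pure_tensor_closed by (simp add: pure_tensor_def)
qed

text \<open>For surjective \<open>h\<close> the balancing relations over \<open>R\<close> and over
  \<open>S\<close> are the same set, so the two tensor groups are equal and not merely
  isomorphic.\<close>

lemma tensor_relations_restrict_scalars:
  assumes "h ` carrier R = carrier S"
  shows "tensor_relations R (restrict_scalars h A) (restrict_scalars h B) = tensor_relations S A B"
proof -
  have "{frag_of (h r \<odot>\<^bsub>A\<^esub> a, b) - frag_of (a, h r \<odot>\<^bsub>B\<^esub> b) | a r b.
         a \<in> carrier A \<and> r \<in> carrier R \<and> b \<in> carrier B} =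
      {frag_of (r \<odot>\<^bsub>A\<^esub> a, b) - frag_of (a, r \<odot>\<^bsub>B\<^esub> b) | a r b.
         a \<in> carrier A \<and> r \<in> carrier S \<and> b \<in> carrier B}"
    unfolding assms[symmetric] by blast
  then show ?thesis by (simp add: tensor_relations_def)
qed

lemma tensor_cong:
  assumes "carrier A' = carrier A" "carrier B' = carrier B"
    and "tensor_relations R' A' B' = tensor_relations R A B"
  shows "tensor R' A' B' = tensor R A B"
    and "tensor_map R' A' B' f g = tensor_map R A B f g"
  using assms by (simp_all add: tensor_def tensor_map_def tensor_class_def fun_eq_iff)

section \<open>Split extensions with nilpotent kernel\<close>

text \<open>The maps \<open>j\<close> and \<open>p\<close> are the inclusion and the projection of the part of degree one,
  and \<open>V k\<close> is the part of degree at least \<open>k\<close>.  By \<open>kernel_induct\<close>, every element of the kernel of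
  \<open>\<pi>\<close> is a sum of products $j(m_1)\cdots j(m_k)$ with $k\ge 1$.\<close>

locale split_extension =
  fixes R :: "('a, 'r) ring_scheme" and S :: "('s, 'q) ring_scheme"
    and M :: "('a, 'm, 'z) bimodule_scheme"
    and \<pi> :: "'s \<Rightarrow> 'a" and \<iota> :: "'a \<Rightarrow> 's" and j :: "'m \<Rightarrow> 's" and p :: "'s \<Rightarrow> 'm"
    and V :: "nat \<Rightarrow> 's set" and n :: nat
  assumes ring_R: "ring R" and ring_S: "ring S" and bimodule: "bimodule R M"
    and \<pi>_hom: "\<pi> \<in> ring_hom S R" and \<iota>_hom: "\<iota> \<in> ring_hom R S"
    and \<pi>_\<iota> [simp]: "r \<in> carrier R \<Longrightarrow> \<pi> (\<iota> r) = r"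
    and j_closed [simp]: "m \<in> carrier M \<Longrightarrow> j m \<in> carrier S"
    and \<pi>_j [simp]: "m \<in> carrier M \<Longrightarrow> \<pi> (j m) = \<zero>\<^bsub>R\<^esub>"
    and j_add: "\<lbrakk>m \<in> carrier M; m' \<in> carrier M\<rbrakk> \<Longrightarrow> j (m \<oplus>\<^bsub>M\<^esub> m') = j m \<oplus>\<^bsub>S\<^esub> j m'"
    and j_smult: "\<lbrakk>r \<in> carrier R; m \<in> carrier M\<rbrakk> \<Longrightarrow> j (r \<odot>\<^bsub>M\<^esub> m) = \<iota> r \<otimes>\<^bsub>S\<^esub> j m"
    and j_right_smult: "\<lbrakk>r \<in> carrier R; m \<in> carrier M\<rbrakk> \<Longrightarrow> j (right_smult M r m) = j m \<otimes>\<^bsub>S\<^esub> \<iota> r"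
    and p_closed [simp]: "s \<in> carrier S \<Longrightarrow> p s \<in> carrier M"
    and p_j [simp]: "m \<in> carrier M \<Longrightarrow> p (j m) = m"
    and p_add: "\<lbrakk>s \<in> carrier S; t \<in> carrier S\<rbrakk> \<Longrightarrow> p (s \<oplus>\<^bsub>S\<^esub> t) = p s \<oplus>\<^bsub>M\<^esub> p t"
    and p_mult: "\<lbrakk>s \<in> carrier S; t \<in> carrier S\<rbrakk> \<Longrightarrow>
      p (s \<otimes>\<^bsub>S\<^esub> t) = \<pi> s \<odot>\<^bsub>M\<^esub> p t \<oplus>\<^bsub>M\<^esub> right_smult M (\<pi> t) (p s)"
    and kernel_induct: "\<lbrakk>i \<in> carrier S; \<pi> i = \<zero>\<^bsub>R\<^esub>; Q \<zero>\<^bsub>S\<^esub>;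
      \<And>x y. \<lbrakk>x \<in> carrier S; y \<in> carrier S; Q x; Q y\<rbrakk> \<Longrightarrow> Q (x \<oplus>\<^bsub>S\<^esub> y);
      \<And>m. m \<in> carrier M \<Longrightarrow> Q (j m);
      \<And>m x. \<lbrakk>m \<in> carrier M; x \<in> carrier S; \<pi> x = \<zero>\<^bsub>R\<^esub>; Q x\<rbrakk> \<Longrightarrow> Q (j m \<otimes>\<^bsub>S\<^esub> x)\<rbrakk> \<Longrightarrow> Q i"
    and V_subset: "V k \<subseteq> carrier S"
    and V_0: "V 0 = carrier S"
    and V_Suc: "V (Suc n) = {\<zero>\<^bsub>S\<^esub>}"
    and V_mult: "\<lbrakk>i \<in> carrier S; \<pi> i = \<zero>\<^bsub>R\<^esub>; s \<in> V k\<rbrakk> \<Longrightarrow> i \<otimes>\<^bsub>S\<^esub> s \<in> V (Suc k)"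
begin

sublocale R: ring R by (rule ring_R)
sublocale S: ring S by (rule ring_S)
sublocale M: left_module R M using bimodule by (simp add: bimodule_def)
sublocale MR: left_module "opposite_ring R" "right_part M"
  using bimodule by (simp add: bimodule_def right_module_def)

lemma right_M: "right_module R (right_part M)"
  using bimodule by (simp add: bimodule_def)

lemmas \<pi>_simps [simp] = ring_hom_closed[OF \<pi>_hom] ring_hom_add[OF \<pi>_hom] ring_hom_mult[OF \<pi>_hom]
  ring_hom_one[OF \<pi>_hom] ring_hom_zero[OF \<pi>_hom ring_S ring_R]

lemmas \<iota>_simps [simp] = ring_hom_closed[OF \<iota>_hom]
  ring_hom_one[OF \<iota>_hom] ring_hom_zero[OF \<iota>_hom ring_R ring_S]

lemma \<pi>_surj: "\<pi> ` carrier S = carrier R"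
proof
  show "carrier R \<subseteq> \<pi> ` carrier S"
    by (rule subsetI) (metis \<pi>_\<iota> \<iota>_simps(1) image_eqI)
qed auto

lemmas ideal_induct [consumes 2, case_names zero add gen mult] = kernel_induct

section \<open>Simple modules over the extension\<close>

lemma decompose:
  assumes "s \<in> carrier S"
  obtains i where "i \<in> carrier S" "\<pi> i = \<zero>\<^bsub>R\<^esub>" "s = \<iota> (\<pi> s) \<oplus>\<^bsub>S\<^esub> i"
proof
  let ?i = "\<ominus>\<^bsub>S\<^esub> \<iota> (\<pi> s) \<oplus>\<^bsub>S\<^esub> s"
  have neg: "\<pi> (\<ominus>\<^bsub>S\<^esub> x) = \<ominus>\<^bsub>R\<^esub> \<pi> x" if "x \<in> carrier S" for x
  proof -
    have "\<pi> (\<ominus>\<^bsub>S\<^esub> x) \<oplus>\<^bsub>R\<^esub> \<pi> x = \<zero>\<^bsub>R\<^esub>"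
      using that by (simp add: S.l_neg flip: ring_hom_add[OF \<pi>_hom])
    then show ?thesis using that R.minus_equality by simp
  qed
  show "?i \<in> carrier S" "\<pi> ?i = \<zero>\<^bsub>R\<^esub>" "s = \<iota> (\<pi> s) \<oplus>\<^bsub>S\<^esub> ?i"
    using assms by (simp_all add: neg R.l_neg S.r_neg flip: S.a_assoc)
qed

text \<open>The elements killed by the kernel form a submodule, because the kernel is closed under
  right multiplication by \<open>S\<close>. The filtration provides a nonzero element of it, so by
  simplicity it is everything.\<close>

lemma simple_killed:
  assumes "simple_module S X" "i \<in> carrier S" "\<pi> i = \<zero>\<^bsub>R\<^esub>" "x \<in> carrier X"
  shows "i \<odot>\<^bsub>X\<^esub> x = \<zero>\<^bsub>X\<^esub>"
proof -
  have X: "left_module S X" using assms(1) by (simp add: simple_module_def)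
  interpret X: left_module S X by fact
  let ?N = "{x \<in> carrier X. \<forall>i\<in>carrier S. \<pi> i = \<zero>\<^bsub>R\<^esub> \<longrightarrow> i \<odot>\<^bsub>X\<^esub> x = \<zero>\<^bsub>X\<^esub>}"
  have "submodule ?N S X"
    unfolding submodule_iff[OF X]
    by (auto simp: X.smult_r_distr X.smult_closed simp flip: X.smult_assoc)
  then have cases: "?N = {\<zero>\<^bsub>X\<^esub>} \<or> ?N = carrier X"
    using assms(1) by (simp add: simple_module_def)
  obtain y where y: "y \<in> carrier X" "y \<noteq> \<zero>\<^bsub>X\<^esub>"
    using assms(1) X.M.zero_closed unfolding simple_module_def by blast
  define K where "K k \<longleftrightarrow> (\<forall>s\<in>V k. \<forall>x\<in>carrier X. s \<odot>\<^bsub>X\<^esub> x = \<zero>\<^bsub>X\<^esub>)" for k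
  have "K (Suc n)" by (simp add: K_def V_Suc)
  moreover have "\<not> K 0" using y X.smult_one[of y] S.one_closed unfolding K_def V_0 by metis
  \<comment> \<open>\<open>K k\<close> says that \<open>V k\<close> annihilates \<open>X\<close>. It
    fails at 0, where the identity acts, and holds at n + 1, so some failing level is followed by
    one that holds. A nonzero product from the failing level is killed by the kernel, which moves it
    to the next level.\<close>
  ultimately obtain k where "\<not> K k" and K: "K (Suc k)" using dec_induct[of 0 "Suc n" "\<lambda>k. \<not> K k"] by blast
  then obtain s z where sz: "s \<in> V k" "z \<in> carrier X" "s \<odot>\<^bsub>X\<^esub> z \<noteq> \<zero>\<^bsub>X\<^esub>" unfolding K_def by blast
  have s: "s \<in> carrier S" using sz(1) V_subset by blast
  have "s \<odot>\<^bsub>X\<^esub> z \<in> ?N"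
    using sz s K V_mult unfolding K_def by (auto simp: X.smult_closed simp flip: X.smult_assoc)
  then have "?N \<noteq> {\<zero>\<^bsub>X\<^esub>}" using sz(3) by blast
  then show ?thesis using cases assms(2-4) by blast
qed

lemma simple_smult:
  assumes "simple_module S X" "s \<in> carrier S" "x \<in> carrier X"
  shows "\<iota> (\<pi> s) \<odot>\<^bsub>X\<^esub> x = s \<odot>\<^bsub>X\<^esub> x"
proof -
  interpret X: left_module S X using assms(1) by (simp add: simple_module_def)
  obtain i where i: "i \<in> carrier S" "\<pi> i = \<zero>\<^bsub>R\<^esub>" "s = \<iota> (\<pi> s) \<oplus>\<^bsub>S\<^esub> i"
    using decompose assms(2) by blast
  have "s \<odot>\<^bsub>X\<^esub> x = \<iota> (\<pi> s) \<odot>\<^bsub>X\<^esub> x \<oplus>\<^bsub>X\<^esub> i \<odot>\<^bsub>X\<^esub> x"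
    using i assms X.smult_l_distr[of "\<iota> (\<pi> s)" i x] by simp
  then show ?thesis
    using simple_killed[OF assms(1) i(1,2) assms(3)] assms X.smult_closed by simp
qed

text \<open>Each \<open>s\<close> acts on \<open>X\<close> as \<open>\<iota> (\<pi> s)\<close> does,
  so a subgroup stable under \<open>R\<close> is stable under \<open>S\<close> and no new submodules
  appear.\<close>

lemma simple_restrict:
  assumes "simple_module S X"
  shows "simple_module R (restrict_scalars \<iota> X)"
  unfolding simple_module_def
proof (intro conjI allI impI)
  have X: "left_module S X" using assms by (simp add: simple_module_def)
  show R: "left_module R (restrict_scalars \<iota> X)"
    by (rule left_module_restrict_scalars[OF \<iota>_hom ring_R X])
  show "carrier (restrict_scalars \<iota> X) \<noteq> {\<zero>\<^bsub>restrict_scalars \<iota> X\<^esub>}"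
    using assms by (simp add: simple_module_def)
  fix N assume N: "submodule N R (restrict_scalars \<iota> X)"
  have "s \<odot>\<^bsub>X\<^esub> x \<in> N" if "s \<in> carrier S" "x \<in> N" for s x
  proof -
    have "x \<in> carrier X" using N that(2) unfolding submodule_iff[OF R] by auto
    moreover have "\<iota> (\<pi> s) \<odot>\<^bsub>X\<^esub> x \<in> N" using N that unfolding submodule_iff[OF R] by simp
    ultimately show ?thesis using simple_smult[OF assms that(1)] by simp
  qed
  then have "submodule N S X"
    using N unfolding submodule_iff[OF R] submodule_iff[OF X] by auto
  then show "N = {\<zero>\<^bsub>restrict_scalars \<iota> X\<^esub>} \<or> N = carrier (restrict_scalars \<iota> X)"
    using assms by (simp add: simple_module_def)
qed

lemma simple_inflate:
  "simple_module R X \<Longrightarrow> simple_module S (restrict_scalars \<pi> X)"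
  by (rule simple_module_restrict_scalars[OF \<pi>_hom \<pi>_surj ring_S])

lemma right_restrict_\<iota>: "right_module S A \<Longrightarrow> right_module R (restrict_scalars \<iota> A)"
  unfolding right_module_def
  by (rule left_module_restrict_scalars[OF ring_hom_opposite_ring[OF \<iota>_hom] ring_opposite_ring[OF ring_R]])

lemma right_restrict_\<pi>: "right_module R A \<Longrightarrow> right_module S (restrict_scalars \<pi> A)"
  unfolding right_module_def
  by (rule left_module_restrict_scalars[OF ring_hom_opposite_ring[OF \<pi>_hom] ring_opposite_ring[OF ring_S]])

abbreviation "I \<equiv> {i \<in> carrier S. \<pi> i = \<zero>\<^bsub>R\<^esub>}"

text \<open>As a left ideal the kernel tests injectivity; as a right ideal, in
  \<open>right_kernel\<close>, it tests flatness.\<close>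

abbreviation "left_kernel \<equiv> (regular_module S)\<lparr>carrier := I\<rparr>"

abbreviation "right_kernel \<equiv> (regular_module (opposite_ring S))\<lparr>carrier := I\<rparr>"

lemma left_module_left_kernel: "left_module S left_kernel"
  by (rule left_module_submodule[OF left_module_regular[OF ring_S]])
    (auto simp: submodule_iff[OF left_module_regular[OF ring_S]])

lemma right_module_right_kernel: "left_module (opposite_ring S) right_kernel"
  by (rule left_module_submodule[OF left_module_regular[OF ring_opposite_ring[OF ring_S]]])
    (auto simp: submodule_iff[OF left_module_regular[OF ring_opposite_ring[OF ring_S]]])

subsection \<open>SF rings\<close>

text \<open>For fixed \<open>a\<close> the map sending (m, x) to a j(m) \<otimes> x is balanced, so
  it factors through M \<otimes> X = 0. This settles degree one; sums and products reach the rest of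
  the kernel.\<close>

lemma tensor_kernel_trivial:
  assumes A: "right_module S A" and X: "left_module S X"
    and triv: "carrier (tensor R (right_part M) (restrict_scalars \<iota> X))
      = {\<one>\<^bsub>tensor R (right_part M) (restrict_scalars \<iota> X)\<^esub>}"
    and i: "i \<in> carrier S" "\<pi> i = \<zero>\<^bsub>R\<^esub>" and ax: "a \<in> carrier A" "x \<in> carrier X"
  shows "pure_tensor R (restrict_scalars \<iota> A) (restrict_scalars \<iota> X) (i \<odot>\<^bsub>A\<^esub> a) x =
    \<one>\<^bsub>tensor R (restrict_scalars \<iota> A) (restrict_scalars \<iota> X)\<^esub>"
proof -
  let ?A = "restrict_scalars \<iota> A" and ?X = "restrict_scalars \<iota> X"
  interpret A: left_module "opposite_ring S" A using A by (simp add: right_module_def)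
  interpret X: left_module S X by fact
  note XR = left_module_restrict_scalars[OF \<iota>_hom ring_R X]
  interpret T: tensor_product R ?A ?X
    by (rule tensor_product.intro[OF right_restrict_\<iota>[OF A] XR])
  interpret TM: tensor_product R "right_part M" ?X
    by (rule tensor_product.intro[OF right_M XR])
  note closed = A.smult_closed[simplified] X.smult_closed
  \<comment> \<open>The quantifier over \<open>a\<close> belongs to the induction: a (j(m) s) = (a
    j(m)) s, so the product case uses the hypothesis at a j(m).\<close>
  have "\<forall>a\<in>carrier A. \<forall>x\<in>carrier X. pure_tensor R ?A ?X (i \<odot>\<^bsub>A\<^esub> a) x = \<one>\<^bsub>tensor R ?A ?X\<^esub>"
    using i
  proof (induction rule: ideal_induct)
    case zero
    then show ?case using A.smult_zero_left T.pure_tensor_zero_left by simp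
  next
    case (add s t)
    then show ?case
      using A.smult_l_distr T.pure_tensor_add_left closed by simp
  next
    case (gen m)
    show ?case
    proof (intro ballI)
      fix a x assume ax: "a \<in> carrier A" "x \<in> carrier X"
      have "balanced R (right_part M) ?X (tensor R ?A ?X) (\<lambda>m x. pure_tensor R ?A ?X (j m \<odot>\<^bsub>A\<^esub> a) x)"
        unfolding balanced_def
      proof (intro conjI ballI)
        fix m r x assume "m \<in> carrier (right_part M)" "r \<in> carrier R" "x \<in> carrier ?X"
        then show "pure_tensor R ?A ?X (j (r \<odot>\<^bsub>right_part M\<^esub> m) \<odot>\<^bsub>A\<^esub> a) x =
            pure_tensor R ?A ?X (j m \<odot>\<^bsub>A\<^esub> a) (r \<odot>\<^bsub>?X\<^esub> x)"
          using ax T.pure_tensor_smult[of "j m \<odot>\<^bsub>A\<^esub> a" r x] A.smult_assoc[of "\<iota> r" "j m" a] closed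
          by (simp add: j_right_smult)
      next
        fix m m' x assume "m \<in> carrier (right_part M)" "m' \<in> carrier (right_part M)" "x \<in> carrier ?X"
        then show "pure_tensor R ?A ?X (j (m \<oplus>\<^bsub>right_part M\<^esub> m') \<odot>\<^bsub>A\<^esub> a) x =
            pure_tensor R ?A ?X (j m \<odot>\<^bsub>A\<^esub> a) x \<otimes>\<^bsub>tensor R ?A ?X\<^esub> pure_tensor R ?A ?X (j m' \<odot>\<^bsub>A\<^esub> a) x"
          using ax T.pure_tensor_add_left[of "j m \<odot>\<^bsub>A\<^esub> a" "j m' \<odot>\<^bsub>A\<^esub> a" x] closed
            A.smult_l_distr[of "j m" "j m'" a] by (simp add: j_add)
      qed (use ax closed T.pure_tensor_closed T.pure_tensor_add_right in auto)
      from TM.tensor_lift[OF T.comm_group_tensor this]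
      obtain k where k: "k \<in> hom (tensor R (right_part M) ?X) (tensor R ?A ?X)"
        "\<And>m x. \<lbrakk>m \<in> carrier M; x \<in> carrier X\<rbrakk> \<Longrightarrow>
          k (pure_tensor R (right_part M) ?X m x) = pure_tensor R ?A ?X (j m \<odot>\<^bsub>A\<^esub> a) x" by auto
      have "pure_tensor R (right_part M) ?X m x = \<one>\<^bsub>tensor R (right_part M) ?X\<^esub>"
        using triv gen ax TM.pure_tensor_closed[of m x] by auto
      then show "pure_tensor R ?A ?X (j m \<odot>\<^bsub>A\<^esub> a) x = \<one>\<^bsub>tensor R ?A ?X\<^esub>"
        using k(2)[of m x] gen ax hom_one[OF k(1) TM.T.is_group T.T.is_group] by simp
    qed
  next
    case (mult m s)
    then show ?case using A.smult_assoc[of s "j m"] closed(1)[of "j m"] by simp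
  qed
  then show ?thesis using ax by blast
qed

text \<open>Only balancing by scalars outside the image of \<open>\<iota>\<close> could be new over
  \<open>S\<close>. Write s as the sum of \<open>\<iota> (\<pi> s)\<close> and a kernel element i:
  the term a i \<otimes> x vanishes over \<open>R\<close>, and \<open>\<iota> (\<pi> s)\<close> acts
  on \<open>X\<close> as s does, so the relation for s already holds over \<open>R\<close>.\<close>

lemma tensor_relations_simple:
  assumes A: "right_module S A" and X: "simple_module S X"
    and triv: "carrier (tensor R (right_part M) (restrict_scalars \<iota> X))
      = {\<one>\<^bsub>tensor R (right_part M) (restrict_scalars \<iota> X)\<^esub>}"
  shows "tensor_relations R (restrict_scalars \<iota> A) (restrict_scalars \<iota> X) = tensor_relations S A X"
proof -
  let ?A = "restrict_scalars \<iota> A" and ?X = "restrict_scalars \<iota> X"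
  have XS: "left_module S X" using X by (simp add: simple_module_def)
  interpret A: left_module "opposite_ring S" A using A by (simp add: right_module_def)
  interpret X: left_module S X by fact
  interpret TS: tensor_product S A X by (rule tensor_product.intro[OF A XS])
  interpret T: tensor_product R ?A ?X
    by (rule tensor_product.intro[OF right_restrict_\<iota>[OF A]
          left_module_restrict_scalars[OF \<iota>_hom ring_R XS]])
  note closed = A.smult_closed[simplified] X.smult_closed
  have "tensor_generators R ?A ?X \<subseteq> tensor_generators S A X"
    unfolding tensor_generators_def restrict_scalars_simps using \<iota>_simps(1) by blast
  then have 1: "tensor_relations R ?A ?X \<subseteq> tensor_relations S A X"
    unfolding tensor_relations_eq restrict_scalars_simps
    by (rule TS.F.mono_generate)
  have "g \<in> tensor_relations R ?A ?X" if "g \<in> tensor_generators S A X" for g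
  proof (cases "\<exists>a s x. a \<in> carrier A \<and> s \<in> carrier S \<and> x \<in> carrier X \<and>
      g = frag_of (s \<odot>\<^bsub>A\<^esub> a, x) - frag_of (a, s \<odot>\<^bsub>X\<^esub> x)")
    case False
    then have "g \<in> tensor_generators R ?A ?X"
      using that unfolding tensor_generators_def restrict_scalars_simps by blast
    then show ?thesis unfolding tensor_relations_eq by (rule generate.incl)
  next
    case True
    then obtain a s x where asx: "a \<in> carrier A" "s \<in> carrier S" "x \<in> carrier X"
      and g: "g = frag_of (s \<odot>\<^bsub>A\<^esub> a, x) - frag_of (a, s \<odot>\<^bsub>X\<^esub> x)" by blast
    obtain i where i: "i \<in> carrier S" "\<pi> i = \<zero>\<^bsub>R\<^esub>" "s = \<iota> (\<pi> s) \<oplus>\<^bsub>S\<^esub> i"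
      using decompose asx(2) by blast
    have "s \<odot>\<^bsub>A\<^esub> a = \<iota> (\<pi> s) \<odot>\<^bsub>A\<^esub> a \<oplus>\<^bsub>A\<^esub> i \<odot>\<^bsub>A\<^esub> a"
      using i asx A.smult_l_distr[of "\<iota> (\<pi> s)" i a] by simp
    then have "pure_tensor R ?A ?X (s \<odot>\<^bsub>A\<^esub> a) x = pure_tensor R ?A ?X (\<iota> (\<pi> s) \<odot>\<^bsub>A\<^esub> a) x"
      using T.pure_tensor_add_left[of "\<iota> (\<pi> s) \<odot>\<^bsub>A\<^esub> a" "i \<odot>\<^bsub>A\<^esub> a" x] asx i closed
        tensor_kernel_trivial[OF A XS triv i(1,2), of a x] T.pure_tensor_closed by simp
    also have "\<dots> = pure_tensor R ?A ?X a (s \<odot>\<^bsub>X\<^esub> x)"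
      using T.pure_tensor_smult[of a "\<pi> s" x] asx simple_smult[OF X asx(2,3)] by simp
    finally show ?thesis
      using T.tensor_class_eqD asx closed unfolding pure_tensor_def g by simp
  qed
  then have "tensor_generators S A X \<subseteq> tensor_relations R ?A ?X" by blast
  then have "tensor_relations S A X \<subseteq> tensor_relations R ?A ?X"
    unfolding tensor_relations_eq[of S]
    by (rule TS.F.generate_subgroup_incl) (use T.relations_subgroup in simp)
  with 1 show ?thesis by blast
qed

text \<open>Inflation along the surjection leaves the tensor relations unchanged, so injectivity of
  the induced map over \<open>S\<close> is literally injectivity over \<open>R\<close>.\<close>

lemma flat_restrict:
  fixes U :: "'u itself"
  assumes X: "left_module R X" and flat: "flat_module U S (restrict_scalars \<pi> X)"
  shows "flat_module U R X"
  unfolding flat_module_def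
proof (intro conjI allI ballI impI X)
  fix A B :: "('a, 'u) module" and f
  assume f: "f \<in> module_hom (opposite_ring R) A B"
    and AB: "right_module R A \<and> right_module R B \<and> inj_on f (carrier A)"
  let ?r = "\<lambda>A :: ('a, 'u) module. restrict_scalars \<pi> A"
  have "f \<in> module_hom (opposite_ring S) (?r A) (?r B)"
    using f linear_map_restrict_scalars[OF ring_hom_opposite_ring[OF \<pi>_hom]]
    by (auto simp: module_hom_iff)
  then have "inj_on (tensor_map S (?r B) (restrict_scalars \<pi> X) f (\<lambda>x. x))
      (carrier (tensor S (?r A) (restrict_scalars \<pi> X)))"
    using flat AB right_restrict_\<pi>[of A] right_restrict_\<pi>[of B]
    unfolding flat_module_def by (metis restrict_scalars_simps(1))
  then show "inj_on (tensor_map R B X f (\<lambda>x. x)) (carrier (tensor R A X))"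
    by (simp add: tensor_cong[OF _ _ tensor_relations_restrict_scalars[OF \<pi>_surj]])
qed

text \<open>An injection of right \<open>S\<close>-modules is one of right \<open>R\<close>-modules
  through \<open>\<iota>\<close>, and by \<open>tensor_relations_simple\<close> the tensor groups
  and maps before and after restriction are the same.\<close>

lemma flat_extend:
  fixes U :: "'u itself"
  assumes X: "simple_module S X" and flat: "flat_module U R (restrict_scalars \<iota> X)"
    and triv: "carrier (tensor R (right_part M) (restrict_scalars \<iota> X))
      = {\<one>\<^bsub>tensor R (right_part M) (restrict_scalars \<iota> X)\<^esub>}"
  shows "flat_module U S X"
  unfolding flat_module_def
proof (intro conjI allI ballI impI)
  show "left_module S X" using X by (simp add: simple_module_def)
  fix A B :: "('s, 'u) module" and f
  assume f: "f \<in> module_hom (opposite_ring S) A B"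
    and AB: "right_module S A \<and> right_module S B \<and> inj_on f (carrier A)"
  let ?r = "\<lambda>A :: ('s, 'u) module. restrict_scalars \<iota> A"
  have "f \<in> module_hom (opposite_ring R) (?r A) (?r B)"
    using f linear_map_restrict_scalars[OF ring_hom_opposite_ring[OF \<iota>_hom]]
    by (auto simp: module_hom_iff)
  then have "inj_on (tensor_map R (?r B) (restrict_scalars \<iota> X) f (\<lambda>x. x))
      (carrier (tensor R (?r A) (restrict_scalars \<iota> X)))"
    using flat AB right_restrict_\<iota>[of A] right_restrict_\<iota>[of B]
    unfolding flat_module_def by (metis restrict_scalars_simps(1))
  then show "inj_on (tensor_map S B X f (\<lambda>x. x)) (carrier (tensor S A X))"
    using AB by (simp add: tensor_cong[OF _ _ tensor_relations_simple[OF _ X triv]])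
qed

text \<open>Flatness is tested on the inclusion of the right ideal \<open>I\<close> into
  \<open>S\<close>, both copied by \<open>e\<close> into the element type of the test
  modules.\<close>

lemma tensor_trivial_of_flat:
  fixes e :: "'s \<Rightarrow> 'u" and X :: "('a, 'v) module"
  assumes e: "inj_on e (carrier S)" and X: "simple_module R X"
    and flat: "flat_module TYPE('u) S (restrict_scalars \<pi> X)"
  shows "carrier (tensor R (right_part M) X) = {\<one>\<^bsub>tensor R (right_part M) X\<^esub>}"
proof -
  let ?X = "restrict_scalars \<pi> X"
  let ?A = "transport_module e right_kernel"
  let ?B = "transport_module e (regular_module (opposite_ring S))"
  let ?f = "\<lambda>x\<in>carrier ?A. x"
  have XR: "left_module R X" using X by (simp add: simple_module_def)
  note XS = left_module_restrict_scalars[OF \<pi>_hom ring_S XR]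
  note mB' = left_module_regular[OF ring_opposite_ring[OF ring_S]]
  have eB: "inj_on e (carrier (regular_module (opposite_ring S)))" using e by simp
  have eA: "inj_on e (carrier right_kernel)" by (rule inj_on_subset[OF e]) auto
  note simpA = transport_module_simps[OF eA] and simpB = transport_module_simps[OF eB]
  note mA = left_module_transport[OF eA right_module_right_kernel]
  note mB = left_module_transport[OF eB mB']
  interpret X: left_module R X by fact
  interpret TA: tensor_product S ?A ?X
    by (rule tensor_product.intro) (use mA XS in \<open>simp_all add: right_module_def\<close>)
  interpret TB: tensor_product S ?B ?X
    by (rule tensor_product.intro) (use mB XS in \<open>simp_all add: right_module_def\<close>)
  interpret TM: tensor_product R "right_part M" X
    by (rule tensor_product.intro[OF right_M XR])
  have "linear_map (opposite_ring S) ?A ?B (\<lambda>x. x)"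
    using simpA simpB unfolding linear_map_def by auto
  from restrict_module_hom[OF this mA] have f: "?f \<in> module_hom (opposite_ring S) ?A ?B" .
  have inj: "inj_on (tensor_map S ?B ?X ?f (\<lambda>x. x)) (carrier (tensor S ?A ?X))"
    using flat f TA.right TB.right unfolding flat_module_def by (auto simp: inj_on_def)
  have f': "linear_map (opposite_ring S) ?A ?B ?f" using f by (simp add: module_hom_iff)
  have id: "linear_map S ?X ?X (\<lambda>x. x)" by (auto simp: linear_map_def)
  note tm = tensor_map_hom[OF TA.tensor_product_axioms TB.tensor_product_axioms f' id]
  have pA: "pure_tensor S ?A ?X (e (j m)) x = \<one>\<^bsub>tensor S ?A ?X\<^esub>"
    if m: "m \<in> carrier M" and x: "x \<in> carrier X" for m x
  proof -
    have ejm: "e (j m) \<in> carrier ?A" using m simpA by simp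
    \<comment> \<open>In S \<otimes> X one has j(m) \<otimes> x = 1 j(m) \<otimes> x = 1 \<otimes>
      \<pi>(j(m)) x = 0; injectivity of the induced map brings this back to I \<otimes> X.\<close>
    have "e (j m) = j m \<odot>\<^bsub>?B\<^esub> e \<one>\<^bsub>S\<^esub>" using m simpB by simp
    then have "pure_tensor S ?B ?X (e (j m)) x = \<one>\<^bsub>tensor S ?B ?X\<^esub>"
      using TB.pure_tensor_smult[of "e \<one>\<^bsub>S\<^esub>" "j m" x] TB.pure_tensor_zero_right[of "e \<one>\<^bsub>S\<^esub>"] m x simpB
      by simp
    then have "tensor_map S ?B ?X ?f (\<lambda>x. x) (pure_tensor S ?A ?X (e (j m)) x) =
        tensor_map S ?B ?X ?f (\<lambda>x. x) \<one>\<^bsub>tensor S ?A ?X\<^esub>"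
      using tm(2)[OF ejm, of x] x ejm hom_one[OF tm(1) TA.T.is_group TB.T.is_group] by simp
    from inj_onD[OF inj this TA.pure_tensor_closed[OF ejm] TA.T.one_closed] x
    show ?thesis by simp
  qed
  let ?i = "inv_into I e"
  have inv: "?i (e i) = i" if "i \<in> I" for i using that eA by simp
  \<comment> \<open>The map sends i \<otimes> x to p(i) \<otimes> x. On the kernel
    \<open>p_mult\<close> reduces to p(i s) = p(i) \<pi>(s), and p(j(m)) = m makes every pure tensor
    of M \<otimes> X an image of some j(m) \<otimes> x.\<close>
  have "balanced S ?A ?X (tensor R (right_part M) X) (\<lambda>a x. pure_tensor R (right_part M) X (p (?i a)) x)"
    unfolding balanced_def
  proof (intro conjI ballI)
    fix a s x assume "a \<in> carrier ?A" "s \<in> carrier S" "x \<in> carrier ?X"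
    moreover from this obtain i where "i \<in> I" "a = e i" using simpA by auto
    ultimately show "pure_tensor R (right_part M) X (p (?i (s \<odot>\<^bsub>?A\<^esub> a))) x =
        pure_tensor R (right_part M) X (p (?i a)) (s \<odot>\<^bsub>?X\<^esub> x)"
      using simpA(4)[of i s] TM.pure_tensor_smult[of "p i" "\<pi> s" x] inv[of i] inv[of "i \<otimes>\<^bsub>S\<^esub> s"]
        MR.smult_closed[of "\<pi> s" "p i"]
      by (simp add: p_mult M.smult_zero_left)
  next
    fix a a' x assume "a \<in> carrier ?A" "a' \<in> carrier ?A" "x \<in> carrier ?X"
    moreover from this obtain i i' where "i \<in> I" "a = e i" "i' \<in> I" "a' = e i'" using simpA by auto
    ultimately show "pure_tensor R (right_part M) X (p (?i (a \<oplus>\<^bsub>?A\<^esub> a'))) x =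
        pure_tensor R (right_part M) X (p (?i a)) x \<otimes>\<^bsub>tensor R (right_part M) X\<^esub>
        pure_tensor R (right_part M) X (p (?i a')) x"
      using simpA(3)[of i i'] TM.pure_tensor_add_left[of "p i" "p i'" x] inv[of i] inv[of i']
        inv[of "i \<oplus>\<^bsub>S\<^esub> i'"]
      by (simp add: p_add)
  qed (use simpA inv TM.pure_tensor_closed TM.pure_tensor_add_right in auto)
  from TA.tensor_lift[OF TM.comm_group_tensor this]
  obtain k where k: "k \<in> hom (tensor S ?A ?X) (tensor R (right_part M) X)"
    "\<And>a x. \<lbrakk>a \<in> carrier ?A; x \<in> carrier X\<rbrakk> \<Longrightarrow>
      k (pure_tensor S ?A ?X a x) = pure_tensor R (right_part M) X (p (?i a)) x" by auto
  have "pure_tensor R (right_part M) X m x = \<one>\<^bsub>tensor R (right_part M) X\<^esub>"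
    if "m \<in> carrier M" "x \<in> carrier X" for m x
    using k(2)[of "e (j m)" x] pA[OF that] that inv[of "j m"] simpA(1)
      hom_one[OF k(1) TA.T.is_group TM.T.is_group] by simp
  then show ?thesis unfolding TM.tensor_trivial_iff by simp
qed

text \<open>The hypothesis on \<open>e\<close> says that the element type of the test modules has
  room for \<open>S\<close>, hence for its ideals and, through \<open>\<iota>\<close>, for those of
  \<open>R\<close>.\<close>

theorem left_SF_ring_iff:
  fixes e :: "'s \<Rightarrow> 'u"
  assumes "inj_on e (carrier S)"
  shows "left_SF_ring TYPE('u) S \<longleftrightarrow> left_SF_ring TYPE('u) R \<and>
    (\<forall>X :: ('a, 'u) module. simple_module R X \<longrightarrow>
      carrier (tensor R (right_part M) X) = {\<one>\<^bsub>tensor R (right_part M) X\<^esub>})"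
proof
  assume "left_SF_ring TYPE('u) S"
  then have flat: "flat_module TYPE('u) S (restrict_scalars \<pi> X)"
    if "simple_module R X" for X :: "('a, 'u) module"
    using simple_inflate[OF that] by (simp add: left_SF_ring_def)
  show "left_SF_ring TYPE('u) R \<and> (\<forall>X :: ('a, 'u) module. simple_module R X \<longrightarrow>
      carrier (tensor R (right_part M) X) = {\<one>\<^bsub>tensor R (right_part M) X\<^esub>})"
    using flat flat_restrict[OF simple_module_left_module] tensor_trivial_of_flat[OF assms] ring_R
    unfolding left_SF_ring_def by blast
next
  assume "left_SF_ring TYPE('u) R \<and> (\<forall>X :: ('a, 'u) module. simple_module R X \<longrightarrow>
      carrier (tensor R (right_part M) X) = {\<one>\<^bsub>tensor R (right_part M) X\<^esub>})"
  note R = this[unfolded left_SF_ring_def]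
  show "left_SF_ring TYPE('u) S"
    unfolding left_SF_ring_def
  proof (intro conjI allI impI ring_S)
    fix X :: "('s, 'u) module" assume X: "simple_module S X"
    show "flat_module TYPE('u) S X"
      by (rule flat_extend[OF X]) (use R simple_restrict[OF X] in blast)+
  qed
qed

subsection \<open>V-rings\<close>

text \<open>Along the surjection \<open>\<pi>\<close> the \<open>S\<close>-linear maps between
  inflated modules are exactly the \<open>R\<close>-linear maps, so extension problems and their
  solutions correspond.\<close>

lemma injective_restrict:
  fixes U :: "'u itself"
  assumes X: "left_module R X" and inj: "injective_module U S (restrict_scalars \<pi> X)"
  shows "injective_module U R X"
  unfolding injective_module_def
proof (intro conjI allI ballI impI X)
  fix A B :: "('a, 'u) module" and f g
  let ?r = "\<lambda>A :: ('a, 'u) module. restrict_scalars \<pi> A"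
  assume fg: "f \<in> module_hom R A B" "g \<in> module_hom R A X"
    and AB: "left_module R A \<and> left_module R B \<and> inj_on f (carrier A)"
  note lin = linear_map_restrict_scalars_iff[OF \<pi>_surj]
  have "f \<in> module_hom S (?r A) (?r B)" "g \<in> module_hom S (?r A) (restrict_scalars \<pi> X)"
    using fg by (auto simp: module_hom_iff lin)
  then have "\<exists>h\<in>module_hom S (?r B) (restrict_scalars \<pi> X). \<forall>a\<in>carrier A. h (f a) = g a"
    using inj AB left_module_restrict_scalars[OF \<pi>_hom ring_S, of A]
      left_module_restrict_scalars[OF \<pi>_hom ring_S, of B]
    unfolding injective_module_def by (metis restrict_scalars_simps(1))
  then show "\<exists>h\<in>module_hom R B X. \<forall>a\<in>carrier A. h (f a) = g a"
    by (auto simp: module_hom_iff lin)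
qed

lemma injective_extend:
  fixes U :: "'u itself"
  assumes X: "simple_module S X" and inj: "injective_module U R (restrict_scalars \<iota> X)"
    and zero: "module_hom R M (restrict_scalars \<iota> X) = {zero_hom M (restrict_scalars \<iota> X)}"
  shows "injective_module U S X"
  unfolding injective_module_def
proof (intro conjI allI ballI impI)
  show XS: "left_module S X" using X by (simp add: simple_module_def)
  let ?X = "restrict_scalars \<iota> X"
  note XR = left_module_restrict_scalars[OF \<iota>_hom ring_R XS]
  interpret X: left_module S X by fact
  fix A B :: "('s, 'u) module" and f g
  let ?r = "\<lambda>A :: ('s, 'u) module. restrict_scalars \<iota> A"
  assume fg: "f \<in> module_hom S A B" "g \<in> module_hom S A X"
    and AB: "left_module S A \<and> left_module S B \<and> inj_on f (carrier A)"
  interpret B: left_module S B using AB by simp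
  note lin = linear_map_restrict_scalars[OF \<iota>_hom]
  have "f \<in> module_hom R (?r A) (?r B)" "g \<in> module_hom R (?r A) ?X"
    using fg by (auto simp: module_hom_iff lin)
  then obtain h where h: "h \<in> module_hom R (?r B) ?X" "\<And>a. a \<in> carrier A \<Longrightarrow> h (f a) = g a"
    using inj AB left_module_restrict_scalars[OF \<iota>_hom ring_R, of A]
      left_module_restrict_scalars[OF \<iota>_hom ring_R, of B]
    unfolding injective_module_def by (metis restrict_scalars_simps(1))
  have hl: "linear_map R (?r B) ?X h" using h(1) by (simp add: module_hom_iff)
  note hD = linear_mapD[OF hl, simplified]
  have hj: "h (j m \<odot>\<^bsub>B\<^esub> b) = \<zero>\<^bsub>X\<^esub>" if "m \<in> carrier M" "b \<in> carrier B" for m b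
  proof -
    have "linear_map R M ?X (\<lambda>m. h (j m \<odot>\<^bsub>B\<^esub> b))"
      unfolding linear_map_def
      using that by (auto simp: j_add j_smult B.smult_l_distr B.smult_assoc B.smult_closed hD)
    then show ?thesis
      using zero that unfolding module_hom_eq_zero_iff[OF M.left_module_axioms XR] by auto
  qed
  \<comment> \<open>For a product j(m) x the fact \<open>hj\<close> is applied at the element x b,
    which disposes of all degrees at once.\<close>
  have hi: "\<forall>b\<in>carrier B. h (i \<odot>\<^bsub>B\<^esub> b) = \<zero>\<^bsub>X\<^esub>" if "i \<in> carrier S" "\<pi> i = \<zero>\<^bsub>R\<^esub>" for i
    using that
  proof (induction rule: ideal_induct)
    case zero
    show ?case
      using linear_map_zero[OF hl left_module_restrict_scalars[OF \<iota>_hom ring_R B.left_module_axioms] XR]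
      by (simp add: B.smult_zero_left)
  next
    case (add x y)
    then show ?case by (simp add: B.smult_l_distr B.smult_closed hD)
  next
    case (mult m x)
    then show ?case using hj by (simp add: B.smult_assoc B.smult_closed)
  qed (use hj in simp)
  \<comment> \<open>The kernel contributes zero on both sides: h(i b) = 0 by \<open>hi\<close>, and
    i acts as zero on the simple module \<open>X\<close>. What remains is linearity over
    \<open>R\<close>.\<close>
  have "h (s \<odot>\<^bsub>B\<^esub> b) = s \<odot>\<^bsub>X\<^esub> h b" if sb: "s \<in> carrier S" "b \<in> carrier B" for s b
  proof -
    obtain i where i: "i \<in> carrier S" "\<pi> i = \<zero>\<^bsub>R\<^esub>" "s = \<iota> (\<pi> s) \<oplus>\<^bsub>S\<^esub> i"
      using decompose sb(1) by blast
    have "s \<odot>\<^bsub>B\<^esub> b = \<iota> (\<pi> s) \<odot>\<^bsub>B\<^esub> b \<oplus>\<^bsub>B\<^esub> i \<odot>\<^bsub>B\<^esub> b"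
      using i sb B.smult_l_distr[of "\<iota> (\<pi> s)" i b] by simp
    then have "h (s \<odot>\<^bsub>B\<^esub> b) = \<iota> (\<pi> s) \<odot>\<^bsub>X\<^esub> h b"
      using i sb hi by (simp add: hD B.smult_closed X.smult_closed)
    then show ?thesis using simple_smult[OF X sb(1)] hD(1) sb by simp
  qed
  then have "h \<in> module_hom S B X"
    using hD h(1) by (simp add: module_hom_iff linear_map_def)
  then show "\<exists>h\<in>module_hom S B X. \<forall>a\<in>carrier A. h (f a) = g a"
    using h(2) by (intro bexI[of _ h]) auto
qed

lemma hom_trivial_of_injective:
  fixes e :: "'s \<Rightarrow> 'u" and X :: "('a, 'v) module"
  assumes e: "inj_on e (carrier S)" and X: "simple_module R X"
    and inj: "injective_module TYPE('u) S (restrict_scalars \<pi> X)"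
  shows "module_hom R M X = {zero_hom M X}"
proof -
  let ?X = "restrict_scalars \<pi> X"
  let ?A = "transport_module e left_kernel"
  let ?B = "transport_module e (regular_module S)"
  let ?incl = "\<lambda>x\<in>carrier ?A. x"
  have XR: "left_module R X" using X by (simp add: simple_module_def)
  interpret X: left_module R X by fact
  note XS = left_module_restrict_scalars[OF \<pi>_hom ring_S XR]
  have eB: "inj_on e (carrier (regular_module S))" using e by simp
  have eA: "inj_on e (carrier left_kernel)" by (rule inj_on_subset[OF e]) auto
  note simpA = transport_module_simps[OF eA] and simpB = transport_module_simps[OF eB]
  note mA = left_module_transport[OF eA left_module_left_kernel]
  note mB = left_module_transport[OF eB left_module_regular[OF ring_S]]
  have "linear_map S ?A ?B (\<lambda>x. x)"
    using simpA simpB unfolding linear_map_def by auto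
  from restrict_module_hom[OF this mA] have incl: "?incl \<in> module_hom S ?A ?B" .
  show ?thesis
    unfolding module_hom_eq_zero_iff[OF M.left_module_axioms XR]
  proof (intro allI impI ballI)
    fix f m assume f: "linear_map R M X f" and m: "m \<in> carrier M"
    note fD = linear_mapD[OF f]
    let ?g = "\<lambda>x. f (p (inv_into (carrier left_kernel) e x))"
    \<comment> \<open>On the kernel p(s i) = \<pi>(s) p(i), since the second term of
      \<open>p_mult\<close> carries the factor \<pi>(i) = 0.\<close>
    have "linear_map S left_kernel ?X (\<lambda>x. f (p x))"
      unfolding linear_map_def
      using MR.smult_zero_left by (auto simp: fD p_add p_mult M.smult_closed)
    from linear_map_comp[OF linear_map_transport_inv[OF eA left_module_left_kernel] this]
    have g: "restrict ?g (carrier ?A) \<in> module_hom S ?A ?X"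
      by (rule restrict_module_hom[OF _ mA])
    have "\<exists>h\<in>module_hom S ?B ?X. \<forall>a\<in>carrier ?A. h (?incl a) = restrict ?g (carrier ?A) a"
      by (rule inj[unfolded injective_module_def, THEN conjunct2, rule_format, OF incl g])
        (simp add: mA mB inj_on_def)
    then obtain h where h: "h \<in> module_hom S ?B ?X"
      "\<forall>a\<in>carrier ?A. h (?incl a) = restrict ?g (carrier ?A) a" by blast
    have hl: "linear_map S ?B ?X h" using h(1) by (simp add: module_hom_iff)
    have "f m = h (e (j m))"
      using h(2) m simpA(1) inv_into_f_f[OF eA, of "j m"] by simp
    \<comment> \<open>In \<open>S\<close> the element j(m) is a multiple of 1, so the extension
      \<open>h\<close> sends its copy to \<pi>(j(m)) times the value of \<open>h\<close> at the copy
      of 1, which is zero.\<close>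
    also have "e (j m) = j m \<odot>\<^bsub>?B\<^esub> e \<one>\<^bsub>S\<^esub>" using m simpB by simp
    also have "h \<dots> = \<zero>\<^bsub>X\<^esub>"
      using linear_mapD(3)[OF hl, of "j m" "e \<one>\<^bsub>S\<^esub>"] linear_mapD(1)[OF hl, of "e \<one>\<^bsub>S\<^esub>"] m simpB(1)
      by (simp add: X.smult_zero_left)
    finally show "f m = \<zero>\<^bsub>X\<^esub>" .
  qed
qed

theorem left_V_ring_iff:
  fixes e :: "'s \<Rightarrow> 'u"
  assumes "inj_on e (carrier S)"
  shows "left_V_ring TYPE('u) S \<longleftrightarrow> left_V_ring TYPE('u) R \<and>
    (\<forall>X :: ('a, 'u) module. simple_module R X \<longrightarrow> module_hom R M X = {zero_hom M X})"
proof
  assume "left_V_ring TYPE('u) S"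
  then have inj: "injective_module TYPE('u) S (restrict_scalars \<pi> X)"
    if "simple_module R X" for X :: "('a, 'u) module"
    using simple_inflate[OF that] by (simp add: left_V_ring_def)
  show "left_V_ring TYPE('u) R \<and>
      (\<forall>X :: ('a, 'u) module. simple_module R X \<longrightarrow> module_hom R M X = {zero_hom M X})"
    using inj injective_restrict[OF simple_module_left_module] hom_trivial_of_injective[OF assms] ring_R
    unfolding left_V_ring_def by blast
next
  assume "left_V_ring TYPE('u) R \<and>
      (\<forall>X :: ('a, 'u) module. simple_module R X \<longrightarrow> module_hom R M X = {zero_hom M X})"
  note R = this[unfolded left_V_ring_def]
  show "left_V_ring TYPE('u) S"
    unfolding left_V_ring_def
  proof (intro conjI allI impI ring_S)
    fix X :: "('s, 'u) module" assume X: "simple_module S X"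
    show "injective_module TYPE('u) S X"
      by (rule injective_extend[OF X]) (use R simple_restrict[OF X] in blast)+
  qed
qed

subsection \<open>Semisimple Artinian rings\<close>

text \<open>The elements s with I s = 0 form a left ideal because \<open>I\<close> is a right ideal.
  By \<open>simple_killed\<close> it contains every simple left ideal, so it contains 1, and i = i 1
  = 0.\<close>

lemma kernel_trivial_of_semisimple:
  assumes "semisimple_module S (regular_module S)" "i \<in> carrier S" "\<pi> i = \<zero>\<^bsub>R\<^esub>"
  shows "i = \<zero>\<^bsub>S\<^esub>"
proof -
  note mS = left_module_regular[OF ring_S]
  let ?N = "{s \<in> carrier S. \<forall>i\<in>carrier S. \<pi> i = \<zero>\<^bsub>R\<^esub> \<longrightarrow> i \<otimes>\<^bsub>S\<^esub> s = \<zero>\<^bsub>S\<^esub>}"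
  have "submodule ?N S (regular_module S)"
    unfolding submodule_iff[OF mS] by (auto simp: S.r_distr simp flip: S.m_assoc)
  then have "?N = carrier (regular_module S)"
  proof (rule semisimple_moduleD[OF assms(1)])     fix L assume L: "submodule L S (regular_module S)" "simple_module S ((regular_module S)\<lparr>carrier := L\<rparr>)"
    then show "L \<subseteq> ?N"
      using simple_killed[OF L(2)] unfolding submodule_iff[OF mS] by auto
  qed
  then have "\<one>\<^bsub>S\<^esub> \<in> ?N" by simp
  then show ?thesis using assms(2,3) by auto
qed

text \<open>Here the left ideal consists of the r with M r = 0. For a simple left ideal L,
  multiplication is a balanced map on M and L, so it factors through the zero group M \<otimes> L;
  hence M L = 0. Once 1 lies in the left ideal, M vanishes.\<close>

lemma bimodule_trivial_of_semisimple:
  fixes e :: "'s \<Rightarrow> 'u"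
  assumes e: "inj_on e (carrier S)" and ss: "semisimple_module R (regular_module R)"
    and triv: "\<And>X :: ('a, 'u) module. simple_module R X \<Longrightarrow>
      carrier (tensor R (right_part M) X) = {\<one>\<^bsub>tensor R (right_part M) X\<^esub>}"
    and m: "m \<in> carrier M"
  shows "m = \<zero>\<^bsub>M\<^esub>"
proof -
  note mR = left_module_regular[OF ring_R]
  note right_closed = MR.smult_closed[simplified]
  have rz: "right_smult M r \<zero>\<^bsub>M\<^esub> = \<zero>\<^bsub>M\<^esub>" if "r \<in> carrier R" for r
    using MR.smult_zero_right[of r] that by simp
  have zr: "right_smult M \<zero>\<^bsub>R\<^esub> m = \<zero>\<^bsub>M\<^esub>" if "m \<in> carrier M" for m
    using MR.smult_zero_left[of m] that by simp
  have rd: "right_smult M (r \<oplus>\<^bsub>R\<^esub> s) m = right_smult M r m \<oplus>\<^bsub>M\<^esub> right_smult M s m"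
    if "m \<in> carrier M" "r \<in> carrier R" "s \<in> carrier R" for m r s
    using MR.smult_l_distr[of r s m] that by simp
  have ra: "right_smult M (r \<otimes>\<^bsub>R\<^esub> s) m = right_smult M s (right_smult M r m)"
    if "m \<in> carrier M" "r \<in> carrier R" "s \<in> carrier R" for m r s
    using MR.smult_assoc[of s r m] that by simp
  have rm: "right_smult M r (m \<oplus>\<^bsub>M\<^esub> m') = right_smult M r m \<oplus>\<^bsub>M\<^esub> right_smult M r m'"
    if "m \<in> carrier M" "m' \<in> carrier M" "r \<in> carrier R" for m m' r
    using MR.smult_r_distr[of r m m'] that by simp
  let ?N = "{r \<in> carrier R. \<forall>m\<in>carrier M. right_smult M r m = \<zero>\<^bsub>M\<^esub>}"
  have "submodule ?N R (regular_module R)"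
    unfolding submodule_iff[OF mR] using right_closed by (auto simp: zr rd ra)
  moreover have "L \<subseteq> ?N"
    if L: "submodule L R (regular_module R)" "simple_module R ((regular_module R)\<lparr>carrier := L\<rparr>)" for L
  proof
    fix r assume r: "r \<in> L"
    let ?L = "(regular_module R)\<lparr>carrier := L\<rparr>"
    \<comment> \<open>\<open>L\<close> lies in \<open>R\<close> while \<open>e\<close> embeds
      \<open>S\<close>; composing with the section copies \<open>L\<close> into the element type
      over which the hypothesis on simple modules ranges.\<close>
    let ?e = "e \<circ> \<iota>"
    let ?X = "transport_module ?e ?L"
    have L': "L \<subseteq> carrier R" using L(1) by (simp add: submodule_iff[OF mR])
    have "inj_on ?e (carrier R)"
    proof (rule comp_inj_on)
      show "inj_on \<iota> (carrier R)" by (rule inj_on_inverseI[of _ \<pi>]) simp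
      show "inj_on e (\<iota> ` carrier R)" by (rule inj_on_subset[OF e]) auto
    qed
    then have inj: "inj_on ?e (carrier ?L)" using inj_on_subset L' by simp
    note simpX = transport_module_simps[OF inj]
    note mL = left_module_submodule[OF mR L(1)]
    note mX = left_module_transport[OF inj mL]
    have "simple_module R ?X"
      by (rule simple_module_iso[OF L(2) mX linear_map_transport[OF inj mL] inj]) (simp add: simpX)
    note trivX = triv[OF this]
    interpret TM: tensor_product R "right_part M" ?X
      by (rule tensor_product.intro[OF right_M mX])
    let ?i = "inv_into (carrier ?L) ?e"
    have inv: "?i (?e l) = l" if "l \<in> L" for l using inv_into_f_f[OF inj] that by simp
    have lin: "linear_map R ?X ?L ?i" by (rule linear_map_transport_inv[OF inj mL])
    have i_closed: "?i x \<in> carrier R" if "x \<in> carrier ?X" for x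
      using linear_mapD(1)[OF lin that] L' by auto
    have "balanced R (right_part M) ?X (add_monoid M) (\<lambda>m x. right_smult M (?i x) m)"
      unfolding balanced_def
      using linear_mapD(2,3)[OF lin] i_closed right_closed by (simp add: rd ra rm)
    from TM.tensor_lift[OF M.a_comm_group this]
    obtain k where k: "k \<in> hom (tensor R (right_part M) ?X) (add_monoid M)"
      "\<And>m x. \<lbrakk>m \<in> carrier M; x \<in> carrier ?X\<rbrakk> \<Longrightarrow>
        k (pure_tensor R (right_part M) ?X m x) = right_smult M (?i x) m" by auto
    have er: "?e r \<in> carrier ?X" unfolding simpX using r by simp
    have "right_smult M r m = \<zero>\<^bsub>M\<^esub>" if "m \<in> carrier M" for m
    proof -
      have "pure_tensor R (right_part M) ?X m (?e r) = \<one>\<^bsub>tensor R (right_part M) ?X\<^esub>"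
        using TM.pure_tensor_closed[of m "?e r"] trivX that er by auto
      then show ?thesis
        using k(2)[OF that er] inv[OF r] hom_one[OF k(1) TM.T.is_group M.a_group] by simp
    qed
    then show "r \<in> ?N" using r L' by auto
  qed
  ultimately have "?N = carrier (regular_module R)"
    by (rule semisimple_moduleD[OF ss])
  then have "\<one>\<^bsub>R\<^esub> \<in> ?N" by simp
  then show ?thesis using m MR.smult_one[of m] by simp
qed

text \<open>Either side forces the kernel to vanish. Then \<open>\<iota>\<close> and
  \<open>\<pi>\<close> are mutually inverse, and semisimplicity and the chain condition are carried
  across together.\<close>

theorem semisimple_artinian_ring_iff:
  fixes e :: "'s \<Rightarrow> 'u"
  assumes e: "inj_on e (carrier S)"
  shows "semisimple_artinian_ring S \<longleftrightarrow> semisimple_artinian_ring R \<and>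
    (\<forall>X :: ('a, 'u) module. simple_module R X \<longrightarrow>
      carrier (tensor R (right_part M) X) = {\<one>\<^bsub>tensor R (right_part M) X\<^esub>})"
proof -
  have bij: "bij_betw \<iota> (carrier R) (carrier S) \<and> bij_betw \<pi> (carrier S) (carrier R)"
    if "\<And>i. \<lbrakk>i \<in> carrier S; \<pi> i = \<zero>\<^bsub>R\<^esub>\<rbrakk> \<Longrightarrow> i = \<zero>\<^bsub>S\<^esub>"
  proof -
    have "\<iota> (\<pi> s) = s" if "s \<in> carrier S" for s
      using decompose[OF that] \<open>\<And>i. \<lbrakk>i \<in> carrier S; \<pi> i = \<zero>\<^bsub>R\<^esub>\<rbrakk> \<Longrightarrow> i = \<zero>\<^bsub>S\<^esub>\<close> that
      by (metis S.r_zero \<iota>_simps(1) \<pi>_simps(1))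
    then show ?thesis
      by (intro conjI bij_betw_byWitness[where f' = \<pi>] bij_betw_byWitness[where f' = \<iota>]) auto
  qed
  show ?thesis
  proof
    assume ss: "semisimple_artinian_ring S"
    then have I0: "i = \<zero>\<^bsub>S\<^esub>" if "i \<in> carrier S" "\<pi> i = \<zero>\<^bsub>R\<^esub>" for i
      using that kernel_trivial_of_semisimple by (simp add: semisimple_artinian_ring_def)
    have "p \<zero>\<^bsub>S\<^esub> = \<zero>\<^bsub>M\<^esub>"
      by (rule additive_zero[OF S.is_abelian_group M.abelian_group_axioms]) (auto simp: p_add)
    then have M0: "m = \<zero>\<^bsub>M\<^esub>" if "m \<in> carrier M" for m
      using I0[of "j m"] p_j[OF that] that by simp
    have "carrier (tensor R (right_part M) X) = {\<one>\<^bsub>tensor R (right_part M) X\<^esub>}"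
      if "simple_module R X" for X :: "('a, 'u) module"
    proof -
      interpret TM: tensor_product R "right_part M" X
        by (rule tensor_product.intro[OF right_M]) (use that in \<open>simp add: simple_module_def\<close>)
      show ?thesis
        unfolding TM.tensor_trivial_iff using M0 TM.pure_tensor_zero_left by (auto; metis)
    qed
    then show "semisimple_artinian_ring R \<and> (\<forall>X :: ('a, 'u) module. simple_module R X \<longrightarrow>
        carrier (tensor R (right_part M) X) = {\<one>\<^bsub>tensor R (right_part M) X\<^esub>})"
      using semisimple_artinian_ring_iso[OF \<iota>_hom _ ring_R ring_S ss] bij I0 by blast
  next
    assume ss: "semisimple_artinian_ring R \<and> (\<forall>X :: ('a, 'u) module. simple_module R X \<longrightarrow>
        carrier (tensor R (right_part M) X) = {\<one>\<^bsub>tensor R (right_part M) X\<^esub>})"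
    then have M0: "m = \<zero>\<^bsub>M\<^esub>" if "m \<in> carrier M" for m
      using bimodule_trivial_of_semisimple[OF e] that by (auto simp: semisimple_artinian_ring_def)
    have "j \<zero>\<^bsub>M\<^esub> = \<zero>\<^bsub>S\<^esub>"
      by (rule additive_zero[OF M.abelian_group_axioms S.is_abelian_group]) (auto simp: j_add)
    then have j0: "j m = \<zero>\<^bsub>S\<^esub>" if "m \<in> carrier M" for m using M0[OF that] by simp
    have "i = \<zero>\<^bsub>S\<^esub>" if "i \<in> carrier S" "\<pi> i = \<zero>\<^bsub>R\<^esub>" for i
      using that by (induction rule: ideal_induct) (auto simp: j0)
    then show "semisimple_artinian_ring S"
      using semisimple_artinian_ring_iso[OF \<pi>_hom _ ring_S ring_R] bij ss by blast
  qed
qed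

subsection \<open>Kasch rings\<close>

abbreviation "kernel_annihilator \<equiv> {s \<in> carrier S. \<forall>i\<in>I. i \<otimes>\<^bsub>S\<^esub> s = \<zero>\<^bsub>S\<^esub>}"

text \<open>Nothing is lost by regarding this left ideal over \<open>R\<close>: the kernel acts as
  zero on it and on every simple \<open>S\<close>-module, so \<open>R\<close>-linear maps between
  the two are \<open>S\<close>-linear.\<close>

abbreviation "annihilator_module \<equiv>
  restrict_scalars \<iota> ((regular_module S)\<lparr>carrier := kernel_annihilator\<rparr>)"

lemma left_module_annihilator: "left_module R annihilator_module"
proof (rule left_module_restrict_scalars[OF \<iota>_hom ring_R left_module_submodule])
  show "left_module S (regular_module S)" by (rule left_module_regular[OF ring_S])
  then show "submodule kernel_annihilator S (regular_module S)"
    by (auto simp: submodule_iff S.r_distr simp flip: S.m_assoc)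
qed

text \<open>The target \<open>K\<close> is known only through its correspondence
  \<open>\<Phi>\<close> with the annihilator, so that it can be the module of the criterion as it is
  written there. An embedding f of an inflated simple module satisfies i f(x) = f(\<pi>(i) x) = 0
  for i in the kernel, hence has values in the annihilator.\<close>

theorem left_Kasch_ring_iff:
  assumes \<Phi>: "linear_map R annihilator_module K \<Phi>" "inj_on \<Phi> kernel_annihilator"
      "\<Phi> ` kernel_annihilator = carrier K" and zero: "\<Phi> \<zero>\<^bsub>S\<^esub> = \<zero>\<^bsub>K\<^esub>"
  shows "left_Kasch_ring TYPE('u) S \<longleftrightarrow>
    (\<forall>X :: ('a, 'u) module. simple_module R X \<longrightarrow> module_hom R X K \<noteq> {zero_hom X K})"
proof -
  let ?N = annihilator_module
  have K: "left_module R K"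
    by (rule left_module_surj[OF left_module_annihilator \<Phi>(1)]) (use \<Phi>(3) zero in simp_all)
  have nonzero: "module_hom R X K \<noteq> {zero_hom X K} \<longleftrightarrow>
      (\<exists>f. linear_map R X K f \<and> (\<exists>x\<in>carrier X. f x \<noteq> \<zero>\<^bsub>K\<^esub>))"
    if "simple_module R X" for X :: "('a, 'u) module"
    using module_hom_eq_zero_iff[OF simple_module_left_module[OF that] K] by blast
  show ?thesis
  proof
    assume Kasch: "left_Kasch_ring TYPE('u) S"
    show "\<forall>X :: ('a, 'u) module. simple_module R X \<longrightarrow> module_hom R X K \<noteq> {zero_hom X K}"
    proof (intro allI impI)
      fix X :: "('a, 'u) module" assume X: "simple_module R X"
      interpret X: left_module R X by (rule simple_module_left_module[OF X])
      note XS = left_module_restrict_scalars[OF \<pi>_hom ring_S X.left_module_axioms]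
      obtain f where f: "f \<in> module_hom S (restrict_scalars \<pi> X) (regular_module S)" "inj_on f (carrier X)"
        using Kasch simple_inflate[OF X] unfolding left_Kasch_ring_def by fastforce
      have fl: "linear_map S (restrict_scalars \<pi> X) (regular_module S) f"
        using f(1) by (simp add: module_hom_iff)
      note fD = linear_mapD[OF fl, simplified]
      have f0: "f \<zero>\<^bsub>X\<^esub> = \<zero>\<^bsub>S\<^esub>"
        using linear_map_zero[OF fl XS left_module_regular[OF ring_S]] by simp
      have ann: "i \<otimes>\<^bsub>S\<^esub> f x = \<zero>\<^bsub>S\<^esub>" if "i \<in> I" "x \<in> carrier X" for i x
        using fD(3)[of i x] that f0 by (simp add: X.smult_zero_left)
      have "f (r \<odot>\<^bsub>X\<^esub> x) = \<iota> r \<otimes>\<^bsub>S\<^esub> f x" if "r \<in> carrier R" "x \<in> carrier X" for r x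
        using fD(3)[of "\<iota> r" x] that by simp
      then have "linear_map R X ?N f"
        using fD ann by (simp add: linear_map_def)
      from linear_map_comp[OF this \<Phi>(1)] have g: "linear_map R X K (\<lambda>x. \<Phi> (f x))" .
      obtain x where x: "x \<in> carrier X" "x \<noteq> \<zero>\<^bsub>X\<^esub>"
        using X X.M.zero_closed unfolding simple_module_def by blast
      then have "f x \<noteq> \<zero>\<^bsub>S\<^esub>" using f(2) f0 X.M.zero_closed by (metis inj_onD)
      moreover have "f x \<in> kernel_annihilator" "\<zero>\<^bsub>S\<^esub> \<in> kernel_annihilator" using x fD(1) ann by auto
      ultimately have "\<Phi> (f x) \<noteq> \<zero>\<^bsub>K\<^esub>" using inj_on_eq_iff[OF \<Phi>(2)] unfolding zero[symmetric] by blast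
      then show "module_hom R X K \<noteq> {zero_hom X K}"
        unfolding nonzero[OF X] using g x by blast
    qed
  next
    assume hom: "\<forall>X :: ('a, 'u) module. simple_module R X \<longrightarrow> module_hom R X K \<noteq> {zero_hom X K}"
    show "left_Kasch_ring TYPE('u) S"
      unfolding left_Kasch_ring_def
    proof (intro conjI allI impI ring_S)
      fix X :: "('s, 'u) module" assume X: "simple_module S X"
      interpret X: left_module S X by (rule simple_module_left_module[OF X])
      note XR = simple_restrict[OF X]
      obtain g x where g: "linear_map R (restrict_scalars \<iota> X) K g" and x: "x \<in> carrier X" "g x \<noteq> \<zero>\<^bsub>K\<^esub>"
        using hom XR nonzero[OF XR] by auto
      let ?\<Psi> = "inv_into kernel_annihilator \<Phi>"
      have "linear_map R K ?N ?\<Psi>"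
        using linear_map_inv_into[OF \<Phi>(1) left_module_annihilator] \<Phi>(2,3) by simp
      from linear_map_comp[OF g this]
      have f: "linear_map R (restrict_scalars \<iota> X) ?N (\<lambda>x. ?\<Psi> (g x))" .
      note fD = linear_mapD[OF f, simplified]
      \<comment> \<open>Both sides depend on s through \<open>\<pi> s\<close>: the kernel kills the
        values of \<open>?\<Psi>\<close> by the choice of the annihilator, and it kills
        \<open>X\<close> by simplicity.\<close>
      have "?\<Psi> (g (s \<odot>\<^bsub>X\<^esub> x)) = s \<otimes>\<^bsub>S\<^esub> ?\<Psi> (g x)" if sx: "s \<in> carrier S" "x \<in> carrier X" for s x
      proof -
        obtain i where i: "i \<in> carrier S" "\<pi> i = \<zero>\<^bsub>R\<^esub>" "s = \<iota> (\<pi> s) \<oplus>\<^bsub>S\<^esub> i"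
          using decompose sx(1) by blast
        have "s \<otimes>\<^bsub>S\<^esub> ?\<Psi> (g x) = \<iota> (\<pi> s) \<otimes>\<^bsub>S\<^esub> ?\<Psi> (g x) \<oplus>\<^bsub>S\<^esub> i \<otimes>\<^bsub>S\<^esub> ?\<Psi> (g x)"
          using i sx fD(1)[of x] S.l_distr[of "\<iota> (\<pi> s)" i "?\<Psi> (g x)"] by simp
        also have "\<dots> = \<iota> (\<pi> s) \<otimes>\<^bsub>S\<^esub> ?\<Psi> (g x)" using i sx fD(1)[of x] by simp
        also have "\<dots> = ?\<Psi> (g (s \<odot>\<^bsub>X\<^esub> x))"
          using fD(3)[of "\<pi> s" x] sx simple_smult[OF X sx] by simp
        finally show ?thesis by simp
      qed
      then have fS: "linear_map S X (regular_module S) (\<lambda>x. ?\<Psi> (g x))"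
        using fD by (simp add: linear_map_def)
      have "?\<Psi> (g x) \<noteq> \<zero>\<^bsub>S\<^esub>"
        using x linear_mapD(1)[OF g, of x] \<Phi>(3) zero f_inv_into_f[of "g x" \<Phi> kernel_annihilator] by auto
      then have "inj_on (\<lambda>x. ?\<Psi> (g x)) (carrier X)"
        using linear_map_simple_inj[OF X left_module_regular[OF ring_S] fS x(1)] by simp
      then show "\<exists>f\<in>module_hom S X (regular_module S). inj_on f (carrier X)"
        using restrict_module_hom[OF fS X.left_module_axioms]
        by (intro bexI[of _ "restrict (\<lambda>x. ?\<Psi> (g x)) (carrier X)"]) (simp_all add: inj_on_def)
    qed
  qed
qed

end

section \<open>Tensor powers\<close>

context tensor_product
begin

text \<open>Pure tensors absorb signs, so each coset contains the formal sum of a list; this makes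
  the choice in \<open>name_tensor\<close> meaningful.\<close>

lemma positive_representative:
  assumes "C \<in> carrier (tensor R A B)"
  shows "\<exists>ps. (\<Sum>q\<leftarrow>ps. frag_of q) \<in> C"
  using assms
proof (induction rule: tensor_induct)
  case one
  have "(0 :: 'b \<times> 'c \<Rightarrow>\<^sub>0 int) \<in> tensor_class R A B 0" by (rule tensor_class_self) simp
  then show ?case by (intro exI[of _ "[]"]) (simp add: tensor_class_zero)
next
  case (pure a b)
  then show ?case
    by (intro exI[of _ "[(a, b)]"]) (simp add: pure_tensor_def tensor_class_self)
next
  case (mult C D)
  then obtain ps qs where "(\<Sum>q\<leftarrow>ps. frag_of q) \<in> C" "(\<Sum>q\<leftarrow>qs. frag_of q) \<in> D" by blast
  then have "(\<Sum>q\<leftarrow>ps @ qs. frag_of q) \<in> C \<otimes>\<^bsub>tensor R A B\<^esub> D"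
    by (auto simp: tensor_def set_mult_def)
  then show ?case by blast
qed

end

text \<open>If the chosen lists agree, the sum over this one list lies in both cosets, and cosets
  that meet are equal.\<close>

lemma inj_on_name_tensor:
  assumes "tensor_product R A B"
  shows "inj_on name_tensor (carrier (tensor R A B))"
proof
  interpret tensor_product R A B by fact
  fix C D assume CD: "C \<in> carrier (tensor R A B)" "D \<in> carrier (tensor R A B)"
    and "name_tensor C = name_tensor D"
  then have eq: "(SOME ps. (\<Sum>q\<leftarrow>ps. frag_of q) \<in> C) = (SOME ps. (\<Sum>q\<leftarrow>ps. frag_of q) \<in> D)"
    by (simp add: name_tensor_def)
  obtain x where "x \<in> C" "x \<in> D"
    using someI_ex[OF positive_representative[OF CD(1)]] someI_ex[OF positive_representative[OF CD(2)]]
    unfolding eq by blast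
  moreover obtain c d where "c \<in> carrier F" "C = tensor_class R A B c"
    "d \<in> carrier F" "D = tensor_class R A B d"
    using CD tensor_class_cases by metis
  ultimately show "C = D" using tensor_class_eqI(2) by metis
qed

section \<open>The left module structure on M \<otimes> B\<close>

lemma tensor_module_simps [simp]:
  "carrier (tensor_module R M B) = carrier (tensor R (right_part M) B)"
  "add (tensor_module R M B) = monoid.mult (tensor R (right_part M) B)"
  "\<zero>\<^bsub>tensor_module R M B\<^esub> = \<one>\<^bsub>tensor R (right_part M) B\<^esub>"
  "r \<odot>\<^bsub>tensor_module R M B\<^esub> C = tensor_map R (right_part M) B (\<lambda>m. r \<odot>\<^bsub>M\<^esub> m) (\<lambda>b. b) C"
  by (simp_all add: tensor_module_def Let_def)

locale bimod =
  fixes R :: "('a, 'r) ring_scheme" and M :: "('a, 'm, 'z) bimodule_scheme"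
  assumes bimodule: "bimodule R M"
begin

sublocale M: left_module R M using bimodule by (simp add: bimodule_def)
sublocale MR: left_module "opposite_ring R" "right_part M"
  using bimodule by (simp add: bimodule_def right_module_def)

lemma right_closed [simp]: "\<lbrakk>r \<in> carrier R; m \<in> carrier M\<rbrakk> \<Longrightarrow> right_smult M r m \<in> carrier M"
  using MR.smult_closed by simp

lemma right_M: "right_module R (right_part M)"
  using bimodule by (simp add: bimodule_def)

lemma tensor_product_M: "left_module R B \<Longrightarrow> tensor_product R (right_part M) B"
  by (rule tensor_product.intro[OF right_M])

lemma linear_map_smult_right_part:
  "r \<in> carrier R \<Longrightarrow> linear_map (opposite_ring R) (right_part M) (right_part M) (\<lambda>m. r \<odot>\<^bsub>M\<^esub> m)"
  using bimodule by (auto simp: linear_map_def M.smult_closed M.smult_r_distr bimodule_def)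

lemma tensor_module_smult:
  assumes "left_module R B" "r \<in> carrier R"
  shows "(\<lambda>C. r \<odot>\<^bsub>tensor_module R M B\<^esub> C) \<in> hom (tensor R (right_part M) B) (tensor R (right_part M) B)"
    and "\<lbrakk>m \<in> carrier M; b \<in> carrier B\<rbrakk> \<Longrightarrow>
      r \<odot>\<^bsub>tensor_module R M B\<^esub> pure_tensor R (right_part M) B m b = pure_tensor R (right_part M) B (r \<odot>\<^bsub>M\<^esub> m) b"
  unfolding tensor_module_simps
  by (rule tensor_map_hom[OF tensor_product_M[OF assms(1)] tensor_product_M[OF assms(1)]
        linear_map_smult_right_part[OF assms(2)] linear_map_id])
    (rule tensor_map_hom(2)[OF tensor_product_M[OF assms(1)] tensor_product_M[OF assms(1)]
        linear_map_smult_right_part[OF assms(2)] linear_map_id], simp_all)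

lemma left_module_tensor_module:
  assumes B: "left_module R B"
  shows "left_module R (tensor_module R M B)"
proof -
  interpret T: tensor_product R "right_part M" B by (rule tensor_product_M[OF B])
  let ?T = "tensor R (right_part M) B" and ?TM = "tensor_module R M B"
  note sm = tensor_module_smult[OF B]
  have sc: "r \<odot>\<^bsub>?TM\<^esub> C \<in> carrier ?T" if "r \<in> carrier R" "C \<in> carrier ?T" for r C
    using sm(1)[OF that(1)] that(2) by (rule hom_in_carrier)
  have smult: "r \<odot>\<^bsub>?TM\<^esub> (C \<otimes>\<^bsub>?T\<^esub> D) = (r \<odot>\<^bsub>?TM\<^esub> C) \<otimes>\<^bsub>?T\<^esub> (r \<odot>\<^bsub>?TM\<^esub> D)"
    if "r \<in> carrier R" "C \<in> carrier ?T" "D \<in> carrier ?T" for r C D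
    using hom_mult[OF sm(1)[OF that(1)] that(2,3)] .
  have sone: "r \<odot>\<^bsub>?TM\<^esub> \<one>\<^bsub>?T\<^esub> = \<one>\<^bsub>?T\<^esub>" if "r \<in> carrier R" for r
    using hom_one[OF sm(1)[OF that] T.T.is_group T.T.is_group] .
  have "abelian_group ?TM"
    by (rule abelian_group_of_comm_group[OF T.comm_group_tensor]) simp_all
  then show ?thesis
  proof (rule left_moduleI[OF M.R.ring_axioms], unfold tensor_module_simps(1-3))
    fix r s C assume r: "r \<in> carrier R" and s: "s \<in> carrier R" and C: "C \<in> carrier ?T"
    show "(r \<oplus>\<^bsub>R\<^esub> s) \<odot>\<^bsub>?TM\<^esub> C = (r \<odot>\<^bsub>?TM\<^esub> C) \<otimes>\<^bsub>?T\<^esub> (s \<odot>\<^bsub>?TM\<^esub> C)"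
      using C
    proof (induction rule: T.tensor_induct)
      case (pure a b)
      then show ?case
        using r s T.pure_tensor_add_left[of "r \<odot>\<^bsub>M\<^esub> a" "s \<odot>\<^bsub>M\<^esub> a" b]
        by (simp add: sm(2) M.smult_l_distr M.smult_closed del: tensor_module_simps)
    next
      case (mult C D)
      then show ?case
        using r s sc by (simp add: smult T.T.m_ac del: tensor_module_simps)
    qed (use r s sone in \<open>simp del: tensor_module_simps\<close>)
    show "(r \<otimes>\<^bsub>R\<^esub> s) \<odot>\<^bsub>?TM\<^esub> C = r \<odot>\<^bsub>?TM\<^esub> (s \<odot>\<^bsub>?TM\<^esub> C)"
      using C
    proof (induction rule: T.tensor_induct)
      case (pure a b)
      then show ?case
        using r s by (simp add: sm(2) M.smult_assoc M.smult_closed del: tensor_module_simps)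
    next
      case (mult C D)
      then show ?case
        using r s sc by (simp add: smult del: tensor_module_simps)
    qed (use r s sone in \<open>simp del: tensor_module_simps\<close>)
  next
    fix C assume C: "C \<in> carrier ?T"
    show "\<one>\<^bsub>R\<^esub> \<odot>\<^bsub>?TM\<^esub> C = C"
      using C
    proof (induction rule: T.tensor_induct)
      case (mult C D)
      then show ?case by (simp add: smult del: tensor_module_simps)
    qed (use sone sm(2) M.smult_one in \<open>simp_all del: tensor_module_simps\<close>)
  qed (use sc smult in blast)+
qed

text \<open>Functoriality in the second factor. The product in degree i + 2 arises by tensoring a
  product map of degree i + 1 with the identity of M.\<close>

lemma linear_map_tensor_module:
  assumes B: "left_module R B" and B': "left_module R B'" and g: "linear_map R B B' g"
  shows "linear_map R (tensor_module R M B) (tensor_module R M B')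
      (tensor_map R (right_part M) B' (\<lambda>m. m) g)"
    and "\<lbrakk>m \<in> carrier M; b \<in> carrier B\<rbrakk> \<Longrightarrow>
      tensor_map R (right_part M) B' (\<lambda>m. m) g (pure_tensor R (right_part M) B m b) =
      pure_tensor R (right_part M) B' m (g b)"
proof -
  let ?g = "tensor_map R (right_part M) B' (\<lambda>m. m) g"
  interpret T: tensor_product R "right_part M" B by (rule tensor_product_M[OF B])
  interpret T': tensor_product R "right_part M" B' by (rule tensor_product_M[OF B'])
  interpret TM: left_module R "tensor_module R M B" by (rule left_module_tensor_module[OF B])
  interpret TM': left_module R "tensor_module R M B'" by (rule left_module_tensor_module[OF B'])
  note tm = tensor_map_hom[OF T.tensor_product_axioms T'.tensor_product_axioms linear_map_id g]
  show g_pure: "?g (pure_tensor R (right_part M) B m b) = pure_tensor R (right_part M) B' m (g b)"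
    if "m \<in> carrier M" "b \<in> carrier B" for m b
    using tm(2)[of m b] that by simp
  have "?g (r \<odot>\<^bsub>tensor_module R M B\<^esub> C) = r \<odot>\<^bsub>tensor_module R M B'\<^esub> ?g C"
    if r: "r \<in> carrier R" and C: "C \<in> carrier (tensor R (right_part M) B)" for r C
    using C
  proof (induction rule: T.tensor_induct)
    case one
    show ?case
      using hom_one[OF tm(1) T.T.is_group T'.T.is_group] TM.smult_zero_right[OF r] TM'.smult_zero_right[OF r]
      by simp
  next
    case (pure a b)
    then show ?case
      using r linear_mapD(1)[OF g]
      by (simp add: g_pure M.smult_closed tensor_module_smult(2)[OF B] tensor_module_smult(2)[OF B']
          del: tensor_module_simps)
  next
    case (mult C D)
    then show ?case
      using TM.smult_r_distr[OF r, of C D] TM'.smult_r_distr[OF r, of "?g C" "?g D"]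
        TM.smult_closed[OF r] hom_mult[OF tm(1)] hom_in_carrier[OF tm(1)]
      by (simp del: tensor_module_simps(4))
  qed
  then show "linear_map R (tensor_module R M B) (tensor_module R M B') ?g"
    using hom_mult[OF tm(1)] hom_in_carrier[OF tm(1)]
    by (simp add: linear_map_def del: tensor_module_simps(4))
qed

section \<open>Tensor powers and their products\<close>

abbreviation "P \<equiv> tensor_power R M"
abbreviation "\<mu> \<equiv> tpow_mult R M"

text \<open>The two claims climb together: the next power is transported along
  \<open>name_tensor\<close>, which requires injectivity on M \<otimes> P(i+1), and this injectivity
  in turn requires P(i+1) to be a module.\<close>

lemma left_module_P_inj:
  "left_module R (P (Suc i)) \<and>
   inj_on name_tensor (carrier (tensor_module R M (P (Suc i))))"
proof (induction i)
  case 0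
  have "left_module R (P (Suc 0))"
    by (simp add: left_module_transport inj_on_def M.left_module_axioms)
  then show ?case by (simp add: inj_on_name_tensor tensor_product_M)
next
  case (Suc i)
  then have "left_module R (P (Suc (Suc i)))"
    by (simp add: left_module_transport left_module_tensor_module del: tensor_module_simps)
  then show ?case by (simp add: inj_on_name_tensor tensor_product_M)
qed

lemma inj_Scal: "inj_on (Scal :: 'a \<Rightarrow> ('a, 'm) tpow_elem) (carrier (regular_module R))"
  and inj_Vec: "inj_on (Vec :: 'm \<Rightarrow> ('a, 'm) tpow_elem) (carrier M)"
  by (simp_all add: inj_on_def)

lemma left_module_P: "left_module R (P i)"
proof (cases i)
  case 0
  then show ?thesis
    using left_module_transport[OF inj_Scal left_module_regular[OF M.R.ring_axioms]] by simp
next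
  case (Suc k)
  then show ?thesis using left_module_P_inj by blast
qed

lemma inj_name: "inj_on name_tensor (carrier (tensor_module R M (P (Suc i))))"
  using left_module_P_inj by blast

sublocale P: left_module R "P i" for i by (rule left_module_P)

lemmas P_0 = transport_module_simps[OF inj_Scal, folded tensor_power.simps(1)[of R M], unfolded regular_module_simps]
lemmas P_1 = transport_module_simps[OF inj_Vec, folded tensor_power.simps(2)[of R M]]
lemmas P_2 = transport_module_simps[OF inj_name[of i], folded tensor_power.simps(3)] for i

text \<open>Left multiplication by an element of degree one. It joins two clauses of the product:
  the right action on M for k = 0 and a named pure tensor for k > 0.\<close>

abbreviation "t k m x \<equiv> \<mu> (Suc 0) k (Vec m) x"

text \<open>One case split on \<open>k\<close> serves all five laws. For k = 0 they are bimodule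
  laws of M, for k > 0 laws of pure tensors.\<close>

lemma t_closed [simp]: "\<lbrakk>m \<in> carrier M; x \<in> carrier (P k)\<rbrakk> \<Longrightarrow> t k m x \<in> carrier (P (Suc k))"
  and t_add_left: "\<lbrakk>m \<in> carrier M; m' \<in> carrier M; x \<in> carrier (P k)\<rbrakk> \<Longrightarrow>
    t k (m \<oplus>\<^bsub>M\<^esub> m') x = t k m x \<oplus>\<^bsub>P (Suc k)\<^esub> t k m' x"
  and t_add_right: "\<lbrakk>m \<in> carrier M; x \<in> carrier (P k); x' \<in> carrier (P k)\<rbrakk> \<Longrightarrow>
    t k m (x \<oplus>\<^bsub>P k\<^esub> x') = t k m x \<oplus>\<^bsub>P (Suc k)\<^esub> t k m x'"
  and t_smult: "\<lbrakk>r \<in> carrier R; m \<in> carrier M; x \<in> carrier (P k)\<rbrakk> \<Longrightarrow>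
    t k (r \<odot>\<^bsub>M\<^esub> m) x = r \<odot>\<^bsub>P (Suc k)\<^esub> t k m x"
  and t_balanced: "\<lbrakk>r \<in> carrier R; m \<in> carrier M; x \<in> carrier (P k)\<rbrakk> \<Longrightarrow>
    t k (right_smult M r m) x = t k m (r \<odot>\<^bsub>P k\<^esub> x)"
proof -
  have "(m \<in> carrier M \<longrightarrow> x \<in> carrier (P k) \<longrightarrow> t k m x \<in> carrier (P (Suc k))) \<and>
    (m \<in> carrier M \<longrightarrow> m' \<in> carrier M \<longrightarrow> x \<in> carrier (P k) \<longrightarrow>
      t k (m \<oplus>\<^bsub>M\<^esub> m') x = t k m x \<oplus>\<^bsub>P (Suc k)\<^esub> t k m' x) \<and>
    (m \<in> carrier M \<longrightarrow> x \<in> carrier (P k) \<longrightarrow> x' \<in> carrier (P k) \<longrightarrow>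
      t k m (x \<oplus>\<^bsub>P k\<^esub> x') = t k m x \<oplus>\<^bsub>P (Suc k)\<^esub> t k m x') \<and>
    (r \<in> carrier R \<longrightarrow> m \<in> carrier M \<longrightarrow> x \<in> carrier (P k) \<longrightarrow>
      t k (r \<odot>\<^bsub>M\<^esub> m) x = r \<odot>\<^bsub>P (Suc k)\<^esub> t k m x) \<and>
    (r \<in> carrier R \<longrightarrow> m \<in> carrier M \<longrightarrow> x \<in> carrier (P k) \<longrightarrow>
      t k (right_smult M r m) x = t k m (r \<odot>\<^bsub>P k\<^esub> x))" for m m' x x' r
  proof (cases k)
    case 0
    have *: "right_smult M (s \<oplus>\<^bsub>R\<^esub> s') m = right_smult M s m \<oplus>\<^bsub>M\<^esub> right_smult M s' m"
      "right_smult M (r \<otimes>\<^bsub>R\<^esub> s) m = right_smult M s (right_smult M r m)"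
      "right_smult M s (m \<oplus>\<^bsub>M\<^esub> m') = right_smult M s m \<oplus>\<^bsub>M\<^esub> right_smult M s m'"
      if "r \<in> carrier R" "s \<in> carrier R" "s' \<in> carrier R" "m \<in> carrier M" "m' \<in> carrier M" for r s s' m m'
      using that MR.smult_l_distr[of s s' m] MR.smult_assoc[of s r m] MR.smult_r_distr[of s m m'] by simp_all
    have **: "right_smult M s (r \<odot>\<^bsub>M\<^esub> m) = r \<odot>\<^bsub>M\<^esub> right_smult M s m"
      if "r \<in> carrier R" "s \<in> carrier R" "m \<in> carrier M" for r s m
      using that bimodule by (simp add: bimodule_def)
    show ?thesis
      unfolding 0
      by (auto simp del: tensor_power.simps simp: P_0 P_1 * ** M.smult_closed)
  next
    case (Suc k')
    interpret T: tensor_product R "right_part M" "P k" by (rule tensor_product_M[OF left_module_P])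
    have t: "t k m x = name_tensor (pure_tensor R (right_part M) (P k) m x)" for m x
      using Suc by simp
    note P2 = P_2[where i = k', folded Suc, simplified tensor_module_simps(1-3)]
    show ?thesis
      unfolding t
      using T.pure_tensor_add_left[of m m' x] T.pure_tensor_add_right[of m x x'] T.pure_tensor_smult[of m r x]
      by (auto simp: P2 tensor_module_smult(2)[OF left_module_P] M.smult_closed P.smult_closed
          simp del: tensor_module_simps(4) tensor_power.simps)
  qed
  then show
    "\<lbrakk>m \<in> carrier M; x \<in> carrier (P k)\<rbrakk> \<Longrightarrow> t k m x \<in> carrier (P (Suc k))"
    "\<lbrakk>m \<in> carrier M; m' \<in> carrier M; x \<in> carrier (P k)\<rbrakk> \<Longrightarrow>
      t k (m \<oplus>\<^bsub>M\<^esub> m') x = t k m x \<oplus>\<^bsub>P (Suc k)\<^esub> t k m' x"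
    "\<lbrakk>m \<in> carrier M; x \<in> carrier (P k); x' \<in> carrier (P k)\<rbrakk> \<Longrightarrow>
      t k m (x \<oplus>\<^bsub>P k\<^esub> x') = t k m x \<oplus>\<^bsub>P (Suc k)\<^esub> t k m x'"
    "\<lbrakk>r \<in> carrier R; m \<in> carrier M; x \<in> carrier (P k)\<rbrakk> \<Longrightarrow>
      t k (r \<odot>\<^bsub>M\<^esub> m) x = r \<odot>\<^bsub>P (Suc k)\<^esub> t k m x"
    "\<lbrakk>r \<in> carrier R; m \<in> carrier M; x \<in> carrier (P k)\<rbrakk> \<Longrightarrow>
      t k (right_smult M r m) x = t k m (r \<odot>\<^bsub>P k\<^esub> x)"
    by blast+
qed

text \<open>Each power is generated additively by the products m \<otimes> x with x in the preceding
  power. Later inductions use this rule and never see the chosen names.\<close>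

lemma P_induct [consumes 1, case_names zero t add]:
  assumes "y \<in> carrier (P (Suc k))"
    and zero: "Q \<zero>\<^bsub>P (Suc k)\<^esub>"
    and t: "\<And>m x. \<lbrakk>m \<in> carrier M; x \<in> carrier (P k)\<rbrakk> \<Longrightarrow> Q (t k m x)"
    and add: "\<And>x y. \<lbrakk>x \<in> carrier (P (Suc k)); y \<in> carrier (P (Suc k)); Q x; Q y\<rbrakk> \<Longrightarrow>
      Q (x \<oplus>\<^bsub>P (Suc k)\<^esub> y)"
  shows "Q y"
proof (cases k)
  case 0
  then obtain m where m: "m \<in> carrier M" "y = Vec m" using assms(1) by (auto simp: P_1 simp del: tensor_power.simps)
  \<comment> \<open>In degree one an element m is itself such a product, namely m \<otimes>
    1.\<close>
  have "y = t 0 m (Scal \<one>\<^bsub>R\<^esub>)" using m MR.smult_one[of m] by simp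
  then show ?thesis using t[of m "Scal \<one>\<^bsub>R\<^esub>"] m 0 by (simp add: P_0 del: tensor_power.simps tpow_mult.simps)
next
  case (Suc k')
  interpret T: tensor_product R "right_part M" "P k" by (rule tensor_product_M[OF left_module_P])
  note P2 = P_2[where i = k', folded Suc, simplified tensor_module_simps(1-3)]
  obtain C where C: "C \<in> carrier (tensor R (right_part M) (P k))" "y = name_tensor C"
    using assms(1) P2(1) by auto
  have "Q (name_tensor C)"
    using C(1)
  proof (induction rule: T.tensor_induct)
    case one
    then show ?case using zero P2(2) by simp
  next
    case (pure a b)
    then show ?case using t[of a b] Suc by simp
  next
    case (mult C D)
    then show ?case using add[of "name_tensor C" "name_tensor D"] P2(1,3) by simp
  qed
  then show ?thesis using C by simp
qed

text \<open>The clause for degree i + 2 applies \<open>tensor_map\<close> to the product map of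
  degree i + 1, and \<open>tensor_map\<close> is controlled only for linear maps. Linearity
  therefore travels through the induction with the rule (m \<otimes> x) \<otimes> y = m \<otimes> (x
  \<otimes> y).\<close>

lemma mult_t_and_linear:
  "(\<forall>j y. y \<in> carrier (P j) \<longrightarrow>
     linear_map R (P (Suc i)) (P (Suc i + j)) (\<lambda>x. \<mu> (Suc i) j x y) \<and>
     (\<forall>m x. m \<in> carrier M \<longrightarrow> x \<in> carrier (P i) \<longrightarrow> \<mu> (Suc i) j (t i m x) y = t (i + j) m (\<mu> i j x y)))"
proof (induction i)
  case 0
  show ?case
  proof (intro allI impI conjI)
    fix j y assume y: "y \<in> carrier (P j)"
    show "linear_map R (P (Suc 0)) (P (Suc 0 + j)) (\<lambda>x. \<mu> (Suc 0) j x y)"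
      unfolding linear_map_def
      using y by (auto simp: P_1 t_add_left t_smult simp del: tensor_power.simps tpow_mult.simps
          simp flip: t_add_left t_smult)
    fix m x assume "m \<in> carrier M" "x \<in> carrier (P 0)"
    \<comment> \<open>With x a scalar r this is (m r) \<otimes> y = m \<otimes> (r y), so the base
      case is balancedness.\<close>
    then show "\<mu> (Suc 0) j (t 0 m x) y = t (0 + j) m (\<mu> 0 j x y)"
      using y t_balanced[of _ m y j] by (auto simp: P_0 simp del: tensor_power.simps(1) tpow_mult.simps(3))
  qed
next
  case (Suc i)
  show ?case
  proof (intro allI impI conjI)
    fix j y assume y: "y \<in> carrier (P j)"
    let ?g = "\<lambda>z. \<mu> (Suc i) j z y"
    have g: "linear_map R (P (Suc i)) (P (Suc (i + j))) ?g" using Suc y by simp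
    note lt = linear_map_tensor_module[OF left_module_P left_module_P g]
    note iv = linear_map_transport_inv[OF inj_name left_module_tensor_module[OF left_module_P], of i,
        folded tensor_power.simps(3)]
    note nm = linear_map_transport[OF inj_name left_module_tensor_module[OF left_module_P], of "i + j",
        folded tensor_power.simps(3)]
    have eq: "\<mu> (Suc (Suc i)) j x y = name_tensor (tensor_map R (right_part M) (P (Suc (i + j))) (\<lambda>m. m) ?g
        (inv_into (carrier (tensor_module R M (P (Suc i)))) name_tensor x))" for x
      by simp
    show "linear_map R (P (Suc (Suc i))) (P (Suc (Suc i) + j)) (\<lambda>x. \<mu> (Suc (Suc i)) j x y)"
      unfolding eq using linear_map_comp[OF linear_map_comp[OF iv lt(1)] nm] by simp
    fix m x assume mx: "m \<in> carrier M" "x \<in> carrier (P (Suc i))"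
    interpret T: tensor_product R "right_part M" "P (Suc i)" by (rule tensor_product_M[OF left_module_P])
    have "inv_into (carrier (tensor_module R M (P (Suc i)))) name_tensor (t (Suc i) m x) =
        pure_tensor R (right_part M) (P (Suc i)) m x"
      using inv_into_f_f[OF inj_name, of "pure_tensor R (right_part M) (P (Suc i)) m x" i] mx by simp
    then show "\<mu> (Suc (Suc i)) j (t (Suc i) m x) y = t (Suc i + j) m (\<mu> (Suc i) j x y)"
      unfolding eq using lt(2)[OF mx] by simp
  qed
qed

lemma mult_t:
  "\<lbrakk>m \<in> carrier M; x \<in> carrier (P i); y \<in> carrier (P j)\<rbrakk> \<Longrightarrow>
    \<mu> (Suc i) j (t i m x) y = t (i + j) m (\<mu> i j x y)"
  using mult_t_and_linear by blast

lemma linear_map_mult: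
  assumes "y \<in> carrier (P j)"
  shows "linear_map R (P i) (P (i + j)) (\<lambda>x. \<mu> i j x y)"
proof (cases i)
  case 0
  then show ?thesis
    using assms unfolding linear_map_def
    by (auto simp: P_0 P.smult_closed P.smult_l_distr P.smult_assoc simp del: tensor_power.simps)
next
  case (Suc k)
  then show ?thesis using mult_t_and_linear[of k] assms by blast
qed

lemma mult_closed [simp]: "\<lbrakk>x \<in> carrier (P i); y \<in> carrier (P j)\<rbrakk> \<Longrightarrow> \<mu> i j x y \<in> carrier (P (i + j))"
  using linear_mapD(1)[OF linear_map_mult] .

lemma mult_add_left: "\<lbrakk>x \<in> carrier (P i); x' \<in> carrier (P i); y \<in> carrier (P j)\<rbrakk> \<Longrightarrow>
    \<mu> i j (x \<oplus>\<^bsub>P i\<^esub> x') y = \<mu> i j x y \<oplus>\<^bsub>P (i + j)\<^esub> \<mu> i j x' y"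
  using linear_mapD(2)[OF linear_map_mult] .

lemma mult_smult: "\<lbrakk>r \<in> carrier R; x \<in> carrier (P i); y \<in> carrier (P j)\<rbrakk> \<Longrightarrow>
    \<mu> i j (r \<odot>\<^bsub>P i\<^esub> x) y = r \<odot>\<^bsub>P (i + j)\<^esub> \<mu> i j x y"
  using linear_mapD(3)[OF linear_map_mult] .

lemma mult_zero_left [simp]: "y \<in> carrier (P j) \<Longrightarrow> \<mu> i j \<zero>\<^bsub>P i\<^esub> y = \<zero>\<^bsub>P (i + j)\<^esub>"
  using linear_map_zero[OF linear_map_mult left_module_P left_module_P] .

lemma mult_0: "r \<in> carrier R \<Longrightarrow> \<mu> 0 j (Scal r) y = r \<odot>\<^bsub>P j\<^esub> y"
  by simp

text \<open>The recursion runs on the left factor, so additivity on the right needs its own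
  induction, which moves the sum past one element of degree one at a time.\<close>

lemma mult_add_right: "\<lbrakk>x \<in> carrier (P i); y \<in> carrier (P j); y' \<in> carrier (P j)\<rbrakk> \<Longrightarrow>
    \<mu> i j x (y \<oplus>\<^bsub>P j\<^esub> y') = \<mu> i j x y \<oplus>\<^bsub>P (i + j)\<^esub> \<mu> i j x y'"
proof (induction i arbitrary: x)
  case 0
  then show ?case by (auto simp: P_0 P.smult_r_distr simp del: tensor_power.simps)
next
  case (Suc i)
  show ?case
    using Suc.prems(1)
  proof (induction rule: P_induct)
    case zero
    show ?case using Suc.prems by (simp del: tensor_power.simps tpow_mult.simps)
  next
    case (t m x)
    then show ?case using Suc.prems
      by (simp add: mult_t Suc.IH t_add_right del: tensor_power.simps tpow_mult.simps)
  next
    case (add u v)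
    have "\<mu> (Suc i) j u y \<in> carrier (P (Suc i + j))" "\<mu> (Suc i) j v y \<in> carrier (P (Suc i + j))"
      "\<mu> (Suc i) j u y' \<in> carrier (P (Suc i + j))" "\<mu> (Suc i) j v y' \<in> carrier (P (Suc i + j))"
      using add Suc.prems mult_closed by blast+
    then show ?case using add Suc.prems
      by (simp add: mult_add_left P.M.a_ac del: tensor_power.simps tpow_mult.simps)
  qed
qed

lemma mult_zero_right [simp]:
  "x \<in> carrier (P i) \<Longrightarrow> \<mu> i j x \<zero>\<^bsub>P j\<^esub> = \<zero>\<^bsub>P (i + j)\<^esub>"
  by (rule additive_zero[OF P.M.abelian_group_axioms P.M.abelian_group_axioms])
    (auto simp: mult_add_right simp del: tensor_power.simps tpow_mult.simps)

text \<open>By \<open>mult_t\<close> an element of degree one can be pulled out of the left factor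
  on both sides, which lowers its degree. In degree 0 the law is linearity of the product of
  \<open>y\<close> and \<open>z\<close> in \<open>y\<close>.\<close>

lemma mult_assoc:
  "\<lbrakk>x \<in> carrier (P i); y \<in> carrier (P j); z \<in> carrier (P k)\<rbrakk> \<Longrightarrow>
    \<mu> (i + j) k (\<mu> i j x y) z = \<mu> i (j + k) x (\<mu> j k y z)"
proof (induction i arbitrary: x)
  case 0
  then show ?case by (auto simp: P_0 mult_smult simp del: tensor_power.simps)
next
  case (Suc i)
  show ?case
    using Suc.prems(1)
  proof (induction rule: P_induct)
    case zero
    show ?case using Suc.prems mult_zero_left[of z k "Suc i + j"]
      by (simp del: tensor_power.simps tpow_mult.simps mult_zero_left add: mult_zero_left ac_simps)
  next
    case (t m x)
    then have "\<mu> (Suc (i + j)) k (t (i + j) m (\<mu> i j x y)) z = t (i + j + k) m (\<mu> (i + j) k (\<mu> i j x y) z)"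
      using Suc.prems by (intro mult_t) auto
    then show ?case using t Suc.prems mult_closed[of y j z k]
      by (simp add: mult_t Suc.IH add.assoc del: tensor_power.simps tpow_mult.simps)
  next
    case (add u v)
    have c: "\<mu> (Suc i) j u y \<in> carrier (P (Suc i + j))" "\<mu> (Suc i) j v y \<in> carrier (P (Suc i + j))"
      "\<mu> j k y z \<in> carrier (P (j + k))"
      using add Suc.prems mult_closed by blast+
    have "\<mu> (Suc i + j) k (\<mu> (Suc i) j (u \<oplus>\<^bsub>P (Suc i)\<^esub> v) y) z =
        \<mu> (Suc i + j) k (\<mu> (Suc i) j u y) z \<oplus>\<^bsub>P (Suc i + j + k)\<^esub> \<mu> (Suc i + j) k (\<mu> (Suc i) j v y) z"
      using mult_add_left[OF add(1,2) Suc.prems(2)] mult_add_left[OF c(1,2) Suc.prems(3)] by simp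
    also have "\<dots> = \<mu> (Suc i) (j + k) (u \<oplus>\<^bsub>P (Suc i)\<^esub> v) (\<mu> j k y z)"
      using mult_add_left[OF add(1,2) c(3)] add(3,4) by (simp only: add.assoc)
    finally show ?case .
  qed
qed

lemma mult_one_right: "x \<in> carrier (P i) \<Longrightarrow> \<mu> i 0 x (Scal \<one>\<^bsub>R\<^esub>) = x"
proof (induction i arbitrary: x)
  case 0
  then show ?case using P_0(4)[of "\<one>\<^bsub>R\<^esub>"] by (auto simp: P_0 simp del: tensor_power.simps)
next
  case (Suc i)
  have 1: "Scal \<one>\<^bsub>R\<^esub> \<in> carrier (P 0)" by (simp add: P_0 del: tensor_power.simps)
  show ?case
    using Suc.prems
  proof (induction rule: P_induct)
    case zero
    show ?case using mult_zero_left[OF 1, of "Suc i"] by (simp del: tensor_power.simps tpow_mult.simps)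
  next
    case (t m x)
    then show ?case using mult_t[OF t 1] Suc.IH by (simp del: tensor_power.simps tpow_mult.simps)
  next
    case (add u v)
    then show ?case using mult_add_left[OF add(1,2) 1] by (simp del: tensor_power.simps tpow_mult.simps)
  qed
qed

end

section \<open>The n-trivial extension\<close>

text \<open>Replaces the index j by j - i. In the associativity proof i and j - i become the degrees
  of the first two factors.\<close>

lemma (in abelian_monoid) finsum_triangle:
  assumes "\<And>i j. \<lbrakk>i \<le> j; j \<le> k\<rbrakk> \<Longrightarrow> f i j \<in> carrier G"
  shows "(\<Oplus>j\<in>{..k::nat}. \<Oplus>i\<in>{..j}. f i j) = (\<Oplus>i\<in>{..k}. \<Oplus>j\<in>{..k - i}. f i (i + j))"
  using assms
proof (induction k)
  case 0
  then show ?case by (simp add: Pi_iff)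
next
  case (Suc k)
  \<comment> \<open>For i \<le> k the inner sum gains the last term f i (k+1). These terms form the
    new column j = k + 1, except for its entry at i = k + 1, which is the whole inner sum for that
    i.\<close>
  have "(\<Oplus>i\<in>{..k}. \<Oplus>j\<in>{..Suc k - i}. f i (i + j)) =
      (\<Oplus>i\<in>{..k}. f i (Suc k) \<oplus> (\<Oplus>j\<in>{..k - i}. f i (i + j)))"
    by (rule finsum_cong') (auto simp: Suc.prems Suc_diff_le intro!: finsum_closed)
  also have "\<dots> = (\<Oplus>i\<in>{..k}. f i (Suc k)) \<oplus> (\<Oplus>i\<in>{..k}. \<Oplus>j\<in>{..k - i}. f i (i + j))"
    by (rule finsum_addf) (auto simp: Suc.prems intro!: finsum_closed)
  also have "(\<Oplus>i\<in>{..k}. \<Oplus>j\<in>{..k - i}. f i (i + j)) = (\<Oplus>j\<in>{..k}. \<Oplus>i\<in>{..j}. f i j)"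
    using Suc by simp
  finally have "(\<Oplus>i\<in>{..k}. \<Oplus>j\<in>{..Suc k - i}. f i (i + j)) =
      (\<Oplus>i\<in>{..k}. f i (Suc k)) \<oplus> (\<Oplus>j\<in>{..k}. \<Oplus>i\<in>{..j}. f i j)" .
  moreover have "(\<Oplus>j\<in>{..k}. \<Oplus>i\<in>{..j}. f i j) \<in> carrier G" "(\<Oplus>i\<in>{..k}. f i (Suc k)) \<in> carrier G"
    "\<And>i. i \<le> k \<Longrightarrow> (\<Oplus>j\<in>{..Suc k - i}. f i (i + j)) \<in> carrier G"
    "\<And>j. j \<le> Suc k \<Longrightarrow> (\<Oplus>i\<in>{..j}. f i j) \<in> carrier G"
    by (auto simp: Suc.prems intro!: finsum_closed)
  ultimately show ?case
    by (simp add: Suc.prems Pi_iff a_assoc)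
qed

lemma finsum_additive:
  assumes "abelian_group X" "abelian_group Y" "finite A" "\<And>i. i \<in> A \<Longrightarrow> g i \<in> carrier X"
    and "f \<in> carrier X \<rightarrow> carrier Y"
    and "\<And>x y. \<lbrakk>x \<in> carrier X; y \<in> carrier X\<rbrakk> \<Longrightarrow> f (x \<oplus>\<^bsub>X\<^esub> y) = f x \<oplus>\<^bsub>Y\<^esub> f y"
  shows "f (finsum X g A) = finsum Y (\<lambda>i. f (g i)) A"
proof -
  interpret X: abelian_group X by fact
  interpret Y: abelian_group Y by fact
  show ?thesis
    using assms(3,4)
  proof (induction A)
    case empty
    show ?case using additive_zero[OF assms(1,2,5,6)] by simp
  next
    case (insert a A)
    then have "finsum X g (insert a A) = g a \<oplus>\<^bsub>X\<^esub> finsum X g A" "finsum X g A \<in> carrier X"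
      by (auto intro!: X.finsum_insert X.finsum_closed)
    moreover have "finsum Y (\<lambda>i. f (g i)) (insert a A) = f (g a) \<oplus>\<^bsub>Y\<^esub> finsum Y (\<lambda>i. f (g i)) A"
      using insert assms(5) by (intro Y.finsum_insert) auto
    ultimately show ?case using insert assms(6) by simp
  qed
qed

section \<open>The ring structure of the extension\<close>

context bimod
begin

text \<open>Simplification would unfold powers and products at small degrees and hide the terms
  \<open>P\<close> and \<open>\<mu>\<close> in which the preceding lemmas are stated.\<close>

declare tensor_power.simps [simp del] tpow_mult.simps [simp del]

context
  fixes n :: nat
begin

abbreviation "S \<equiv> trivial_extension n R M"

lemma trivial_extension_simps:
  "carrier S = (\<Pi>\<^sub>E k\<in>{..n}. carrier (P k))"
  "x \<oplus>\<^bsub>S\<^esub> y = (\<lambda>k\<in>{..n}. x k \<oplus>\<^bsub>P k\<^esub> y k)"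
  "x \<otimes>\<^bsub>S\<^esub> y = (\<lambda>k\<in>{..n}. \<Oplus>\<^bsub>P k\<^esub>i\<in>{..k}. \<mu> i (k - i) (x i) (y (k - i)))"
  "\<zero>\<^bsub>S\<^esub> = (\<lambda>k\<in>{..n}. \<zero>\<^bsub>P k\<^esub>)"
  by (simp_all add: trivial_extension_def)

lemma component_closed [simp]: "\<lbrakk>x \<in> carrier S; k \<le> n\<rbrakk> \<Longrightarrow> x k \<in> carrier (P k)"
  by (auto simp: trivial_extension_simps)

lemma S_eqI: "\<lbrakk>x \<in> carrier S; y \<in> carrier S; \<And>k. k \<le> n \<Longrightarrow> x k = y k\<rbrakk> \<Longrightarrow> x = y"
  unfolding trivial_extension_simps by (rule PiE_ext) auto

lemma mult_closed' [simp]: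
  "\<lbrakk>i \<le> k; x \<in> carrier (P i); y \<in> carrier (P (k - i))\<rbrakk> \<Longrightarrow> \<mu> i (k - i) x y \<in> carrier (P k)"
  using mult_closed[of x i y "k - i"] by simp

lemma product_closed [simp]:
  assumes "x \<in> carrier S" "y \<in> carrier S" "k \<le> n"
  shows "(\<Oplus>\<^bsub>P k\<^esub>i\<in>{..k}. \<mu> i (k - i) (x i) (y (k - i))) \<in> carrier (P k)"
  using assms by (intro P.M.finsum_closed) auto

lemma S_closed [simp]:
  "\<lbrakk>x \<in> carrier S; y \<in> carrier S\<rbrakk> \<Longrightarrow> x \<oplus>\<^bsub>S\<^esub> y \<in> carrier S"
  "\<lbrakk>x \<in> carrier S; y \<in> carrier S\<rbrakk> \<Longrightarrow> x \<otimes>\<^bsub>S\<^esub> y \<in> carrier S"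
  "\<zero>\<^bsub>S\<^esub> \<in> carrier S"
proof -
  show "x \<oplus>\<^bsub>S\<^esub> y \<in> carrier S" if "x \<in> carrier S" "y \<in> carrier S"
    using that component_closed unfolding trivial_extension_simps(2) by (subst trivial_extension_simps) auto
  show "x \<otimes>\<^bsub>S\<^esub> y \<in> carrier S" if "x \<in> carrier S" "y \<in> carrier S"
    using that product_closed unfolding trivial_extension_simps(3) by (subst trivial_extension_simps) auto
  show "\<zero>\<^bsub>S\<^esub> \<in> carrier S"
    by (auto simp: trivial_extension_simps)
qed

lemma component_simps [simp]:
  "k \<le> n \<Longrightarrow> (x \<oplus>\<^bsub>S\<^esub> y) k = x k \<oplus>\<^bsub>P k\<^esub> y k"
  "k \<le> n \<Longrightarrow> \<zero>\<^bsub>S\<^esub> k = \<zero>\<^bsub>P k\<^esub>"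
  by (simp_all add: trivial_extension_simps)

lemma component_mult:
  "k \<le> n \<Longrightarrow> (x \<otimes>\<^bsub>S\<^esub> y) k = (\<Oplus>\<^bsub>P k\<^esub>i\<in>{..k}. \<mu> i (k - i) (x i) (y (k - i)))"
  by (simp add: trivial_extension_simps)

text \<open>For d > n the result is zero, as there is no component d; this keeps
  \<open>homog_mult_homog\<close> valid when degrees add up beyond n.\<close>

definition homog :: "nat \<Rightarrow> ('a, 'm) tpow_elem \<Rightarrow> nat \<Rightarrow> ('a, 'm) tpow_elem" where
  "homog d x = (\<lambda>k\<in>{..n}. if k = d then x else \<zero>\<^bsub>P k\<^esub>)"

lemma homog_closed [simp]: "x \<in> carrier (P d) \<Longrightarrow> homog d x \<in> carrier S"
  by (auto simp: homog_def trivial_extension_simps)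

lemma homog_component [simp]: "k \<le> n \<Longrightarrow> homog d x k = (if k = d then x else \<zero>\<^bsub>P k\<^esub>)"
  by (simp add: homog_def)

lemma Scal_closed [simp]: "r \<in> carrier R \<Longrightarrow> Scal r \<in> carrier (P 0)"
  by (simp add: P_0)

lemma Vec_closed [simp]: "m \<in> carrier M \<Longrightarrow> Vec m \<in> carrier (P (Suc 0))"
  by (simp add: P_1)

lemma one_eq: "\<one>\<^bsub>S\<^esub> = homog 0 (Scal \<one>\<^bsub>R\<^esub>)"
  by (simp add: trivial_extension_def homog_def)

text \<open>In the convolution sum only the index d survives, and for k < d not even that one
  occurs.\<close>

lemma homog_mult:
  assumes "x \<in> carrier (P d)" "s \<in> carrier S" "k \<le> n"
  shows "(homog d x \<otimes>\<^bsub>S\<^esub> s) k = (if d \<le> k then \<mu> d (k - d) x (s (k - d)) else \<zero>\<^bsub>P k\<^esub>)"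
proof -
  have "(homog d x \<otimes>\<^bsub>S\<^esub> s) k = (\<Oplus>\<^bsub>P k\<^esub>i\<in>{..k}. if d = i then \<mu> i (k - i) x (s (k - i)) else \<zero>\<^bsub>P k\<^esub>)"
    unfolding component_mult[OF assms(3)]
    using assms mult_zero_left[of "s (k - i)" "k - i" i for i]
    by (intro P.M.finsum_cong') (auto simp: le_diff_conv2)
  also have "\<dots> = (if d \<le> k then \<mu> d (k - d) x (s (k - d)) else \<zero>\<^bsub>P k\<^esub>)"
  proof (cases "d \<le> k")
    case True
    then show ?thesis
      using assms P.M.finsum_singleton[of d "{..k}" "\<lambda>i. \<mu> i (k - i) (if i = d then x else \<zero>\<^bsub>P i\<^esub>) (s (k - i))" k]
      by (simp cong: if_cong)
  next
    case False
    then show ?thesis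
      by (auto intro!: P.M.add.finprod_one_eqI)
  qed
  finally show ?thesis .
qed

lemma mult_homog_0:
  assumes "r \<in> carrier R" "s \<in> carrier S" "k \<le> n"
  shows "(s \<otimes>\<^bsub>S\<^esub> homog 0 (Scal r)) k = \<mu> k 0 (s k) (Scal r)"
proof (cases k)
  case 0
  then show ?thesis
    using assms mult_closed[of "s 0" 0 "Scal r" 0] by (simp add: component_mult)
next
  case (Suc l)
  have "(\<Oplus>\<^bsub>P k\<^esub>i\<in>{..l}. \<mu> i (k - i) (s i) (homog 0 (Scal r) (k - i))) = \<zero>\<^bsub>P k\<^esub>"
  proof (rule P.M.add.finprod_one_eqI[simplified])
    fix i assume "i \<in> {..l}"
    then show "\<mu> i (k - i) (s i) (homog 0 (Scal r) (k - i)) = \<zero>\<^bsub>P k\<^esub>"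
      using assms Suc mult_zero_right[of "s i" i "k - i"] by simp
  qed
  moreover have "(\<lambda>i. \<mu> i (k - i) (s i) (homog 0 (Scal r) (k - i))) \<in> {..Suc l} \<rightarrow> carrier (P k)"
    using assms Suc by (auto intro!: mult_closed' homog_closed component_closed)
  ultimately show ?thesis
    using assms Suc P.M.finsum_Suc[of _ l] mult_closed[of "s k" k "Scal r" 0]
    by (simp add: component_mult)
qed

lemma S_assoc:
  assumes "x \<in> carrier S" "y \<in> carrier S" "z \<in> carrier S"
  shows "(x \<otimes>\<^bsub>S\<^esub> y) \<otimes>\<^bsub>S\<^esub> z = x \<otimes>\<^bsub>S\<^esub> (y \<otimes>\<^bsub>S\<^esub> z)"
proof (rule S_eqI)
  fix k assume k: "k \<le> n"
  let ?f = "\<lambda>i j. \<mu> j (k - j) (\<mu> i (j - i) (x i) (y (j - i))) (z (k - j))"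
  have yz: "\<mu> j (k - (i + j)) (y j) (z (k - (i + j))) \<in> carrier (P (k - i))"
    if "i \<le> k" "j \<le> k - i" for i j
    using mult_closed'[of j "k - i" "y j" "z (k - (i + j))"] that k assms by simp
  have "((x \<otimes>\<^bsub>S\<^esub> y) \<otimes>\<^bsub>S\<^esub> z) k =
      (\<Oplus>\<^bsub>P k\<^esub>j\<in>{..k}. \<mu> j (k - j) (\<Oplus>\<^bsub>P j\<^esub>i\<in>{..j}. \<mu> i (j - i) (x i) (y (j - i))) (z (k - j)))"
    unfolding component_mult[OF k] using k assms
    by (intro P.M.finsum_cong') (auto simp: component_mult)
  also have "\<dots> = (\<Oplus>\<^bsub>P k\<^esub>j\<in>{..k}. \<Oplus>\<^bsub>P k\<^esub>i\<in>{..j}. ?f i j)"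
  proof (rule P.M.finsum_cong')
    fix j assume "j \<in> {..k}"
    then have j: "j \<le> k" by simp
    show "\<mu> j (k - j) (\<Oplus>\<^bsub>P j\<^esub>i\<in>{..j}. \<mu> i (j - i) (x i) (y (j - i))) (z (k - j)) =
        (\<Oplus>\<^bsub>P k\<^esub>i\<in>{..j}. ?f i j)"
      by (rule finsum_additive[OF P.M.abelian_group_axioms P.M.abelian_group_axioms])
        (use j k assms mult_add_left[of _ j _ "z (k - j)" "k - j"] in auto)
  qed (use assms k in \<open>auto intro!: P.M.finsum_closed\<close>)
  \<comment> \<open>From here i and j are the degrees taken from \<open>x\<close> and
    \<open>y\<close>, and \<open>z\<close> takes the remaining k - i - j.\<close>
  also have "\<dots> = (\<Oplus>\<^bsub>P k\<^esub>i\<in>{..k}. \<Oplus>\<^bsub>P k\<^esub>j\<in>{..k - i}. ?f i (i + j))"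
    by (rule P.M.finsum_triangle) (use assms k in auto)
  also have "\<dots> = (\<Oplus>\<^bsub>P k\<^esub>i\<in>{..k}. \<mu> i (k - i) (x i) (\<Oplus>\<^bsub>P (k - i)\<^esub>j\<in>{..k - i}. \<mu> j (k - i - j) (y j) (z (k - i - j))))"
  proof (rule P.M.finsum_cong')
    fix i assume "i \<in> {..k}"
    then have i: "i \<le> k" by simp
    have "\<mu> i (k - i) (x i) (\<Oplus>\<^bsub>P (k - i)\<^esub>j\<in>{..k - i}. \<mu> j (k - i - j) (y j) (z (k - i - j))) =
        (\<Oplus>\<^bsub>P k\<^esub>j\<in>{..k - i}. \<mu> i (k - i) (x i) (\<mu> j (k - i - j) (y j) (z (k - i - j))))"
      by (rule finsum_additive[OF P.M.abelian_group_axioms P.M.abelian_group_axioms])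
        (use i k assms mult_add_right[of "x i" i _ "k - i"] yz in auto)
    also have "\<dots> = (\<Oplus>\<^bsub>P k\<^esub>j\<in>{..k - i}. ?f i (i + j))"
    proof (rule P.M.finsum_cong')
      fix j assume "j \<in> {..k - i}"
      then have j: "j \<le> k - i" by simp
      \<comment> \<open>The degree is an argument of \<open>P\<close> and \<open>\<mu>\<close>, so
        this identity must be known before associativity matches.\<close>
      have "j + (k - (i + j)) = k - i" using i j by simp
      then show "\<mu> i (k - i) (x i) (\<mu> j (k - i - j) (y j) (z (k - i - j))) = ?f i (i + j)"
        using mult_assoc[of "x i" i "y j" j "z (k - (i + j))" "k - (i + j)"] i j k assms by simp
    qed (use i k assms in auto)
    finally show "(\<Oplus>\<^bsub>P k\<^esub>j\<in>{..k - i}. ?f i (i + j)) =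
      \<mu> i (k - i) (x i) (\<Oplus>\<^bsub>P (k - i)\<^esub>j\<in>{..k - i}. \<mu> j (k - i - j) (y j) (z (k - i - j)))" by simp
  qed (use k assms yz in \<open>auto intro!: mult_closed' P.M.finsum_closed\<close>)
  also have "\<dots> = (x \<otimes>\<^bsub>S\<^esub> (y \<otimes>\<^bsub>S\<^esub> z)) k"
    unfolding component_mult[OF k] using k assms
    by (intro P.M.finsum_cong') (auto simp: component_mult yz intro!: mult_closed' P.M.finsum_closed)
  finally show "((x \<otimes>\<^bsub>S\<^esub> y) \<otimes>\<^bsub>S\<^esub> z) k = (x \<otimes>\<^bsub>S\<^esub> (y \<otimes>\<^bsub>S\<^esub> z)) k" .
qed (use assms in auto)

lemma ring_S: "ring S"
proof (rule ringI)
  show "abelian_group S"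
  proof (rule abelian_groupI)
    fix x assume x: "x \<in> carrier S"
    let ?y = "\<lambda>k\<in>{..n}. \<ominus>\<^bsub>P k\<^esub> x k"
    have y: "?y \<in> carrier S"
      using component_closed[OF x] by (subst trivial_extension_simps) auto
    show "\<exists>y\<in>carrier S. y \<oplus>\<^bsub>S\<^esub> x = \<zero>\<^bsub>S\<^esub>"
      by (rule bexI[OF _ y], rule S_eqI) (use x y in \<open>auto simp: P.M.l_neg\<close>)
  qed (auto intro!: S_eqI simp: P.M.a_ac)
  show "monoid S"
  proof (rule monoidI)
    fix x assume x: "x \<in> carrier S"
    show "\<one>\<^bsub>S\<^esub> \<otimes>\<^bsub>S\<^esub> x = x"
      by (rule S_eqI) (use x in \<open>auto simp: one_eq homog_mult mult_0 P.smult_one\<close>)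
    show "x \<otimes>\<^bsub>S\<^esub> \<one>\<^bsub>S\<^esub> = x"
      by (rule S_eqI) (use x in \<open>auto simp: one_eq mult_homog_0 mult_one_right\<close>)
  qed (auto simp: S_assoc one_eq)
  fix x y z assume xyz: "x \<in> carrier S" "y \<in> carrier S" "z \<in> carrier S"
  show "(x \<oplus>\<^bsub>S\<^esub> y) \<otimes>\<^bsub>S\<^esub> z = x \<otimes>\<^bsub>S\<^esub> z \<oplus>\<^bsub>S\<^esub> y \<otimes>\<^bsub>S\<^esub> z"
  proof (rule S_eqI)
    fix k assume k: "k \<le> n"
    have "((x \<oplus>\<^bsub>S\<^esub> y) \<otimes>\<^bsub>S\<^esub> z) k =
        (\<Oplus>\<^bsub>P k\<^esub>i\<in>{..k}. \<mu> i (k - i) (x i) (z (k - i)) \<oplus>\<^bsub>P k\<^esub> \<mu> i (k - i) (y i) (z (k - i)))"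
      unfolding component_mult[OF k] using k xyz mult_add_left[of "x i" i "y i" "z (k - i)" "k - i" for i]
      by (intro P.M.finsum_cong') auto
    also have "\<dots> = (x \<otimes>\<^bsub>S\<^esub> z \<oplus>\<^bsub>S\<^esub> y \<otimes>\<^bsub>S\<^esub> z) k"
      using k xyz by (subst P.M.finsum_addf) (auto simp: component_mult)
    finally show "((x \<oplus>\<^bsub>S\<^esub> y) \<otimes>\<^bsub>S\<^esub> z) k = (x \<otimes>\<^bsub>S\<^esub> z \<oplus>\<^bsub>S\<^esub> y \<otimes>\<^bsub>S\<^esub> z) k" .
  qed (use xyz in auto)
  show "z \<otimes>\<^bsub>S\<^esub> (x \<oplus>\<^bsub>S\<^esub> y) = z \<otimes>\<^bsub>S\<^esub> x \<oplus>\<^bsub>S\<^esub> z \<otimes>\<^bsub>S\<^esub> y"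
  proof (rule S_eqI)
    fix k assume k: "k \<le> n"
    have "(z \<otimes>\<^bsub>S\<^esub> (x \<oplus>\<^bsub>S\<^esub> y)) k =
        (\<Oplus>\<^bsub>P k\<^esub>i\<in>{..k}. \<mu> i (k - i) (z i) (x (k - i)) \<oplus>\<^bsub>P k\<^esub> \<mu> i (k - i) (z i) (y (k - i)))"
      unfolding component_mult[OF k]
      using k xyz mult_add_right[of "z i" i "x (k - i)" "k - i" "y (k - i)" for i]
      by (intro P.M.finsum_cong') auto
    also have "\<dots> = (z \<otimes>\<^bsub>S\<^esub> x \<oplus>\<^bsub>S\<^esub> z \<otimes>\<^bsub>S\<^esub> y) k"
      using k xyz by (subst P.M.finsum_addf) (auto simp: component_mult)
    finally show "(z \<otimes>\<^bsub>S\<^esub> (x \<oplus>\<^bsub>S\<^esub> y)) k = (z \<otimes>\<^bsub>S\<^esub> x \<oplus>\<^bsub>S\<^esub> z \<otimes>\<^bsub>S\<^esub> y) k" .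
  qed (use xyz in auto)
qed

section \<open>Homogeneous elements and the split extension\<close>

lemma homog_add:
  assumes "x \<in> carrier (P d)" "y \<in> carrier (P d)"
  shows "homog d (x \<oplus>\<^bsub>P d\<^esub> y) = homog d x \<oplus>\<^bsub>S\<^esub> homog d y"
  by (rule S_eqI) (use assms in auto)

lemma homog_zero: "homog d \<zero>\<^bsub>P d\<^esub> = \<zero>\<^bsub>S\<^esub>"
  by (rule S_eqI) auto

lemma homog_mult_homog:
  assumes "x \<in> carrier (P i)" "y \<in> carrier (P j)"
  shows "homog i x \<otimes>\<^bsub>S\<^esub> homog j y = homog (i + j) (\<mu> i j x y)"
proof (rule S_eqI)
  fix k assume k: "k \<le> n"
  then show "(homog i x \<otimes>\<^bsub>S\<^esub> homog j y) k = homog (i + j) (\<mu> i j x y) k"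
    using assms mult_zero_right[of x i "k - i"] homog_mult[OF assms(1) homog_closed[OF assms(2)] k] by auto
qed (use assms in auto)

lemma S_eq_zeroI: "\<lbrakk>x \<in> carrier S; \<And>k. k \<le> n \<Longrightarrow> x k = \<zero>\<^bsub>P k\<^esub>\<rbrakk> \<Longrightarrow> x = \<zero>\<^bsub>S\<^esub>"
  by (rule S_eqI) auto

text \<open>By \<open>P_induct\<close> a homogeneous element of degree d + 2 is a sum of products of
  an element of degree one with one of degree d + 1, and an element without component 0 is the sum
  of its homogeneous parts of positive degree.\<close>

lemma positive_degree_induct:
  assumes i: "i \<in> carrier S" "i 0 = \<zero>\<^bsub>P 0\<^esub>"
    and zero: "Q \<zero>\<^bsub>S\<^esub>"
    and add: "\<And>x y. \<lbrakk>x \<in> carrier S; y \<in> carrier S; Q x; Q y\<rbrakk> \<Longrightarrow> Q (x \<oplus>\<^bsub>S\<^esub> y)"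
    and gen: "\<And>m. m \<in> carrier M \<Longrightarrow> Q (homog 1 (Vec m))"
    and mult: "\<And>m x. \<lbrakk>m \<in> carrier M; x \<in> carrier S; x 0 = \<zero>\<^bsub>P 0\<^esub>; Q x\<rbrakk> \<Longrightarrow>
      Q (homog 1 (Vec m) \<otimes>\<^bsub>S\<^esub> x)"
  shows "Q i"
proof -
  have hom: "Q (homog (Suc d) x)" if "x \<in> carrier (P (Suc d))" for d x
    using that
  proof (induction d arbitrary: x)
    case 0
    then show ?case using gen by (auto simp: P_1)
  next
    case (Suc d)
    show ?case
      using Suc.prems
    proof (induction rule: P_induct)
      case zero
      show ?case using \<open>Q \<zero>\<^bsub>S\<^esub>\<close> by (simp add: homog_zero)
    next
      case (t m x)
      then have "Q (homog 1 (Vec m) \<otimes>\<^bsub>S\<^esub> homog (Suc d) x)"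
        using Suc.IH by (intro mult) auto
      then show ?case using t homog_mult_homog[of "Vec m" 1 x "Suc d"] by simp
    next
      case (add x y)
      then show ?case using assms(4) by (simp add: homog_add)
    qed
  qed
  \<comment> \<open>The truncation of \<open>i\<close> to degrees at most e. For e = 0 it is zero
    because component 0 of \<open>i\<close> vanishes, and for e = n it is \<open>i\<close>.\<close>
  define u where "u e = (\<lambda>k\<in>{..n}. if k \<le> e then i k else \<zero>\<^bsub>P k\<^esub>)" for e
  have u_closed: "u e \<in> carrier S" for e
    using component_closed[OF i(1)] unfolding u_def by (subst trivial_extension_simps) auto
  have u_simp: "k \<le> n \<Longrightarrow> u e k = (if k \<le> e then i k else \<zero>\<^bsub>P k\<^esub>)" for e k
    by (simp add: u_def)
  have "Q (u e)" if "e \<le> n" for e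
    using that
  proof (induction e)
    case 0
    have "u 0 = \<zero>\<^bsub>S\<^esub>" by (rule S_eq_zeroI) (use i u_closed in \<open>auto simp: u_simp\<close>)
    then show ?case using zero by simp
  next
    case (Suc e)
    have "u (Suc e) = u e \<oplus>\<^bsub>S\<^esub> homog (Suc e) (i (Suc e))"
      by (rule S_eqI) (use Suc.prems i u_closed in \<open>auto simp: u_simp le_Suc_eq\<close>)
    then show ?case using Suc hom i u_closed by (auto intro: add)
  qed
  moreover have "u n = i" by (rule S_eqI) (use i u_closed in \<open>auto simp: u_simp\<close>)
  ultimately show ?thesis by (metis order_refl)
qed

lemma P_0_cases:
  assumes "x \<in> carrier (P 0)" obtains r where "r \<in> carrier R" "x = Scal r"
  using assms by (auto simp: P_0)

lemma P_1_cases: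
  assumes "x \<in> carrier (P (Suc 0))" obtains m where "m \<in> carrier M" "x = Vec m"
  using assms by (auto simp: P_1)

lemma mult_1_0: "\<lbrakk>r \<in> carrier R; m \<in> carrier M\<rbrakk> \<Longrightarrow> \<mu> (Suc 0) 0 (Vec m) (Scal r) = Vec (right_smult M r m)"
  by (simp add: tpow_mult.simps)

text \<open>The degree filtration reaches zero at n + 1 because there are no components beyond n.
  The assumption n \<ge> 1 provides component 1, from which the projection to M reads its
  value.\<close>

lemma split_extension:
  assumes "n \<ge> 1"
  shows "split_extension R S M (\<lambda>s. the_scal (s 0)) (\<lambda>r. homog 0 (Scal r)) (\<lambda>m. homog 1 (Vec m))
    (\<lambda>s. the_vec (s 1)) (\<lambda>k. {s \<in> carrier S. \<forall>i<k. i \<le> n \<longrightarrow> s i = \<zero>\<^bsub>P i\<^esub>}) n"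
proof (rule split_extension.intro)
  show "ring R" by (rule M.R.ring_axioms)
  show "ring S" by (rule ring_S)
  show "Defs.bimodule R M" by (rule bimodule)
  have 0: "\<exists>r\<in>carrier R. s 0 = Scal r" and 1: "\<exists>m\<in>carrier M. s (Suc 0) = Vec m"
    if "s \<in> carrier S" for s
    using component_closed[OF that, of 0] component_closed[OF that, of 1] assms
    by (auto elim!: P_0_cases P_1_cases)
  have mult0: "(s \<otimes>\<^bsub>S\<^esub> s') 0 = Scal (r \<otimes>\<^bsub>R\<^esub> r')"
    if "s \<in> carrier S" "s' \<in> carrier S" "r \<in> carrier R" "r' \<in> carrier R" "s 0 = Scal r" "s' 0 = Scal r'"
    for s s' r r'
    using that component_mult[of 0 s s'] P.M.finsum_0[of "\<lambda>i. \<mu> i (0 - i) (s i) (s' (0 - i))" 0]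
    by (simp add: mult_0 P_0)
  show "(\<lambda>s. the_scal (s 0)) \<in> ring_hom S R"
  proof (rule ring_hom_memI)
    show "the_scal (\<one>\<^bsub>S\<^esub> 0) = \<one>\<^bsub>R\<^esub>" by (simp add: one_eq)
    fix x y assume x: "x \<in> carrier S" and y: "y \<in> carrier S"
    obtain r s where rs: "r \<in> carrier R" "s \<in> carrier R" "x 0 = Scal r" "y 0 = Scal s"
      using 0[OF x] 0[OF y] by auto
    then show "the_scal ((x \<otimes>\<^bsub>S\<^esub> y) 0) = the_scal (x 0) \<otimes>\<^bsub>R\<^esub> the_scal (y 0)"
      using mult0[OF x y] by simp
    show "the_scal ((x \<oplus>\<^bsub>S\<^esub> y) 0) = the_scal (x 0) \<oplus>\<^bsub>R\<^esub> the_scal (y 0)"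
      using rs by (simp add: P_0)
    show "the_scal (x 0) \<in> carrier R" using rs by simp
  qed
  show "(\<lambda>r. homog 0 (Scal r)) \<in> ring_hom R S"
    by (rule ring_hom_memI) (simp_all add: homog_mult_homog mult_0 one_eq P_0 flip: homog_add)
  show "the_scal (homog 0 (Scal r) 0) = r" for r by simp
  show "homog 1 (Vec m) \<in> carrier S" if "m \<in> carrier M" for m using that by simp
  show "the_scal (homog 1 (Vec m) 0) = \<zero>\<^bsub>R\<^esub>" for m by (simp add: P_0)
  show "homog 1 (Vec (m \<oplus>\<^bsub>M\<^esub> m')) = homog 1 (Vec m) \<oplus>\<^bsub>S\<^esub> homog 1 (Vec m')"
    if "m \<in> carrier M" "m' \<in> carrier M" for m m'
    using homog_add[of "Vec m" 1 "Vec m'"] that by (simp add: P_1)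
  show "homog 1 (Vec (r \<odot>\<^bsub>M\<^esub> m)) = homog 0 (Scal r) \<otimes>\<^bsub>S\<^esub> homog 1 (Vec m)"
    if "r \<in> carrier R" "m \<in> carrier M" for r m
    using that by (simp add: homog_mult_homog mult_0 P_1)
  show "homog 1 (Vec (right_smult M r m)) = homog 1 (Vec m) \<otimes>\<^bsub>S\<^esub> homog 0 (Scal r)"
    if "r \<in> carrier R" "m \<in> carrier M" for r m
    using that by (simp add: homog_mult_homog mult_1_0)
  show "the_vec (homog 1 (Vec m) 1) = m" for m using assms by simp
  show "the_vec (s 1) \<in> carrier M" if "s \<in> carrier S" for s
    using 1[OF that] by auto
  fix s t assume s: "s \<in> carrier S" and t: "t \<in> carrier S"
  obtain r r' m m' where *: "r \<in> carrier R" "r' \<in> carrier R" "m \<in> carrier M" "m' \<in> carrier M"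
    "s 0 = Scal r" "t 0 = Scal r'" "s (Suc 0) = Vec m" "t (Suc 0) = Vec m'"
    using 0[OF s] 0[OF t] 1[OF s] 1[OF t] by auto
  show "the_vec ((s \<oplus>\<^bsub>S\<^esub> t) 1) = the_vec (s 1) \<oplus>\<^bsub>M\<^esub> the_vec (t 1)"
    using * assms by (simp add: P_1)
  \<comment> \<open>Component 1 of a product has just the two terms m r' and r m', which gives the
    product rule for the projection to M.\<close>
  let ?f = "\<lambda>i. \<mu> i (Suc 0 - i) (s i) (t (Suc 0 - i))"
  have f: "?f \<in> {..Suc 0} \<rightarrow> carrier (P (Suc 0))"
    using s t assms by (auto intro!: mult_closed' component_closed)
  have "(s \<otimes>\<^bsub>S\<^esub> t) (Suc 0) = finsum (P (Suc 0)) ?f {..Suc 0}"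
    using assms by (simp add: component_mult)
  also have "\<dots> = ?f (Suc 0) \<oplus>\<^bsub>P (Suc 0)\<^esub> finsum (P (Suc 0)) ?f {..0}"
    by (rule P.M.finsum_Suc[OF f])
  also have "finsum (P (Suc 0)) ?f {..0} = ?f 0"
    by (rule P.M.finsum_0) (use funcset_mem[OF f, of 0] in simp)
  also have "?f (Suc 0) \<oplus>\<^bsub>P (Suc 0)\<^esub> ?f 0 = Vec (r \<odot>\<^bsub>M\<^esub> m' \<oplus>\<^bsub>M\<^esub> right_smult M r' m)"
    using * by (simp add: mult_0 mult_1_0 P_1 M.smult_closed M.M.a_comm)
  finally show "the_vec ((s \<otimes>\<^bsub>S\<^esub> t) 1) =
      the_scal (s 0) \<odot>\<^bsub>M\<^esub> the_vec (t 1) \<oplus>\<^bsub>M\<^esub> right_smult M (the_scal (t 0)) (the_vec (s 1))"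
    using * by simp
next
  have zero: "s 0 = \<zero>\<^bsub>P 0\<^esub>" if "s \<in> carrier S" "the_scal (s 0) = \<zero>\<^bsub>R\<^esub>" for s
    using component_closed[OF that(1), of 0] that(2) by (auto elim!: P_0_cases simp: P_0(2))
  have zero': "the_scal \<zero>\<^bsub>P 0\<^esub> = \<zero>\<^bsub>R\<^esub>" by (simp add: P_0)
  fix i assume i: "i \<in> carrier S" "the_scal (i 0) = \<zero>\<^bsub>R\<^esub>"
  fix Q :: "(nat \<Rightarrow> ('a, 'm) tpow_elem) \<Rightarrow> bool"
  assume Q: "Q \<zero>\<^bsub>S\<^esub>"
    "\<And>x y. \<lbrakk>x \<in> carrier S; y \<in> carrier S; Q x; Q y\<rbrakk> \<Longrightarrow> Q (x \<oplus>\<^bsub>S\<^esub> y)"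
    "\<And>m. m \<in> carrier M \<Longrightarrow> Q (homog 1 (Vec m))"
    "\<And>m x. \<lbrakk>m \<in> carrier M; x \<in> carrier S; the_scal (x 0) = \<zero>\<^bsub>R\<^esub>; Q x\<rbrakk> \<Longrightarrow>
      Q (homog 1 (Vec m) \<otimes>\<^bsub>S\<^esub> x)"
  show "Q i"
    using i(1) zero[OF i]
    by (rule positive_degree_induct) (use Q zero' in auto)
next
  fix k
  show "{s \<in> carrier S. \<forall>i<k. i \<le> n \<longrightarrow> s i = \<zero>\<^bsub>P i\<^esub>} \<subseteq> carrier S" by auto
  show "{s \<in> carrier S. \<forall>i<0. i \<le> n \<longrightarrow> s i = \<zero>\<^bsub>P i\<^esub>} = carrier S" by auto
  show "{s \<in> carrier S. \<forall>i<Suc n. i \<le> n \<longrightarrow> s i = \<zero>\<^bsub>P i\<^esub>} = {\<zero>\<^bsub>S\<^esub>}"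
    using S_eq_zeroI by auto
  fix i s assume i: "i \<in> carrier S" "the_scal (i 0) = \<zero>\<^bsub>R\<^esub>"
    and "s \<in> {s \<in> carrier S. \<forall>i<k. i \<le> n \<longrightarrow> s i = \<zero>\<^bsub>P i\<^esub>}"
  then have s: "s \<in> carrier S" "\<And>l. l < k \<Longrightarrow> l \<le> n \<Longrightarrow> s l = \<zero>\<^bsub>P l\<^esub>" by auto
  have i0: "i 0 = \<zero>\<^bsub>P 0\<^esub>"
    using component_closed[OF i(1), of 0] i(2) by (auto elim!: P_0_cases simp: P_0(2))
  have "(i \<otimes>\<^bsub>S\<^esub> s) l = \<zero>\<^bsub>P l\<^esub>" if "l < Suc k" "l \<le> n" for l
    unfolding component_mult[OF that(2)]
  proof (rule P.M.add.finprod_one_eqI[simplified])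
    fix a assume "a \<in> {..l}"
    then have a: "a \<le> l" by simp
    \<comment> \<open>Either a = 0, where \<open>i\<close> has no component, or l - a < k, where
      \<open>s\<close> has none.\<close>
    show "\<mu> a (l - a) (i a) (s (l - a)) = \<zero>\<^bsub>P l\<^esub>"
    proof (cases a)
      case 0
      then show ?thesis using i0 s that mult_zero_left[of "s l" l 0] by simp
    next
      case (Suc b)
      then have "s (l - a) = \<zero>\<^bsub>P (l - a)\<^esub>" using s(2)[of "l - a"] a that by simp
      then show ?thesis using i a that mult_zero_right[of "i a" a "l - a"] by simp
    qed
  qed
  then show "i \<otimes>\<^bsub>S\<^esub> s \<in> {s \<in> carrier S. \<forall>i<Suc k. i \<le> n \<longrightarrow> s i = \<zero>\<^bsub>P i\<^esub>}"
    using i s by simp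
qed

text \<open>The annihilator is defined inside M \<otimes> P(k), whereas products in the extension
  lie in P(k+1). For k > 0 the two differ by the injective naming. For k = 0 they are M \<otimes> R
  and M, and m r = 0 gives m \<otimes> r = m r \<otimes> 1 = 0.\<close>

lemma t_trivial_iff:
  assumes m: "m \<in> carrier M" and x: "x \<in> carrier (P k)"
  shows "pure_tensor R (right_part M) (P k) m x = \<one>\<^bsub>tensor R (right_part M) (P k)\<^esub> \<longleftrightarrow>
    t k m x = \<zero>\<^bsub>P (Suc k)\<^esub>"
proof
  interpret T: tensor_product R "right_part M" "P k" by (rule tensor_product_M[OF left_module_P])
  have "balanced R (right_part M) (P k) (add_monoid (P (Suc k))) (t k)"
    unfolding balanced_def by (auto simp: t_add_left t_add_right t_balanced)
  from T.tensor_lift[OF P.M.a_comm_group this] obtain f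
    where f: "f \<in> hom (tensor R (right_part M) (P k)) (add_monoid (P (Suc k)))"
      "\<And>a b. \<lbrakk>a \<in> carrier M; b \<in> carrier (P k)\<rbrakk> \<Longrightarrow> f (pure_tensor R (right_part M) (P k) a b) = t k a b"
    by auto
  show "t k m x = \<zero>\<^bsub>P (Suc k)\<^esub>"
    if "pure_tensor R (right_part M) (P k) m x = \<one>\<^bsub>tensor R (right_part M) (P k)\<^esub>"
    using f(2)[OF m x] that hom_one[OF f(1) T.T.is_group P.M.a_group] by simp
  assume t0: "t k m x = \<zero>\<^bsub>P (Suc k)\<^esub>"
  show "pure_tensor R (right_part M) (P k) m x = \<one>\<^bsub>tensor R (right_part M) (P k)\<^esub>"
  proof (cases k)
    case 0
    then obtain r where r: "r \<in> carrier R" "x = Scal r" using x by (auto elim!: P_0_cases)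
    have "right_smult M r m = \<zero>\<^bsub>M\<^esub>" using t0 r m 0 by (simp add: mult_1_0 P_1)
    moreover have "x = r \<odot>\<^bsub>P 0\<^esub> Scal \<one>\<^bsub>R\<^esub>" using r by (simp add: P_0)
    ultimately show ?thesis
      using T.pure_tensor_smult[of m r "Scal \<one>\<^bsub>R\<^esub>"] T.pure_tensor_zero_left[of "Scal \<one>\<^bsub>R\<^esub>"] r m 0 by simp
  next
    case (Suc l)
    have "name_tensor (pure_tensor R (right_part M) (P k) m x) = name_tensor \<one>\<^bsub>tensor R (right_part M) (P k)\<^esub>"
      using t0 Suc P_2(2)[where i = l] by (simp add: tpow_mult.simps)
    then show ?thesis
      using inj_onD[OF inj_on_name_tensor[OF T.tensor_product_axioms]] T.pure_tensor_closed[of m x] m x by simp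
  qed
qed

text \<open>Since the kernel is generated by M, annihilation by it means m \<otimes> s(k) = 0 for
  all m and all k < n. Component n is free, so splitting it off identifies the annihilator with the
  two summands of the test module.\<close>

lemma left_Kasch_trivial_extension_iff:
  assumes n: "n \<ge> 1"
  shows "left_Kasch_ring TYPE('u) S \<longleftrightarrow> (\<forall>X :: ('a, 'u) module. simple_module R X \<longrightarrow>
    module_hom R X (kasch_test_module n R M) \<noteq> {zero_hom X (kasch_test_module n R M)})"
proof -
  interpret E: split_extension R S M "\<lambda>s. the_scal (s 0)" "\<lambda>r. homog 0 (Scal r)" "\<lambda>m. homog 1 (Vec m)"
    "\<lambda>s. the_vec (s 1)" "\<lambda>k. {s \<in> carrier S. \<forall>i<k. i \<le> n \<longrightarrow> s i = \<zero>\<^bsub>P i\<^esub>}" n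
    by (rule split_extension[OF n])
  let ?K = "kasch_test_module n R M"
  let ?A = "\<lambda>k. tensor_annihilator R (right_part M) (P k)"
  let ?\<Phi> = "\<lambda>s. (restrict s {..<n}, s n)"
  have A: "?A k = {x \<in> carrier (P k). \<forall>m\<in>carrier M. t k m x = \<zero>\<^bsub>P (Suc k)\<^esub>}" for k
    using t_trivial_iff by (auto simp: tensor_annihilator_def)
  have K_carrier: "carrier ?K = (\<Pi>\<^sub>E k\<in>{..<n}. ?A k) \<times> carrier (P n)"
    by (auto simp: kasch_test_module_def module_direct_sum_def module_coproduct_def)
  have K_zero: "\<zero>\<^bsub>?K\<^esub> = (\<lambda>k\<in>{..<n}. \<zero>\<^bsub>P k\<^esub>, \<zero>\<^bsub>P n\<^esub>)"
    by (simp add: kasch_test_module_def module_direct_sum_def module_coproduct_def)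
  have K_add: "(f, y) \<oplus>\<^bsub>?K\<^esub> (g, z) = (\<lambda>k\<in>{..<n}. f k \<oplus>\<^bsub>P k\<^esub> g k, y \<oplus>\<^bsub>P n\<^esub> z)" for f g y z
    by (simp add: kasch_test_module_def module_direct_sum_def module_coproduct_def)
  have K_smult: "r \<odot>\<^bsub>?K\<^esub> (f, y) = (\<lambda>k\<in>{..<n}. r \<odot>\<^bsub>P k\<^esub> f k, r \<odot>\<^bsub>P n\<^esub> y)" for r f y
    by (simp add: kasch_test_module_def module_direct_sum_def module_coproduct_def)
  have N: "E.kernel_annihilator = {s \<in> carrier S. \<forall>k<n. s k \<in> ?A k}" (is "?N = _")
  proof (rule equalityI; rule subsetI)
    fix s assume s: "s \<in> ?N"
    have "s k \<in> ?A k" if k: "k < n" for k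
    proof -
      have "t k m (s k) = \<zero>\<^bsub>P (Suc k)\<^esub>" if "m \<in> carrier M" for m
      proof -
        have "homog 1 (Vec m) \<otimes>\<^bsub>S\<^esub> s = \<zero>\<^bsub>S\<^esub>" using s that E.\<pi>_j E.j_closed by blast
        \<comment> \<open>Component k + 1 exists because k < n, and there the product is m \<otimes>
          s(k).\<close>
        from fun_cong[OF this, of "Suc k"] show ?thesis
          using homog_mult[of "Vec m" 1 s "Suc k"] s k that by simp
      qed
      then show ?thesis unfolding A using s k by simp
    qed
    then show "s \<in> {s \<in> carrier S. \<forall>k<n. s k \<in> ?A k}" using s by simp
  next
    fix s assume s: "s \<in> {s \<in> carrier S. \<forall>k<n. s k \<in> ?A k}"
    show "s \<in> ?N"
    proof (intro CollectI conjI ballI)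
      fix i assume "i \<in> E.I"
      then have "i \<in> carrier S" "the_scal (i 0) = \<zero>\<^bsub>R\<^esub>" by auto
      then show "i \<otimes>\<^bsub>S\<^esub> s = \<zero>\<^bsub>S\<^esub>"
      proof (induction rule: E.ideal_induct)
        case (gen m)
        \<comment> \<open>Component 0 vanishes because the left factor sits in degree one. A
          component k > 0 involves \<open>s\<close> at k - 1 < n, where the annihilator condition
          applies.\<close>
        have "(homog 1 (Vec m) \<otimes>\<^bsub>S\<^esub> s) k = \<zero>\<^bsub>P k\<^esub>" if "k \<le> n" for k
          using homog_mult[of "Vec m" 1 s k] s gen that A[of "k - 1"] by (cases k) auto
        then show ?case using s gen by (intro S_eq_zeroI) auto
      next
        case (mult m x)
        then show ?case using s E.S.m_assoc[of "homog 1 (Vec m)" x s] by simp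
      next
        case (add x y)
        then show ?case using s by (simp add: E.S.l_distr)
      qed (use s in simp)
    qed (use s in simp)
  qed
  have "linear_map R E.annihilator_module ?K ?\<Phi>"
    unfolding linear_map_def restrict_scalars_simps
  proof (intro conjI ballI)
    show "?\<Phi> \<in> carrier (regular_module S\<lparr>carrier := ?N\<rparr>) \<rightarrow> carrier ?K"
      unfolding N K_carrier by auto
  next
    fix r s assume r: "r \<in> carrier R" and "s \<in> carrier (regular_module S\<lparr>carrier := ?N\<rparr>)"
    then have s: "s \<in> carrier S" by simp
    have "(homog 0 (Scal r) \<otimes>\<^bsub>S\<^esub> s) k = r \<odot>\<^bsub>P k\<^esub> s k" if "k \<le> n" for k
      using r s that by (simp add: homog_mult mult_0)
    then show "?\<Phi> (homog 0 (Scal r) \<odot>\<^bsub>regular_module S\<lparr>carrier := ?N\<rparr>\<^esub> s) = r \<odot>\<^bsub>?K\<^esub> ?\<Phi> s"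
      by (auto simp: K_smult)
  qed (auto simp: K_add)
  moreover have "inj_on ?\<Phi> ?N"
  proof
    fix s s' assume ss: "s \<in> ?N" "s' \<in> ?N" and eq: "?\<Phi> s = ?\<Phi> s'"
    show "s = s'"
    proof (rule S_eqI)
      fix k assume "k \<le> n"
      then show "s k = s' k" using eq by (cases "k = n") (auto dest: fun_cong[of _ _ k])
    qed (use ss in auto)
  qed
  moreover have "?\<Phi> ` ?N = carrier ?K"
  proof
    show "carrier ?K \<subseteq> ?\<Phi> ` ?N"
    proof
      fix z assume "z \<in> carrier ?K"
      then obtain f y where z: "z = (f, y)" "f \<in> (\<Pi>\<^sub>E k\<in>{..<n}. ?A k)" "y \<in> carrier (P n)"
        unfolding K_carrier by auto
      let ?s = "\<lambda>k\<in>{..n}. if k < n then f k else y"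
      have "?s \<in> carrier S"
        unfolding trivial_extension_simps(1) using z(2,3) by (auto simp: A PiE_iff)
      then have "?s \<in> ?N"
        unfolding N using z(2) by (auto simp: PiE_iff)
      moreover have "?\<Phi> ?s = z"
        using z by (auto simp: PiE_iff extensional_def fun_eq_iff)
      ultimately show "z \<in> ?\<Phi> ` ?N" by blast
    qed
    show "?\<Phi> ` ?N \<subseteq> carrier ?K" unfolding N K_carrier by (auto split: if_splits)
  qed
  moreover have "?\<Phi> \<zero>\<^bsub>S\<^esub> = \<zero>\<^bsub>?K\<^esub>"
    by (auto simp: K_zero)
  ultimately show ?thesis by (rule E.left_Kasch_ring_iff)
qed

end

end

theorem theorem3p4:
  fixes R :: "('a, 'r) ring_scheme" and M :: "('a, 'm, 'z) bimodule_scheme" and n :: nat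
  assumes "ring R" and "\<one>\<^bsub>R\<^esub> \<noteq> \<zero>\<^bsub>R\<^esub>" and "bimodule R M" and "n \<ge> 1"
  shows "(semisimple_artinian_ring (trivial_extension n R M) \<longleftrightarrow>
           semisimple_artinian_ring R \<and>
           (\<forall>X :: ('a, ('a, 'm, 'v) univ) module. simple_module R X \<longrightarrow>
              carrier (tensor R (right_part M) X) = {\<one>\<^bsub>tensor R (right_part M) X\<^esub>}))
         \<and> (left_SF_ring TYPE(('a, 'm, 'v) univ) (trivial_extension n R M) \<longleftrightarrow>
           left_SF_ring TYPE(('a, 'm, 'v) univ) R \<and>
           (\<forall>X :: ('a, ('a, 'm, 'v) univ) module. simple_module R X \<longrightarrow>
              carrier (tensor R (right_part M) X) = {\<one>\<^bsub>tensor R (right_part M) X\<^esub>}))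
         \<and> (left_V_ring TYPE(('a, 'm, 'v) univ) (trivial_extension n R M) \<longleftrightarrow>
           left_V_ring TYPE(('a, 'm, 'v) univ) R \<and>
           (\<forall>X :: ('a, ('a, 'm, 'v) univ) module. simple_module R X \<longrightarrow>
              module_hom R M X = {zero_hom M X}))
         \<and> (left_Kasch_ring TYPE(('a, 'm, 'v) univ) (trivial_extension n R M) \<longleftrightarrow>
           (\<forall>X :: ('a, ('a, 'm, 'v) univ) module. simple_module R X \<longrightarrow>
              module_hom R X (kasch_test_module n R M) \<noteq> {zero_hom X (kasch_test_module n R M)}))"
proof -
  interpret B: bimod R M by (rule bimod.intro[OF assms(3)])
  interpret E: split_extension R "trivial_extension n R M" M "\<lambda>s. the_scal (s 0)"
    "\<lambda>r. B.homog n 0 (Scal r)" "\<lambda>m. B.homog n 1 (Vec m)" "\<lambda>s. the_vec (s 1)"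
    "\<lambda>k. {s \<in> carrier (trivial_extension n R M). \<forall>i<k. i \<le> n \<longrightarrow> s i = \<zero>\<^bsub>tensor_power R M i\<^esub>}" n
    by (rule B.split_extension[OF assms(4)])
  \<comment> \<open>The first summand of \<open>univ\<close> consists of sets of functions of the
    type of the extension's elements, so singletons provide the injection.\<close>
  let ?e = "\<lambda>s. Inl {s} :: ('a, 'm, 'v) univ"
  have e: "inj_on ?e (carrier (trivial_extension n R M))" by (simp add: inj_on_def)
  show ?thesis
    using E.semisimple_artinian_ring_iff[OF e] E.left_SF_ring_iff[OF e] E.left_V_ring_iff[OF e]
      B.left_Kasch_trivial_extension_iff[OF assms(4), where 'u = "('a, 'm, 'v) univ"]
    by (intro conjI)
qed

end
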